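(* Let $-1<s<0$. There is a constant $C$, depending only on $s$, such that for all non-negative smooth functions $f,g$ on $\mathbb{R}^2\times\mathbb{R}$ the following four estimates hold: $$\Big\|\frac{w}{\langle\tau-|\xi|^2\rangle}\Big(\frac{f^{K^c}}{w}*\frac{g^{K^c}}{w}\Big)\Big\|_{Z^s}\le C\,\|f^{K^c}\|_{Y^s}\|g^{K^c}\|_{Y^s},$$ $$\Big\|\frac{w}{\langle\tau-|\xi|^2\rangle}\Big(\frac{f^{K}}{w}*\frac{g^{K}}{w}\Big)\Big\|_{Z^s}\le C\,\|f^{K}\|_{\hat X^{s,1/2,1}}\|g^{K}\|_{\hat X^{s,1/2,1}},$$ $$\Big\|\frac{\chi_K\,w}{\langle\tau-|\xi|^2\rangle}\Big(\frac{f^{K}}{w}*\frac{g^{K^c}}{w}\Big)\Big\|_{\hat X^{s,1/2,1}}\le C\,\|f^{K}\|_{\hat X^{s,1/2,1}}\|g^{K^c}\|_{Y^s},$$ $$\Big\|\frac{(1-\chi_K)\,w}{\langle\tau-|\xi|^2\rangle}\Big(\frac{f^{K}}{w}*\frac{g^{K^c}}{w}\Big)\Big\|_{Y^s}\le C\,\|f^{K}\|_{\hat X^{s,1/2,1}}\|g^{K^c}\|_{Y^s}.$$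
   Context: Functions are functions of $(\xi,\tau)\in\mathbb{R}^2\times\mathbb{R}$, and $f*g$ is the space-time convolution $f*g(\xi,\tau)=\int_{\mathbb{R}}\int_{\mathbb{R}^2}f(\xi_1,\tau_1)g(\xi-\xi_1,\tau-\tau_1)\,d\xi_1d\tau_1$. Notation: $\langle a\rangle:=1+|a|$, and $|(\xi,\tau)|:=(|\tau|+|\xi|^2)^{1/2}$, so $\langle(\xi,\tau)\rangle=1+(|\tau|+|\xi|^2)^{1/2}$. $\chi_A$ is the characteristic function of $A$. For integers $j,d\ge0$ set $A_j:=\{(\xi,\tau)\in\mathbb{R}^2\times\mathbb{R}:2^j\le\langle\xi\rangle<2^{j+1}\}$, $B_d:=\{(\xi,\tau)\in\mathbb{R}^2\times\mathbb{R}:2^d\le\langle\tau-|\xi|^2\rangle<2^{d+1}\}$, $B_{\le d}:=\bigcup_{0\le d'\le d}B_{d'}$ (empty if $d<0$), and $f_{j,d}:=\chi_{A_j\cap B_d}f$. Let $K:=\bigcup_{j\ge0}(A_j\cap B_{\le 2j-4})$, let $K^c$ be its complement, and set $f^K:=\chi_Kf$, $f^{K^c}:=\chi_{K^c}f$. The weight is $w(\xi,\tau):=\max(1,-\tau)^{10}$. Norms: $\|f\|_{L^2_\xi L^p_\tau}$ is the $L^2$ norm in $\xi\in\mathbb{R}^2$ of the $L^p$ norm in $\tau\in\mathbb{R}$. Then $$\|f\|_{\hat X^{s,b,1}}:=\Big(\sum_{j\ge0}2^{2sj}\Big(\sum_{d\ge0}2^{bd}\|f_{j,d}\|_{L^2_\xi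 L^2_\tau}\Big)^2\Big)^{1/2},$$ $$\|f\|_{Y^s}:=\|\langle\xi\rangle^sf\|_{L^2_\xi L^1_\tau}+\|\langle(\xi,\tau)\rangle^{s+1}f\|_{L^2_\xi L^2_\tau},$$ and $Z^s:=\hat X^{s,1/2,1}+Y^s$ with the norm $$\|f\|_{Z^s}:=\inf\{\|f_1\|_{\hat X^{s,1/2,1}}+\|f_2\|_{Y^s}: f=f_1+f_2,\ f_1\in\hat X^{s,1/2,1},\ f_2\in Y^s\}.$$ *)

theory Defs
  imports "HOL-Analysis.Analysis"
begin

type_synonym spacetime = "(real ^ 2) \<times> real"


subsection \<open>Smooth functions\<close>

text \<open>\<open>C_n n f\<close>: all iterated directional derivatives of \<open>f\<close> of order at most \<open>n\<close> exist
  and are continuous.\<close>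

primrec C_n :: "nat \<Rightarrow> ('a::real_normed_vector \<Rightarrow> 'b::real_normed_vector) \<Rightarrow> bool" where
  "C_n 0 f \<longleftrightarrow> continuous_on UNIV f"
| "C_n (Suc n) f \<longleftrightarrow> (\<forall>x. f differentiable (at x)) \<and>
     (\<forall>v. C_n n (\<lambda>x. frechet_derivative f (at x) v))"

definition smooth :: "('a::real_normed_vector \<Rightarrow> 'b::real_normed_vector) \<Rightarrow> bool" where
  "smooth f \<longleftrightarrow> (\<forall>n. C_n n f)"


subsection \<open>Brackets, frequency regions and the weight\<close>

definition bracket :: "'a::real_normed_vector \<Rightarrow> real" where
  "bracket a = 1 + norm a"

definition parabolic_abs :: "spacetime \<Rightarrow> real" where
  "parabolic_abs = (\<lambda>(\<xi>, \<tau>). sqrt (\<bar>\<tau>\<bar> + (norm \<xi>)\<^sup>2))"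

definition A_set :: "nat \<Rightarrow> spacetime set" where
  "A_set j = {(\<xi>, \<tau>). 2 ^ j \<le> bracket \<xi> \<and> bracket \<xi> < 2 ^ (j + 1)}"

definition B_set :: "nat \<Rightarrow> spacetime set" where
  "B_set d = {(\<xi>, \<tau>). 2 ^ d \<le> bracket (\<tau> - (norm \<xi>)\<^sup>2) \<and> bracket (\<tau> - (norm \<xi>)\<^sup>2) < 2 ^ (d + 1)}"

text \<open>The bound is an integer, since \<open>2j - 4\<close> is negative for \<open>j < 2\<close>.\<close>

definition B_le :: "int \<Rightarrow> spacetime set" where
  "B_le d = (\<Union>d'\<in>{d'. int d' \<le> d}. B_set d')"

definition K_set :: "spacetime set" where
  "K_set = (\<Union>j. A_set j \<inter> B_le (2 * int j - 4))"

definition restr :: "spacetime set \<Rightarrow> (spacetime \<Rightarrow> real) \<Rightarrow> spacetime \<Rightarrow> real" where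
  "restr S f = (\<lambda>p. indicator S p * f p)"

definition weight :: "spacetime \<Rightarrow> real" where
  "weight = (\<lambda>(\<xi>, \<tau>). max 1 (- \<tau>) ^ 10)"

definition modulation :: "spacetime \<Rightarrow> real" where
  "modulation = (\<lambda>(\<xi>, \<tau>). bracket (\<tau> - (norm \<xi>)\<^sup>2))"


subsection \<open>Space-time convolution\<close>

definition conv :: "(spacetime \<Rightarrow> real) \<Rightarrow> (spacetime \<Rightarrow> real) \<Rightarrow> spacetime \<Rightarrow> real" where
  "conv f g p = (LINT q|lborel. f q * g (p - q))"

text \<open>Where the defining integral diverges, \<^const>\<open>conv\<close> takes the default value 0 of the
  Bochner integral; the following predicate says that this happens only on a null set.\<close>

definition conv_defined :: "(spacetime \<Rightarrow> real) \<Rightarrow> (spacetime \<Rightarrow> real) \<Rightarrow> bool" where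
  "conv_defined f g \<longleftrightarrow> (AE p in lborel. integrable lborel (\<lambda>q. f q * g (p - q)))"


subsection \<open>Norms, with values in \<open>[0, \<infinity>]\<close>\<close>

text \<open>Powers of extended nonnegative reals with exponent \<open>a > 0\<close>.\<close>

definition epowr :: "ennreal \<Rightarrow> real \<Rightarrow> ennreal" where
  "epowr x a = (if x = top then top else ennreal (enn2real x powr a))"

definition Lp_norm :: "real \<Rightarrow> 'a measure \<Rightarrow> ('a \<Rightarrow> ennreal) \<Rightarrow> ennreal" where
  "Lp_norm p M F = epowr (\<integral>\<^sup>+ x. epowr (F x) p \<partial>M) (1 / p)"

definition L2Lp_norm :: "real \<Rightarrow> (spacetime \<Rightarrow> real) \<Rightarrow> ennreal" where
  "L2Lp_norm p f =
     Lp_norm 2 lborel (\<lambda>\<xi>::real ^ 2. Lp_norm p lborel (\<lambda>\<tau>::real. ennreal \<bar>f (\<xi>, \<tau>)\<bar>))"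

definition X_norm :: "real \<Rightarrow> real \<Rightarrow> (spacetime \<Rightarrow> real) \<Rightarrow> ennreal" where
  "X_norm s b f =
     epowr (\<Sum>j. ennreal (2 powr (2 * s * real j)) *
       (\<Sum>d. ennreal (2 powr (b * real d)) * L2Lp_norm 2 (restr (A_set j \<inter> B_set d) f))\<^sup>2) (1 / 2)"

definition Y_norm :: "real \<Rightarrow> (spacetime \<Rightarrow> real) \<Rightarrow> ennreal" where
  "Y_norm s f =
     L2Lp_norm 1 (\<lambda>(\<xi>, \<tau>). bracket \<xi> powr s * f (\<xi>, \<tau>)) +
     L2Lp_norm 2 (\<lambda>p. bracket (parabolic_abs p) powr (s + 1) * f p)"

definition X_space :: "real \<Rightarrow> real \<Rightarrow> (spacetime \<Rightarrow> real) set" where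
  "X_space s b = {f. f \<in> borel_measurable borel \<and> X_norm s b f < top}"

definition Y_space :: "real \<Rightarrow> (spacetime \<Rightarrow> real) set" where
  "Y_space s = {f. f \<in> borel_measurable borel \<and> Y_norm s f < top}"

text \<open>Functions are identified when they agree almost everywhere. The infimum of the empty set
  is \<open>\<infinity>\<close>, so functions outside the sum space have infinite norm.\<close>

definition Z_norm :: "real \<Rightarrow> (spacetime \<Rightarrow> real) \<Rightarrow> ennreal" where
  "Z_norm s f = Inf {X_norm s (1/2) f1 + Y_norm s f2 | f1 f2.
     f1 \<in> X_space s (1/2) \<and> f2 \<in> Y_space s \<and> (AE p in lborel. f p = f1 p + f2 p)}"

subsection \<open>The weighted bilinear expression\<close>

definition over_weight :: "(spacetime \<Rightarrow> real) \<Rightarrow> spacetime \<Rightarrow> real" where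
  "over_weight f = (\<lambda>p. f p / weight p)"

definition bilin :: "(spacetime \<Rightarrow> real) \<Rightarrow> (spacetime \<Rightarrow> real) \<Rightarrow> spacetime \<Rightarrow> real" where
  "bilin f g = (\<lambda>p. weight p / modulation p * conv (over_weight f) (over_weight g) p)"

end

theory Submission
  imports Defs
begin

text \<open>
  Let \<open>\<delta> = s + 1\<close>, write \<open>N = \<langle>\<xi>\<rangle>\<close>, \<open>M = \<langle>\<tau> - |\<xi>|\<^sup>2\<rangle>\<close>, \<open>L = \<langle>(\<xi>, \<tau>)\<rangle>\<close>, and fix a small \<open>\<eta> > 0\<close>.
  Summing geometric series, the \<open>X\<close> norm, and off \<open>K\<close> also the \<open>Y\<close> norm, of an output is dominated by
  the \<open>L\<^sup>2\<close> norm with weight \<open>N\<^sup>s M\<^bsup>1/2 + \<eta>\<^esup>\<close>, while the input norms dominate the \<open>L\<^sup>2\<close> norms with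
  weights \<open>N\<^sup>s M\<^bsup>1/2\<^esup>\<close> and \<open>L\<^sup>\<delta>\<close>. By duality the estimates become \<open>L\<^sup>2\<close> bounds for trilinear forms
  \<open>\<integral>\<integral> F(x) G(y) H(x + y) k(x, y)\<close>, and it remains to majorise the weighted kernel pointwise by
  kernels whose forms are bounded:

  \<^item> products of \<open>M\<^bsup>-1/2 - \<eta>\<^esup>\<close> and \<open>N\<^bsup>-1 - \<eta>\<^esup>\<close>, by integrating out one variable;
  \<^item> products of two factors \<open>M\<^bsup>-1/2 - \<eta>\<^esup>\<close>, by the \<open>L\<^sup>4\<close> Strichartz estimate;
  \<^item> if one of the functions has very low frequency, by measuring a slice of a paraboloid in a strip;
  \<^item> for three factors in \<open>K\<close>, a Loomis--Whitney estimate, which rests on the fact that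
    \<open>|\<xi>\<^sub>1 + \<xi>\<^sub>2|\<^sup>2 - |\<xi>\<^sub>1|\<^sup>2 - |\<xi>\<^sub>2|\<^sup>2 = 2 \<xi>\<^sub>1 \<cdot> \<xi>\<^sub>2\<close> is small only for nearly orthogonal frequencies.

  When \<open>K \<times> K\<^sup>c\<close> interacts to an output of much smaller parabolic size, the second factor lives at time
  frequency about \<open>- N\<^sub>1\<^sup>2\<close>, where the ratio of the weights \<open>w\<close> gives as many powers of \<open>N\<^sub>1\<close> as needed.
  For outputs of \<open>K \<times> K\<close> off \<open>K\<close> the \<open>L\<^sup>2\<^sub>\<xi> L\<^sup>1\<^sub>\<tau>\<close> part of the \<open>Y\<close> norm is not covered by the weighted
  \<open>L\<^sup>2\<close> norm in a favourable way, and is estimated by Young's inequality in \<open>\<xi>\<close> instead.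
\<close>

subsection \<open>Square roots and the L2 norm in the extended nonnegative reals\<close>

text \<open>The critical case is three functions in \<open>K\<close> with all frequencies of size N:
  the weights N^(\<delta> - 1) on the output and on both inputs leave N^(1 - \<delta>) to be gained.
  Strichartz gains no power of N. Transversality gains (N1 N2)^(-1/2), a full power of N, which
  suffices for every \<delta> > 0, that is s > -1, but leaves only N^\<delta> to spare. All other
  losses are charged to such a margin. The \<open>X\<close> norm carries the exponent 1/2 of the
  modulation with an \<open>l^1\<close> sum, while the kernels need 1/2 + \<eta>. Since M is at most
  N^2 / 8 in \<open>K\<close> and at most L^2 everywhere, M^\<eta> costs N^(2 \<eta>) or L^(2
  \<eta>). The condition s < 0 enters through L^s \<le> N^s. Kernels keep the dyadic sums out of the
  case analysis: a kernel may be majorised pointwise by a sum of others, and permuting the three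
  functions gives one bound several roles. With values in [0, \<infinity>] nothing has to be finite
  in advance; convergence of the convolution almost everywhere is read off from the same L2
  bounds.\<close>

lemma epowr_2: "epowr x 2 = x ^ 2"
proof (cases "x = top")
  case True then show ?thesis by (simp add: epowr_def)
next
  case False
  then obtain r where "x = ennreal r" "r \<ge> 0" by (cases x) auto
  then show ?thesis by (simp add: epowr_def ennreal_power)
qed

abbreviation esqrt :: "ennreal \<Rightarrow> ennreal" where
  "esqrt x \<equiv> epowr x (1 / 2)"

lemma esqrt_power2 [simp]: "esqrt x ^ 2 = x"
proof (cases "x = top")
  case True then show ?thesis by (simp add: epowr_def)
next
  case False
  then obtain r where "x = ennreal r" "r \<ge> 0" by (cases x) auto
  then show ?thesis by (simp add: epowr_def ennreal_power powr_half_sqrt)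
qed

lemma power2_le_imp_le_ennreal:
  fixes a b :: ennreal
  assumes "a ^ 2 \<le> b ^ 2" shows "a \<le> b"
proof (cases "b = top")
  case False
  then obtain r where r: "b = ennreal r" "r \<ge> 0" by (cases b) auto
  have "a \<noteq> top" using assms r by (auto simp: ennreal_power top_unique)
  then obtain q where q: "a = ennreal q" "q \<ge> 0" by (cases a) auto
  have "q ^ 2 \<le> r ^ 2" using assms by (simp add: r q ennreal_power)
  then show ?thesis using r q by (simp add: power2_le_iff_abs_le)
qed simp

lemma power2_le_iff_ennreal:
  fixes a b :: ennreal
  shows "a ^ 2 \<le> b ^ 2 \<longleftrightarrow> a \<le> b"
  using power2_le_imp_le_ennreal power_mono[of a b 2] by auto

lemma power2_eq_iff_ennreal:
  fixes a b :: ennreal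
  shows "a ^ 2 = b ^ 2 \<longleftrightarrow> a = b"
  by (metis power2_le_iff_ennreal antisym order_refl)

lemma esqrt_of_power2 [simp]: "esqrt (x ^ 2) = x"
  by (metis power2_eq_iff_ennreal esqrt_power2)

lemma esqrt_le_iff: "esqrt x \<le> y \<longleftrightarrow> x \<le> y ^ 2"
  by (metis power2_le_iff_ennreal esqrt_power2)

lemma esqrt_mono: "x \<le> y \<Longrightarrow> esqrt x \<le> esqrt y"
  by (simp add: esqrt_le_iff)

lemma esqrt_mult: "esqrt (x * y) = esqrt x * esqrt y"
  by (metis power_mult_distrib esqrt_of_power2 esqrt_power2)

lemma esqrt_less_top_iff: "esqrt x < top \<longleftrightarrow> x < top"
  by (metis power_less_top_ennreal esqrt_power2 zero_neq_numeral)

lemma measurable_esqrt [measurable]: "esqrt \<in> borel_measurable borel"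
  unfolding epowr_def by measurable

definition l2 :: "('a::euclidean_space \<Rightarrow> ennreal) \<Rightarrow> ennreal" where
  "l2 F = esqrt (\<integral>\<^sup>+ x. F x ^ 2 \<partial>lborel)"

lemma l2_power2: "l2 F ^ 2 = (\<integral>\<^sup>+ x. F x ^ 2 \<partial>lborel)"
  by (simp add: l2_def)

lemma l2_mono: "(\<And>x. F x \<le> G x) \<Longrightarrow> l2 F \<le> l2 G"
  unfolding l2_def by (intro esqrt_mono nn_integral_mono power_mono) auto

lemma nn_integral_mult_le_esqrt:
  assumes [measurable]: "F \<in> borel_measurable M" "G \<in> borel_measurable M"
  shows "(\<integral>\<^sup>+ x. F x * G x \<partial>M) \<le> esqrt (\<integral>\<^sup>+ x. F x ^ 2 \<partial>M) * esqrt (\<integral>\<^sup>+ x. G x ^ 2 \<partial>M)"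
  by (rule power2_le_imp_le_ennreal)
    (simp add: power_mult_distrib Cauchy_Schwarz_nn_integral)

lemma nn_integral_mult_le_l2:
  assumes "F \<in> borel_measurable borel" "G \<in> borel_measurable borel"
  shows "(\<integral>\<^sup>+ x. F x * G x \<partial>lborel) \<le> l2 F * l2 G"
  unfolding l2_def by (rule nn_integral_mult_le_esqrt) (use assms in auto)

lemma nn_integral_lborel_plus:
  fixes F :: "'a::euclidean_space \<Rightarrow> ennreal"
  assumes [measurable]: "F \<in> borel_measurable borel"
  shows "(\<integral>\<^sup>+ x. F (a + x) \<partial>lborel) = (\<integral>\<^sup>+ x. F x \<partial>lborel)"
proof -
  have "(\<integral>\<^sup>+ x. F x \<partial>lborel) = (\<integral>\<^sup>+ x. F x \<partial>distr lborel borel ((+) a))"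
    by (simp add: lborel_distr_plus)
  then show ?thesis by (subst (asm) nn_integral_distr) auto
qed

lemma nn_integral_lborel_diff:
  fixes F :: "'a::euclidean_space \<Rightarrow> ennreal"
  assumes [measurable]: "F \<in> borel_measurable borel"
  shows "(\<integral>\<^sup>+ x. F (a - x) \<partial>lborel) = (\<integral>\<^sup>+ x. F x \<partial>lborel)"
proof -
  have "(\<integral>\<^sup>+ x. F x \<partial>lborel) = (\<integral>\<^sup>+ x. F x \<partial>(density (distr lborel borel (\<lambda>x. a + (- 1) *\<^sub>R x)) (\<lambda>_. ennreal (\<bar>- 1\<bar> ^ DIM('a)))))"
    by (subst lborel_affine[of "-1" a]) auto
  then show ?thesis by (simp add: nn_integral_density nn_integral_distr)
qed

text \<open>Testing with \<open>S\<close> itself would require cancelling \<open>l2 S\<close>, which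
  may be infinite. The truncations \<open>H n\<close>, capped at \<open>n\<close> and cut off to the
  ball of radius \<open>n\<close>, have finite norm, satisfy the bound after cancellation, and
  increase to \<open>S\<close>.\<close>

lemma l2_dual:
  fixes S :: "'a::euclidean_space \<Rightarrow> ennreal"
  assumes [measurable]: "S \<in> borel_measurable borel"
    and *: "\<And>H. H \<in> borel_measurable borel \<Longrightarrow> (\<integral>\<^sup>+ x. S x * H x \<partial>lborel) \<le> A * l2 H"
  shows "l2 S \<le> A"
proof -
  define H :: "nat \<Rightarrow> 'a \<Rightarrow> ennreal" where
    "H n x = min (S x) (of_nat n) * indicator (cball 0 (real n)) x" for n x
  have [measurable]: "H n \<in> borel_measurable borel" for n
    unfolding H_def
    by (intro borel_measurable_times_ennreal borel_measurable_min borel_measurable_indicator) simp_all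
  have HS: "H n x \<le> S x" for n x by (auto simp: H_def indicator_def)
  have fin: "(\<integral>\<^sup>+ x. H n x ^ 2 \<partial>lborel) < top" for n
  proof -
    have "(\<integral>\<^sup>+ x. H n x ^ 2 \<partial>lborel) \<le> (\<integral>\<^sup>+ x. of_nat n ^ 2 * indicator (cball (0::'a) (real n)) x \<partial>lborel)"
      by (intro nn_integral_mono) (auto simp: H_def indicator_def intro!: power_mono)
    also have "\<dots> = of_nat n ^ 2 * emeasure lborel (cball (0::'a) (real n))"
      by (simp add: nn_integral_cmult_indicator)
    also have "\<dots> < top"
      using emeasure_lborel_cball_finite[of "0::'a" "real n"]
      by (simp add: ennreal_mult_less_top power_less_top_ennreal of_nat_less_top)
    finally show ?thesis .
  qed
  have le: "(\<integral>\<^sup>+ x. H n x ^ 2 \<partial>lborel) \<le> A ^ 2" for n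
  proof -
    have "l2 (H n) ^ 2 = (\<integral>\<^sup>+ x. H n x * H n x \<partial>lborel)"
      unfolding l2_power2 by (simp add: power2_eq_square)
    also have "\<dots> \<le> (\<integral>\<^sup>+ x. S x * H n x \<partial>lborel)"
      by (intro nn_integral_mono mult_right_mono HS) auto
    also have "\<dots> \<le> A * l2 (H n)" by (rule *) simp
    finally have 1: "l2 (H n) * l2 (H n) \<le> A * l2 (H n)" by (simp add: power2_eq_square)
    have "l2 (H n) < top" unfolding l2_def esqrt_less_top_iff by (rule fin)
    then have "l2 (H n) \<noteq> top" by simp
    then have "l2 (H n) \<le> A"
      using 1 ennreal_mult_le_mult_iff[of "l2 (H n)" "l2 (H n)" A]
      by (cases "l2 (H n) = 0") (simp_all add: mult.commute)
    then show ?thesis by (metis l2_power2 power2_le_iff_ennreal)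
  qed
  have "(\<integral>\<^sup>+ x. S x ^ 2 \<partial>lborel) = (\<integral>\<^sup>+ x. (SUP n. H n x ^ 2) \<partial>lborel)"
  proof (rule nn_integral_cong)
    fix x :: 'a
    have "(SUP n. H n x ^ 2) = S x ^ 2"
    proof (rule antisym)
      show "(SUP n. H n x ^ 2) \<le> S x ^ 2" by (intro SUP_least power_mono HS) auto
      obtain m :: nat where m: "norm x \<le> real m" using real_arch_simple by blast
      show "S x ^ 2 \<le> (SUP n. H n x ^ 2)"
      proof (cases "S x = top")
        assume T: "S x = top"
        have "of_nat n \<le> (SUP n. H n x ^ 2)" for n
        proof -
          \<comment> \<open>Here \<open>S x\<close> is infinite, so \<open>H (m + n + 1) x\<close>
            equals its cap; the index exceeds \<open>m\<close> so that \<open>x\<close> lies in the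
            ball.\<close>
          have "n \<le> (m + n + 1) ^ 2" by (simp add: power2_eq_square algebra_simps)
          then have "(of_nat n :: ennreal) \<le> of_nat (m + n + 1) ^ 2"
            unfolding of_nat_power[symmetric] by (rule of_nat_mono)
          also have "\<dots> = H (m + n + 1) x ^ 2"
            using m by (simp add: H_def T)
          also have "\<dots> \<le> (SUP n. H n x ^ 2)" by (rule SUP_upper) simp
          finally show ?thesis .
        qed
        then have "(SUP n. of_nat n) \<le> (SUP n. H n x ^ 2)" by (rule SUP_least)
        then show ?thesis unfolding ennreal_SUP_of_nat_eq_top by (rule order_trans[OF top_greatest])
      next
        assume T: "S x \<noteq> top"
        then obtain n :: nat where n: "S x \<le> of_nat n"
          by (metis ennreal_Ex_less_of_nat less_imp_le less_top)
        have "S x ^ 2 = H (max m n) x ^ 2"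
        proof -
          have "S x \<le> of_nat (max m n)" using n by (rule order_trans) (simp add: of_nat_mono)
          then show ?thesis using m by (auto simp: H_def min_absorb1)
        qed
        also have "\<dots> \<le> (SUP n. H n x ^ 2)" by (rule SUP_upper) simp
        finally show ?thesis .
      qed
    qed
    then show "S x ^ 2 = (SUP n. H n x ^ 2)" by simp
  qed
  also have "\<dots> = (SUP n. \<integral>\<^sup>+ x. H n x ^ 2 \<partial>lborel)"
  proof (rule nn_integral_monotone_convergence_SUP)
    show "incseq (\<lambda>n x. H n x ^ 2)"
      by (auto simp: incseq_def le_fun_def H_def indicator_def intro!: power_mono min.mono of_nat_mono)
  qed simp
  also have "\<dots> \<le> A ^ 2" by (intro SUP_least le)
  finally show ?thesis by (simp add: l2_def esqrt_le_iff)
qed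

subsection \<open>Trilinear convolution forms with a kernel\<close>

definition triform :: "('a::euclidean_space \<Rightarrow> 'a \<Rightarrow> real) \<Rightarrow> ('a \<Rightarrow> ennreal) \<Rightarrow> ('a \<Rightarrow> ennreal) \<Rightarrow> ('a \<Rightarrow> ennreal) \<Rightarrow> ennreal" where
  "triform k F G H = (\<integral>\<^sup>+ x. \<integral>\<^sup>+ y. F x * G y * H (x + y) * ennreal (k x y) \<partial>lborel \<partial>lborel)"

definition kernel :: "('a::euclidean_space \<Rightarrow> 'a \<Rightarrow> real) \<Rightarrow> bool" where
  "kernel k \<longleftrightarrow> (\<lambda>z. k (fst z) (snd z)) \<in> borel_measurable (borel \<Otimes>\<^sub>M borel) \<and> (\<forall>x y. 0 \<le> k x y)"

text \<open>By duality in \<open>H\<close>, \<open>C\<close> bounds the norm from L2 x L2 to L2 of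
  the bilinear convolution with kernel \<open>k\<close>; see \<open>tri_bilinear\<close>. The
  trilinear form is kept because, up to reflections, its three functions can be permuted.\<close>

definition tri :: "('a::euclidean_space \<Rightarrow> 'a \<Rightarrow> real) \<Rightarrow> real \<Rightarrow> bool" where
  "tri k C \<longleftrightarrow> kernel k \<and> 0 \<le> C \<and>
    (\<forall>F\<in>borel_measurable borel. \<forall>G\<in>borel_measurable borel. \<forall>H\<in>borel_measurable borel.
       triform k F G H \<le> ennreal C * (l2 F * l2 G * l2 H))"

lemma kernel_measurable:
  "kernel k \<Longrightarrow> (\<lambda>z. k (fst z) (snd z)) \<in> borel_measurable (borel \<Otimes>\<^sub>M borel)"
  by (simp add: kernel_def)

lemma kernel_nonneg: "kernel k \<Longrightarrow> 0 \<le> k x y"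
  by (simp add: kernel_def)

lemma kernel_measurable_compose:
  assumes "kernel k" "f \<in> measurable M borel" "g \<in> measurable M borel"
  shows "(\<lambda>z. k (f z) (g z)) \<in> borel_measurable M"
  using measurable_compose[OF measurable_Pair[OF assms(2,3)] kernel_measurable[OF assms(1)]]
  by simp

lemma triD:
  assumes "tri k C" "F \<in> borel_measurable borel" "G \<in> borel_measurable borel" "H \<in> borel_measurable borel"
  shows "triform k F G H \<le> ennreal C * (l2 F * l2 G * l2 H)"
  using assms by (auto simp: tri_def)

lemma tri_kernel: "tri k C \<Longrightarrow> kernel k"
  by (simp add: tri_def)

lemma tri_nonneg: "tri k C \<Longrightarrow> 0 \<le> C"
  by (simp add: tri_def)

lemma triI:
  assumes "kernel k" "0 \<le> C"
    and "\<And>F G H. F \<in> borel_measurable borel \<Longrightarrow> G \<in> borel_measurable borel \<Longrightarrow> H \<in> borel_measurable borel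
      \<Longrightarrow> triform k F G H \<le> ennreal C * (l2 F * l2 G * l2 H)"
  shows "tri k C"
  using assms by (auto simp: tri_def)

lemma tri_mono:
  assumes "tri k C" "kernel k'" "\<And>x y. k' x y \<le> k x y" "C \<le> C'"
  shows "tri k' C'"
proof (rule triI)
  show "kernel k'" by fact
  show "0 \<le> C'" using assms(4) tri_nonneg[OF assms(1)] by simp
  fix F G H :: "'a \<Rightarrow> ennreal"
  assume m: "F \<in> borel_measurable borel" "G \<in> borel_measurable borel" "H \<in> borel_measurable borel"
  have "triform k' F G H \<le> triform k F G H"
    unfolding triform_def by (intro nn_integral_mono mult_left_mono ennreal_leI assms) auto
  also have "\<dots> \<le> ennreal C * (l2 F * l2 G * l2 H)" by (rule triD[OF assms(1) m])
  also have "\<dots> \<le> ennreal C' * (l2 F * l2 G * l2 H)"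
    by (intro mult_right_mono ennreal_leI assms) auto
  finally show "triform k' F G H \<le> ennreal C' * (l2 F * l2 G * l2 H)" .
qed

lemma tri_cmult:
  assumes "tri k C" "0 \<le> c"
  shows "tri (\<lambda>x y. c * k x y) (c * C)"
proof (rule triI)
  note [measurable] = kernel_measurable_compose[OF tri_kernel[OF assms(1)]]
  show "kernel (\<lambda>x y. c * k x y)" using tri_kernel[OF assms(1)] assms(2) by (auto simp: kernel_def)
  show "0 \<le> c * C" using tri_nonneg[OF assms(1)] assms(2) by simp
  fix F G H :: "'a \<Rightarrow> ennreal"
  assume [measurable]: "F \<in> borel_measurable borel" "G \<in> borel_measurable borel" "H \<in> borel_measurable borel"
  have "triform (\<lambda>x y. c * k x y) F G H = ennreal c * triform k F G H"
    unfolding triform_def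
    by (simp add: ennreal_mult' assms nn_integral_cmult[symmetric] mult_ac)
  also have "\<dots> \<le> ennreal c * (ennreal C * (l2 F * l2 G * l2 H))"
    by (intro mult_left_mono triD[OF assms(1)]) auto
  finally show "triform (\<lambda>x y. c * k x y) F G H \<le> ennreal (c * C) * (l2 F * l2 G * l2 H)"
    by (simp only: ennreal_mult'[OF assms(2)] mult.assoc)
qed

lemma tri_suminf:
  assumes k: "\<And>n. tri (k n) (C n)" and "summable C" and k': "kernel k'"
    and le: "\<And>x y. ennreal (k' x y) \<le> (\<Sum>n. ennreal (k n x y))"
  shows "tri k' (\<Sum>n. C n)"
proof (rule triI)
  note [measurable] = kernel_measurable_compose[OF tri_kernel[OF k]]
  show "kernel k'" by fact
  have C: "0 \<le> C n" for n by (rule tri_nonneg[OF k])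
  then show "0 \<le> (\<Sum>n. C n)" by (rule suminf_nonneg[OF assms(2)])
  fix F G H :: "'a \<Rightarrow> ennreal"
  assume [measurable]: "F \<in> borel_measurable borel" "G \<in> borel_measurable borel" "H \<in> borel_measurable borel"
  have "triform k' F G H \<le> (\<integral>\<^sup>+ x. \<integral>\<^sup>+ y. F x * G y * H (x + y) * (\<Sum>n. ennreal (k n x y)) \<partial>lborel \<partial>lborel)"
    unfolding triform_def by (intro nn_integral_mono mult_left_mono le) auto
  also have "\<dots> = (\<integral>\<^sup>+ x. \<integral>\<^sup>+ y. (\<Sum>n. F x * G y * H (x + y) * ennreal (k n x y)) \<partial>lborel \<partial>lborel)"
    by simp
  also have "\<dots> = (\<Sum>n. triform (k n) F G H)"
    unfolding triform_def
    by (subst nn_integral_suminf, measurable, subst nn_integral_suminf, measurable)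
  also have "\<dots> \<le> (\<Sum>n. ennreal (C n) * (l2 F * l2 G * l2 H))"
    by (intro suminf_le triD[OF k]) auto
  also have "\<dots> = ennreal (\<Sum>n. C n) * (l2 F * l2 G * l2 H)"
    using suminf_ennreal2[OF C assms(2)] by simp
  finally show "triform k' F G H \<le> ennreal (\<Sum>n. C n) * (l2 F * l2 G * l2 H)" .
qed

lemma tri_add:
  assumes "tri k1 C1" "tri k2 C2"
  shows "tri (\<lambda>x y. k1 x y + k2 x y) (C1 + C2)"
proof (rule triI)
  note [measurable] = kernel_measurable_compose[OF tri_kernel[OF assms(1)]] kernel_measurable_compose[OF tri_kernel[OF assms(2)]]
  note nn = kernel_nonneg[OF tri_kernel[OF assms(1)]] kernel_nonneg[OF tri_kernel[OF assms(2)]]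
  note C = tri_nonneg[OF assms(1)] tri_nonneg[OF assms(2)]
  show "kernel (\<lambda>x y. k1 x y + k2 x y)"
    using tri_kernel[OF assms(1)] tri_kernel[OF assms(2)] by (auto simp: kernel_def)
  show "0 \<le> C1 + C2" using C by simp
  fix F G H :: "'a \<Rightarrow> ennreal"
  assume [measurable]: "F \<in> borel_measurable borel" "G \<in> borel_measurable borel" "H \<in> borel_measurable borel"
  have "triform (\<lambda>x y. k1 x y + k2 x y) F G H = triform k1 F G H + triform k2 F G H"
    unfolding triform_def by (simp add: nn ennreal_plus distrib_left nn_integral_add)
  also have "\<dots> \<le> ennreal C1 * (l2 F * l2 G * l2 H) + ennreal C2 * (l2 F * l2 G * l2 H)"
    by (intro add_mono triD[OF assms(1)] triD[OF assms(2)]) auto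
  finally show "triform (\<lambda>x y. k1 x y + k2 x y) F G H \<le> ennreal (C1 + C2) * (l2 F * l2 G * l2 H)"
    by (simp add: C ennreal_plus distrib_right)
qed

lemma triform_swap:
  assumes "kernel k" and [measurable]: "F \<in> borel_measurable borel" "G \<in> borel_measurable borel" "H \<in> borel_measurable borel"
  shows "triform (\<lambda>x y. k y x) F G H = triform k G F H"
proof -
  note [measurable] = kernel_measurable_compose[OF assms(1)]
  have "triform (\<lambda>x y. k y x) F G H = (\<integral>\<^sup>+ y. \<integral>\<^sup>+ x. F x * G y * H (x + y) * ennreal (k y x) \<partial>lborel \<partial>lborel)"
    unfolding triform_def by (rule lborel_pair.Fubini') measurable
  also have "\<dots> = triform k G F H"
    unfolding triform_def by (simp add: mult_ac add.commute)
  finally show ?thesis .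
qed

lemma tri_swap:
  assumes "tri k C" shows "tri (\<lambda>x y. k y x) C"
proof (rule triI)
  have k: "kernel k" by (rule tri_kernel[OF assms])
  note [measurable] = kernel_measurable_compose[OF k]
  show "kernel (\<lambda>x y. k y x)"
    unfolding kernel_def by (auto simp: kernel_nonneg[OF k])
  show "0 \<le> C" by (rule tri_nonneg[OF assms])
  fix F G H :: "'a \<Rightarrow> ennreal"
  assume m: "F \<in> borel_measurable borel" "G \<in> borel_measurable borel" "H \<in> borel_measurable borel"
  show "triform (\<lambda>x y. k y x) F G H \<le> ennreal C * (l2 F * l2 G * l2 H)"
    using triD[OF assms m(2,1,3)] by (simp add: triform_swap[OF k m] mult_ac)
qed

text \<open>Cauchy-Schwarz in \<open>y\<close> for each \<open>x\<close> puts the kernel into its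
  uniform L2 bound. What remains, \<open>Q x\<close>, is the L2 norm in \<open>y\<close> of
  \<open>G y * H (x + y)\<close>, and Fubini with translation invariance gives
  \<open>l2 Q = l2 G * l2 H\<close> exactly.\<close>

lemma tri_fix_first:
  assumes k: "kernel k" and C: "0 \<le> C"
    and *: "\<And>x. (\<integral>\<^sup>+ y. ennreal (k x y) ^ 2 \<partial>lborel) \<le> ennreal C ^ 2"
  shows "tri k C"
proof (rule triI[OF k C])
  note [measurable] = kernel_measurable_compose[OF k]
  fix F G H :: "'a \<Rightarrow> ennreal"
  assume [measurable]: "F \<in> borel_measurable borel" "G \<in> borel_measurable borel" "H \<in> borel_measurable borel"
  define Q where "Q x = esqrt (\<integral>\<^sup>+ y. (G y * H (x + y)) ^ 2 \<partial>lborel)" for x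
  have [measurable]: "Q \<in> borel_measurable borel" unfolding Q_def by measurable
  have 1: "(\<integral>\<^sup>+ y. G y * H (x + y) * ennreal (k x y) \<partial>lborel) \<le> Q x * ennreal C" for x
  proof -
    have "(\<integral>\<^sup>+ y. G y * H (x + y) * ennreal (k x y) \<partial>lborel) \<le> Q x * esqrt (\<integral>\<^sup>+ y. ennreal (k x y) ^ 2 \<partial>lborel)"
      unfolding Q_def by (rule nn_integral_mult_le_esqrt) measurable
    also have "\<dots> \<le> Q x * ennreal C"
      using * by (intro mult_left_mono) (auto simp: esqrt_le_iff)
    finally show ?thesis .
  qed
  have "(\<integral>\<^sup>+ x. Q x ^ 2 \<partial>lborel) = (\<integral>\<^sup>+ y. \<integral>\<^sup>+ x. G y ^ 2 * H (x + y) ^ 2 \<partial>lborel \<partial>lborel)"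
    unfolding Q_def by (simp add: power_mult_distrib) (rule lborel_pair.Fubini', measurable)
  also have "\<dots> = (\<integral>\<^sup>+ y. G y ^ 2 * (\<integral>\<^sup>+ x. H x ^ 2 \<partial>lborel) \<partial>lborel)"
  proof (rule nn_integral_cong)
    fix y :: 'a
    have "(\<integral>\<^sup>+ x. H (x + y) ^ 2 \<partial>lborel) = (\<integral>\<^sup>+ x. H x ^ 2 \<partial>lborel)"
      using nn_integral_lborel_plus[of "\<lambda>x. H x ^ 2" y] by (simp add: add.commute)
    then show "(\<integral>\<^sup>+ x. G y ^ 2 * H (x + y) ^ 2 \<partial>lborel) = G y ^ 2 * (\<integral>\<^sup>+ x. H x ^ 2 \<partial>lborel)"
      by (simp add: nn_integral_cmult)
  qed
  also have "\<dots> = (l2 G * l2 H) ^ 2"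
    by (simp add: nn_integral_multc power_mult_distrib l2_power2)
  finally have Q: "l2 Q = l2 G * l2 H"
    unfolding l2_def[of Q] by simp
  have "triform k F G H = (\<integral>\<^sup>+ x. F x * (\<integral>\<^sup>+ y. G y * H (x + y) * ennreal (k x y) \<partial>lborel) \<partial>lborel)"
    unfolding triform_def by (simp add: nn_integral_cmult[symmetric] mult_ac)
  also have "\<dots> \<le> (\<integral>\<^sup>+ x. F x * (Q x * ennreal C) \<partial>lborel)"
    by (intro nn_integral_mono mult_left_mono 1) auto
  also have "\<dots> = ennreal C * (\<integral>\<^sup>+ x. F x * Q x \<partial>lborel)"
    by (simp add: nn_integral_cmult[symmetric] mult_ac)
  also have "\<dots> \<le> ennreal C * (l2 F * l2 Q)"
    by (intro mult_left_mono nn_integral_mult_le_l2) auto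
  finally show "triform k F G H \<le> ennreal C * (l2 F * l2 G * l2 H)"
    by (simp add: Q mult_ac)
qed

lemma kernel_swap: "kernel k \<Longrightarrow> kernel (\<lambda>x y. k y x)"
  using kernel_measurable_compose[of k snd "borel \<Otimes>\<^sub>M borel" fst] by (simp add: kernel_def)

lemma tri_fix_second:
  assumes k: "kernel k" and C: "0 \<le> C"
    and *: "\<And>y. (\<integral>\<^sup>+ x. ennreal (k x y) ^ 2 \<partial>lborel) \<le> ennreal C ^ 2"
  shows "tri k C"
  using tri_swap[OF tri_fix_first[OF kernel_swap[OF k] C *]] by simp

lemma triform_sum:
  assumes k: "kernel k" and [measurable]: "F \<in> borel_measurable borel" "G \<in> borel_measurable borel" "H \<in> borel_measurable borel"
  shows "triform k F G H = (\<integral>\<^sup>+ z. (\<integral>\<^sup>+ x. F x * G (z - x) * ennreal (k x (z - x)) \<partial>lborel) * H z \<partial>lborel)"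
proof -
  note [measurable] = kernel_measurable_compose[OF k]
  have "triform k F G H = (\<integral>\<^sup>+ x. \<integral>\<^sup>+ z. F x * G (z - x) * H z * ennreal (k x (z - x)) \<partial>lborel \<partial>lborel)"
    unfolding triform_def
  proof (rule nn_integral_cong)
    fix x :: 'a
    show "(\<integral>\<^sup>+ y. F x * G y * H (x + y) * ennreal (k x y) \<partial>lborel) =
      (\<integral>\<^sup>+ z. F x * G (z - x) * H z * ennreal (k x (z - x)) \<partial>lborel)"
      using nn_integral_lborel_plus[of "\<lambda>z. F x * G (z - x) * H z * ennreal (k x (z - x))" x] by simp
  qed
  also have "\<dots> = (\<integral>\<^sup>+ z. \<integral>\<^sup>+ x. F x * G (z - x) * H z * ennreal (k x (z - x)) \<partial>lborel \<partial>lborel)"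
    by (rule lborel_pair.Fubini') measurable
  also have "\<dots> = (\<integral>\<^sup>+ z. (\<integral>\<^sup>+ x. F x * G (z - x) * ennreal (k x (z - x)) \<partial>lborel) * H z \<partial>lborel)"
    by (intro nn_integral_cong, subst nn_integral_multc[symmetric]) (simp_all add: mult_ac)
  finally show ?thesis .
qed

text \<open>The same Cauchy-Schwarz argument along the fibres x + y = z; it is the one to use when
  the kernel has one factor in each input.\<close>

lemma tri_fix_sum:
  assumes k: "kernel k" and C: "0 \<le> C"
    and *: "\<And>z. (\<integral>\<^sup>+ x. ennreal (k x (z - x)) ^ 2 \<partial>lborel) \<le> ennreal C ^ 2"
  shows "tri k C"
proof (rule triI[OF k C])
  note [measurable] = kernel_measurable_compose[OF k]
  fix F G H :: "'a \<Rightarrow> ennreal"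
  assume [measurable]: "F \<in> borel_measurable borel" "G \<in> borel_measurable borel" "H \<in> borel_measurable borel"
  define Q where "Q z = esqrt (\<integral>\<^sup>+ x. (F x * G (z - x)) ^ 2 \<partial>lborel)" for z
  have [measurable]: "Q \<in> borel_measurable borel" unfolding Q_def by measurable
  have 1: "(\<integral>\<^sup>+ x. F x * G (z - x) * ennreal (k x (z - x)) \<partial>lborel) \<le> Q z * ennreal C" for z
  proof -
    have "(\<integral>\<^sup>+ x. F x * G (z - x) * ennreal (k x (z - x)) \<partial>lborel) \<le> Q z * esqrt (\<integral>\<^sup>+ x. ennreal (k x (z - x)) ^ 2 \<partial>lborel)"
      unfolding Q_def by (rule nn_integral_mult_le_esqrt) measurable
    also have "\<dots> \<le> Q z * ennreal C"
      using * by (intro mult_left_mono) (auto simp: esqrt_le_iff)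
    finally show ?thesis .
  qed
  have "(\<integral>\<^sup>+ z. Q z ^ 2 \<partial>lborel) = (\<integral>\<^sup>+ x. \<integral>\<^sup>+ z. F x ^ 2 * G (z - x) ^ 2 \<partial>lborel \<partial>lborel)"
    unfolding Q_def by (simp add: power_mult_distrib) (rule lborel_pair.Fubini', measurable)
  also have "\<dots> = (\<integral>\<^sup>+ x. F x ^ 2 * (\<integral>\<^sup>+ z. G z ^ 2 \<partial>lborel) \<partial>lborel)"
  proof (rule nn_integral_cong)
    fix x :: 'a
    have "(\<integral>\<^sup>+ z. G (z - x) ^ 2 \<partial>lborel) = (\<integral>\<^sup>+ z. G z ^ 2 \<partial>lborel)"
      using nn_integral_lborel_plus[of "\<lambda>z. G z ^ 2" "- x"] by simp
    then show "(\<integral>\<^sup>+ z. F x ^ 2 * G (z - x) ^ 2 \<partial>lborel) = F x ^ 2 * (\<integral>\<^sup>+ z. G z ^ 2 \<partial>lborel)"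
      by (simp add: nn_integral_cmult)
  qed
  also have "\<dots> = (l2 F * l2 G) ^ 2"
    by (simp add: nn_integral_multc power_mult_distrib l2_power2)
  finally have Q: "l2 Q = l2 F * l2 G"
    unfolding l2_def[of Q] by simp
  have "triform k F G H \<le> (\<integral>\<^sup>+ z. (Q z * ennreal C) * H z \<partial>lborel)"
    unfolding triform_sum[OF k \<open>F \<in> _\<close> \<open>G \<in> _\<close> \<open>H \<in> _\<close>]
    by (intro nn_integral_mono mult_right_mono 1) auto
  also have "\<dots> = ennreal C * (\<integral>\<^sup>+ z. Q z * H z \<partial>lborel)"
    by (simp add: nn_integral_cmult[symmetric] mult_ac)
  also have "\<dots> \<le> ennreal C * (l2 Q * l2 H)"
    by (intro mult_left_mono nn_integral_mult_le_l2) auto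
  finally show "triform k F G H \<le> ennreal C * (l2 F * l2 G * l2 H)"
    by (simp add: Q mult_ac)
qed

lemma tri_bilinear:
  assumes k: "tri k C" and [measurable]: "F \<in> borel_measurable borel" "G \<in> borel_measurable borel"
  shows "l2 (\<lambda>z. \<integral>\<^sup>+ x. F x * G (z - x) * ennreal (k x (z - x)) \<partial>lborel) \<le> ennreal C * (l2 F * l2 G)"
proof (rule l2_dual)
  note [measurable] = kernel_measurable_compose[OF tri_kernel[OF k]]
  show "(\<lambda>z. \<integral>\<^sup>+ x. F x * G (z - x) * ennreal (k x (z - x)) \<partial>lborel) \<in> borel_measurable borel"
    by measurable
  fix H :: "'a \<Rightarrow> ennreal" assume H: "H \<in> borel_measurable borel"
  show "(\<integral>\<^sup>+ z. (\<integral>\<^sup>+ x. F x * G (z - x) * ennreal (k x (z - x)) \<partial>lborel) * H z \<partial>lborel)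
      \<le> ennreal C * (l2 F * l2 G) * l2 H"
    using triD[OF k assms(2,3) H] by (simp add: triform_sum[OF tri_kernel[OF k] assms(2,3) H] mult_ac)
qed

text \<open>Replace the third function \<open>H\<close> by \<open>z \<mapsto> H (- z)\<close>: the form becomes symmetric on \<open>x + y + z = 0\<close>.\<close>

lemma tri_rotate:
  assumes k: "tri k C"
  shows "tri (\<lambda>x y. k (- y - x) x) C"
proof (rule triI)
  have K: "kernel k" by (rule tri_kernel[OF k])
  note [measurable] = kernel_measurable_compose[OF K]
  show "kernel (\<lambda>x y. k (- y - x) x)" by (auto simp: kernel_def kernel_nonneg[OF K])
  show "0 \<le> C" by (rule tri_nonneg[OF k])
  fix F G H :: "'a \<Rightarrow> ennreal"
  assume [measurable]: "F \<in> borel_measurable borel" "G \<in> borel_measurable borel" "H \<in> borel_measurable borel"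
  have l2m: "l2 (\<lambda>x. f (- x)) = l2 f" if [measurable]: "f \<in> borel_measurable borel" for f :: "'a \<Rightarrow> ennreal"
    unfolding l2_def using nn_integral_lborel_diff[of "\<lambda>x. f x ^ 2" 0] by simp
  have "triform (\<lambda>x y. k (- y - x) x) F G H =
     (\<integral>\<^sup>+ x. \<integral>\<^sup>+ y. F x * G y * H (x + y) * ennreal (k (- y - x) x) \<partial>lborel \<partial>lborel)"
    by (simp add: triform_def)
  also have "\<dots> = (\<integral>\<^sup>+ x. \<integral>\<^sup>+ w. F x * G (- x - w) * H (- w) * ennreal (k w x) \<partial>lborel \<partial>lborel)"
  proof (rule nn_integral_cong)
    fix x :: 'a
    show "(\<integral>\<^sup>+ y. F x * G y * H (x + y) * ennreal (k (- y - x) x) \<partial>lborel) =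
       (\<integral>\<^sup>+ w. F x * G (- x - w) * H (- w) * ennreal (k w x) \<partial>lborel)"
      using nn_integral_lborel_diff[of "\<lambda>y. F x * G y * H (x + y) * ennreal (k (- y - x) x)" "- x"]
      by simp
  qed
  also have "\<dots> = (\<integral>\<^sup>+ w. \<integral>\<^sup>+ x. F x * G (- x - w) * H (- w) * ennreal (k w x) \<partial>lborel \<partial>lborel)"
    by (rule lborel_pair.Fubini') measurable
  also have "\<dots> = triform k (\<lambda>w. H (- w)) F (\<lambda>z. G (- z))"
  proof -
    have *: "- (w + x) = - x - w" for w x :: 'a by simp
    show ?thesis unfolding triform_def * by (intro nn_integral_cong) (simp add: mult_ac)
  qed
  also have "\<dots> \<le> ennreal C * (l2 (\<lambda>w. H (- w)) * l2 F * l2 (\<lambda>z. G (- z)))"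
    by (rule triD[OF k]) measurable
  finally show "triform (\<lambda>x y. k (- y - x) x) F G H \<le> ennreal C * (l2 F * l2 G * l2 H)"
    by (simp add: l2m mult_ac)
qed

section \<open>Localisation of kernels to windows\<close>

lemma nn_integral_window:
  fixes \<alpha> :: real
  assumes "0 \<le> \<alpha>"
  shows "(\<integral>\<^sup>+ t. ennreal (of_bool (\<bar>u - t\<bar> \<le> \<alpha>)) \<partial>lborel) = ennreal (2 * \<alpha>)"
proof -
  have "(\<integral>\<^sup>+ t. ennreal (of_bool (\<bar>u - t\<bar> \<le> \<alpha>)) \<partial>lborel) = (\<integral>\<^sup>+ t. indicator {u - \<alpha>..u + \<alpha>} t \<partial>lborel)"
    by (intro nn_integral_cong) (auto simp: indicator_def)
  also have "\<dots> = ennreal (2 * \<alpha>)"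
    using assms by simp
  finally show ?thesis .
qed

lemma measurable_of_bool [measurable (raw)]:
  assumes "Measurable.pred M P"
  shows "(\<lambda>x. of_bool (P x) :: real) \<in> borel_measurable M"
  unfolding of_bool_def using assms by measurable

text \<open>Fubini: each \<open>x\<close> is seen by exactly those windows whose position t lies in
  an interval of length 2 \<alpha>.\<close>

lemma l2_window:
  fixes \<phi> :: "'a::euclidean_space \<Rightarrow> real"
  assumes [measurable]: "\<phi> \<in> borel_measurable borel" "F \<in> borel_measurable borel" and \<alpha>: "0 \<le> \<alpha>"
  shows "(\<integral>\<^sup>+ t. l2 (\<lambda>x. F x * ennreal (of_bool (\<bar>\<phi> x - t\<bar> \<le> \<alpha>))) ^ 2 \<partial>lborel) = ennreal (2 * \<alpha>) * l2 F ^ 2"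
proof -
  have "(\<integral>\<^sup>+ t. l2 (\<lambda>x. F x * ennreal (of_bool (\<bar>\<phi> x - t\<bar> \<le> \<alpha>))) ^ 2 \<partial>lborel) =
    (\<integral>\<^sup>+ t. \<integral>\<^sup>+ x. F x ^ 2 * ennreal (of_bool (\<bar>\<phi> x - t\<bar> \<le> \<alpha>)) \<partial>lborel \<partial>lborel)"
    unfolding l2_power2 by (intro nn_integral_cong) (auto simp: power_mult_distrib)
  also have "\<dots> = (\<integral>\<^sup>+ x. \<integral>\<^sup>+ t. F x ^ 2 * ennreal (of_bool (\<bar>\<phi> x - t\<bar> \<le> \<alpha>)) \<partial>lborel \<partial>lborel)"
    by (rule lborel_pair.Fubini') measurable
  also have "\<dots> = (\<integral>\<^sup>+ x. F x ^ 2 * ennreal (2 * \<alpha>) \<partial>lborel)"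
    by (simp add: nn_integral_cmult nn_integral_window[OF \<alpha>])
  also have "\<dots> = ennreal (2 * \<alpha>) * l2 F ^ 2"
    by (subst nn_integral_multc) (auto simp: l2_power2 mult.commute)
  finally show ?thesis .
qed

text \<open>A kernel on whose support \<open>\<phi> x\<close> and \<open>\<psi> y\<close> are \<open>\<alpha>\<close>-close may be localised to windows of
  comparable length: averaging over the position \<open>t\<close> of the window replaces an almost orthogonal
  decomposition.\<close>

lemma tri_localize:
  fixes \<phi> \<psi> :: "'a::euclidean_space \<Rightarrow> real"
  assumes k: "kernel k" and [measurable]: "\<phi> \<in> borel_measurable borel" "\<psi> \<in> borel_measurable borel"
    and \<alpha>: "0 < \<alpha>" and C: "0 \<le> C"
    and supp: "\<And>x y. k x y \<noteq> 0 \<Longrightarrow> \<bar>\<phi> x - \<psi> y\<bar> \<le> \<alpha>"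
    and loc: "\<And>t. tri (\<lambda>x y. k x y * of_bool (\<bar>\<phi> x - t\<bar> \<le> \<alpha>) * of_bool (\<bar>\<psi> y - t\<bar> \<le> 2 * \<alpha>)) C"
  shows "tri k (2 * C)"
proof (rule triI[OF k])
  note [measurable] = kernel_measurable_compose[OF k]
  show "0 \<le> 2 * C" using C by simp
  fix F G H :: "'a \<Rightarrow> ennreal"
  assume [measurable]: "F \<in> borel_measurable borel" "G \<in> borel_measurable borel" "H \<in> borel_measurable borel"
  define Ft where "Ft t x = F x * ennreal (of_bool (\<bar>\<phi> x - t\<bar> \<le> \<alpha>))" for t x
  define Gt where "Gt t y = G y * ennreal (of_bool (\<bar>\<psi> y - t\<bar> \<le> 2 * \<alpha>))" for t y
  have [measurable]: "Ft t \<in> borel_measurable borel" "Gt t \<in> borel_measurable borel" for t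
    unfolding Ft_def Gt_def by measurable
  have l2t [measurable]: "(\<lambda>t. l2 (Ft t)) \<in> borel_measurable borel" "(\<lambda>t. l2 (Gt t)) \<in> borel_measurable borel"
    unfolding l2_def Ft_def Gt_def by measurable
  \<comment> \<open>On the support of \<open>k\<close>, closeness of \<open>\<phi> x\<close> to
    \<open>t\<close> already forces \<open>\<psi> y\<close> into the window of twice the radius, so
    only the first indicator affects the integral over \<open>t\<close>.\<close>
  have 1: "(\<integral>\<^sup>+ t. F x * G y * H (x + y) * ennreal (k x y) * ennreal (of_bool (\<bar>\<phi> x - t\<bar> \<le> \<alpha>)) * ennreal (of_bool (\<bar>\<psi> y - t\<bar> \<le> 2 * \<alpha>)) \<partial>lborel)
      = ennreal (2 * \<alpha>) * (F x * G y * H (x + y) * ennreal (k x y))" for x y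
  proof (cases "k x y = 0")
    case False
    have "(\<integral>\<^sup>+ t. F x * G y * H (x + y) * ennreal (k x y) * ennreal (of_bool (\<bar>\<phi> x - t\<bar> \<le> \<alpha>)) * ennreal (of_bool (\<bar>\<psi> y - t\<bar> \<le> 2 * \<alpha>)) \<partial>lborel)
       = (\<integral>\<^sup>+ t. F x * G y * H (x + y) * ennreal (k x y) * ennreal (of_bool (\<bar>\<phi> x - t\<bar> \<le> \<alpha>)) \<partial>lborel)"
      using supp[OF False] by (intro nn_integral_cong) auto
    also have "\<dots> = F x * G y * H (x + y) * ennreal (k x y) * ennreal (2 * \<alpha>)"
      using \<alpha> by (subst nn_integral_cmult) (auto simp: nn_integral_window)
    finally show ?thesis by (simp add: mult.commute)
  qed simp
  have "ennreal (2 * \<alpha>) * triform k F G H =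
    (\<integral>\<^sup>+ x. \<integral>\<^sup>+ y. \<integral>\<^sup>+ t. F x * G y * H (x + y) * ennreal (k x y) * ennreal (of_bool (\<bar>\<phi> x - t\<bar> \<le> \<alpha>)) * ennreal (of_bool (\<bar>\<psi> y - t\<bar> \<le> 2 * \<alpha>)) \<partial>lborel \<partial>lborel \<partial>lborel)"
    unfolding triform_def 1 by (simp add: nn_integral_cmult)
  also have "\<dots> = (\<integral>\<^sup>+ x. \<integral>\<^sup>+ t. \<integral>\<^sup>+ y. F x * G y * H (x + y) * ennreal (k x y) * ennreal (of_bool (\<bar>\<phi> x - t\<bar> \<le> \<alpha>)) * ennreal (of_bool (\<bar>\<psi> y - t\<bar> \<le> 2 * \<alpha>)) \<partial>lborel \<partial>lborel \<partial>lborel)"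
    by (intro nn_integral_cong lborel_pair.Fubini') measurable
  also have "\<dots> = (\<integral>\<^sup>+ t. \<integral>\<^sup>+ x. \<integral>\<^sup>+ y. F x * G y * H (x + y) * ennreal (k x y) * ennreal (of_bool (\<bar>\<phi> x - t\<bar> \<le> \<alpha>)) * ennreal (of_bool (\<bar>\<psi> y - t\<bar> \<le> 2 * \<alpha>)) \<partial>lborel \<partial>lborel \<partial>lborel)"
    by (intro lborel_pair.Fubini') measurable
  also have "\<dots> = (\<integral>\<^sup>+ t. triform (\<lambda>x y. k x y * of_bool (\<bar>\<phi> x - t\<bar> \<le> \<alpha>) * of_bool (\<bar>\<psi> y - t\<bar> \<le> 2 * \<alpha>)) (Ft t) (Gt t) H \<partial>lborel)"
    unfolding triform_def Ft_def Gt_def by (intro nn_integral_cong) (auto simp: of_bool_def)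
  also have "\<dots> \<le> (\<integral>\<^sup>+ t. ennreal C * (l2 (Ft t) * l2 (Gt t) * l2 H) \<partial>lborel)"
    by (intro nn_integral_mono triD[OF loc]) auto
  also have "\<dots> = (\<integral>\<^sup>+ t. (ennreal C * l2 H) * (l2 (Ft t) * l2 (Gt t)) \<partial>lborel)"
    by (simp add: mult_ac)
  also have "\<dots> = ennreal C * l2 H * (\<integral>\<^sup>+ t. l2 (Ft t) * l2 (Gt t) \<partial>lborel)"
    by (subst nn_integral_cmult) auto
  \<comment> \<open>Cauchy-Schwarz in \<open>t\<close> recombines the localised pieces. The window
    lengths 2 \<alpha> and 4 \<alpha> cost only a factor 2 after division by 2 \<alpha>.\<close>
  also have "\<dots> \<le> ennreal C * l2 H * (esqrt (\<integral>\<^sup>+ t. l2 (Ft t) ^ 2 \<partial>lborel) * esqrt (\<integral>\<^sup>+ t. l2 (Gt t) ^ 2 \<partial>lborel))"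
    by (intro mult_left_mono nn_integral_mult_le_esqrt) auto
  also have "\<dots> = ennreal C * l2 H * (esqrt (ennreal (2 * \<alpha>) * l2 F ^ 2) * esqrt (ennreal (4 * \<alpha>) * l2 G ^ 2))"
    using l2_window[of \<phi> F \<alpha>] l2_window[of \<psi> G "2 * \<alpha>"] \<alpha> unfolding Ft_def Gt_def by simp
  also have "\<dots> = ennreal C * l2 H * (esqrt (ennreal (2 * \<alpha>) * ennreal (4 * \<alpha>)) * (l2 F * l2 G))"
    by (simp add: esqrt_mult mult_ac)
  also have "\<dots> \<le> ennreal C * l2 H * (esqrt (ennreal (4 * \<alpha>) ^ 2) * (l2 F * l2 G))"
    using \<alpha> by (intro mult_left_mono mult_right_mono esqrt_mono) (auto simp: power2_eq_square intro!: mult_right_mono ennreal_leI)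
  also have "\<dots> = ennreal (2 * \<alpha>) * (ennreal (2 * C) * (l2 F * l2 G * l2 H))"
  proof -
    have "ennreal (2 * \<alpha>) * ennreal (2 * C) = ennreal C * ennreal (4 * \<alpha>)"
      using \<alpha> C by (simp add: ennreal_mult[symmetric] mult_ac)
    then have "ennreal (2 * \<alpha>) * (ennreal (2 * C) * (l2 F * l2 G * l2 H)) = ennreal C * ennreal (4 * \<alpha>) * (l2 F * l2 G * l2 H)"
      by (simp only: mult.assoc[symmetric])
    then show ?thesis unfolding esqrt_of_power2 by (simp only: ac_simps)
  qed
  finally have "ennreal (2 * \<alpha>) * triform k F G H \<le> ennreal (2 * \<alpha>) * (ennreal (2 * C) * (l2 F * l2 G * l2 H))" .
  then show "triform k F G H \<le> ennreal (2 * C) * (l2 F * l2 G * l2 H)"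
    using \<alpha> by (subst (asm) ennreal_mult_le_mult_iff) auto
qed

text \<open>The rotation of \<open>tri_rotate\<close> turns the pair y, x + y into the two inputs,
  up to a sign, and has order three: rotate once, localise, rotate twice more.\<close>

lemma tri_localize_sum:
  fixes \<psi> \<theta> :: "'a::euclidean_space \<Rightarrow> real"
  assumes k: "kernel k" and [measurable]: "\<psi> \<in> borel_measurable borel" "\<theta> \<in> borel_measurable borel"
    and \<alpha>: "0 < \<alpha>" and C: "0 \<le> C"
    and supp: "\<And>x y. k x y \<noteq> 0 \<Longrightarrow> \<bar>\<psi> y - \<theta> (x + y)\<bar> \<le> \<alpha>"
    and loc: "\<And>t. tri (\<lambda>x y. k x y * of_bool (\<bar>\<psi> y - t\<bar> \<le> \<alpha>) * of_bool (\<bar>\<theta> (x + y) - t\<bar> \<le> 2 * \<alpha>)) C"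
  shows "tri k (2 * C)"
proof -
  note [measurable] = kernel_measurable_compose[OF k]
  have "tri (\<lambda>x y. k (- y - x) x) (2 * C)"
  proof (rule tri_localize[where \<phi> = \<psi> and \<psi> = "\<lambda>u. \<theta> (- u)" and \<alpha> = \<alpha>])
    show "kernel (\<lambda>x y. k (- y - x) x)" by (auto simp: kernel_def kernel_nonneg[OF k])
    show "\<bar>\<psi> x - \<theta> (- y)\<bar> \<le> \<alpha>" if "k (- y - x) x \<noteq> 0" for x y
      using supp[OF that] by simp
    show "tri (\<lambda>x y. k (- y - x) x * of_bool (\<bar>\<psi> x - t\<bar> \<le> \<alpha>) * of_bool (\<bar>\<theta> (- y) - t\<bar> \<le> 2 * \<alpha>)) C" for t
      using tri_rotate[OF loc[of t]] by simp
  qed (use \<alpha> C in \<open>simp_all\<close>)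
  from tri_rotate[OF tri_rotate[OF this]] show ?thesis by simp
qed

text \<open>Exchanging \<open>y\<close> with \<open>x + y\<close>: \<open>a + b = c + d\<close> and \<open>a - c = d - b\<close> describe the same quadruples.\<close>

lemma tri_reflect:
  fixes \<phi> \<psi> :: "'a::euclidean_space \<Rightarrow> real"
  assumes [measurable]: "\<phi> \<in> borel_measurable borel" "\<psi> \<in> borel_measurable borel"
    and nn: "\<And>x. 0 \<le> \<phi> x" "\<And>x. 0 \<le> \<psi> x" and tri: "tri (\<lambda>x y. \<phi> x * \<psi> y) C"
  shows "tri (\<lambda>x y. \<phi> x * \<psi> (x + y)) C"
proof (rule triI)
  show "kernel (\<lambda>x y. \<phi> x * \<psi> (x + y))" using nn by (auto simp: kernel_def)
  show "0 \<le> C" by (rule tri_nonneg[OF tri])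
  fix F G H :: "'a \<Rightarrow> ennreal"
  assume [measurable]: "F \<in> borel_measurable borel" "G \<in> borel_measurable borel" "H \<in> borel_measurable borel"
  define F1 where "F1 x = F x * ennreal (\<phi> x)" for x
  define H1 where "H1 x = H x * ennreal (\<psi> x)" for x
  have [measurable]: "F1 \<in> borel_measurable borel" "H1 \<in> borel_measurable borel"
    unfolding F1_def H1_def by measurable
  define Q where "Q y = (\<integral>\<^sup>+ x. F1 x * H1 (x + y) \<partial>lborel)" for y
  define R where "R z = (\<integral>\<^sup>+ x. F1 x * H1 (z - x) \<partial>lborel)" for z
  have [measurable]: "Q \<in> borel_measurable borel" "R \<in> borel_measurable borel"
    unfolding Q_def R_def by measurable
  have sq: "(\<integral>\<^sup>+ x. f x \<partial>lborel) ^ 2 = (\<integral>\<^sup>+ a. \<integral>\<^sup>+ c. f a * f c \<partial>lborel \<partial>lborel)"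
    if [measurable]: "f \<in> borel_measurable borel" for f :: "'a \<Rightarrow> ennreal"
    by (simp add: nn_integral_cmult nn_integral_multc power2_eq_square)
  have "l2 Q ^ 2 = (\<integral>\<^sup>+ y. \<integral>\<^sup>+ a. \<integral>\<^sup>+ c. F1 a * H1 (a + y) * (F1 c * H1 (c + y)) \<partial>lborel \<partial>lborel \<partial>lborel)"
    unfolding l2_power2 Q_def by (subst sq) auto
  also have "\<dots> = (\<integral>\<^sup>+ a. \<integral>\<^sup>+ y. \<integral>\<^sup>+ c. F1 a * H1 (a + y) * (F1 c * H1 (c + y)) \<partial>lborel \<partial>lborel \<partial>lborel)"
    by (rule lborel_pair.Fubini') measurable
  also have "\<dots> = (\<integral>\<^sup>+ a. \<integral>\<^sup>+ c. \<integral>\<^sup>+ y. F1 a * H1 (a + y) * (F1 c * H1 (c + y)) \<partial>lborel \<partial>lborel \<partial>lborel)"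
    by (intro nn_integral_cong lborel_pair.Fubini') measurable
  \<comment> \<open>Substituting y = z - a - c turns a + y into z - c and c + y into z - a, so the
    two factors \<open>H1\<close> trade places.\<close>
  also have "\<dots> = (\<integral>\<^sup>+ a. \<integral>\<^sup>+ c. \<integral>\<^sup>+ z. F1 a * H1 (z - a) * (F1 c * H1 (z - c)) \<partial>lborel \<partial>lborel \<partial>lborel)"
  proof (rule nn_integral_cong, rule nn_integral_cong)
    fix a c :: 'a
    show "(\<integral>\<^sup>+ y. F1 a * H1 (a + y) * (F1 c * H1 (c + y)) \<partial>lborel) = (\<integral>\<^sup>+ z. F1 a * H1 (z - a) * (F1 c * H1 (z - c)) \<partial>lborel)"
      using nn_integral_lborel_plus[of "\<lambda>y. F1 a * H1 (a + y) * (F1 c * H1 (c + y))" "- a - c"]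
      by (simp add: algebra_simps)
  qed
  also have "\<dots> = (\<integral>\<^sup>+ a. \<integral>\<^sup>+ z. \<integral>\<^sup>+ c. F1 a * H1 (z - a) * (F1 c * H1 (z - c)) \<partial>lborel \<partial>lborel \<partial>lborel)"
    by (intro nn_integral_cong lborel_pair.Fubini') measurable
  also have "\<dots> = (\<integral>\<^sup>+ z. \<integral>\<^sup>+ a. \<integral>\<^sup>+ c. F1 a * H1 (z - a) * (F1 c * H1 (z - c)) \<partial>lborel \<partial>lborel \<partial>lborel)"
    by (rule lborel_pair.Fubini') measurable
  also have "\<dots> = l2 R ^ 2"
    unfolding l2_power2 R_def by (subst sq) auto
  finally have QR: "l2 Q = l2 R" by (simp add: power2_eq_iff_ennreal)
  have "R = (\<lambda>z. \<integral>\<^sup>+ x. F x * H (z - x) * ennreal (\<phi> x * \<psi> (z - x)) \<partial>lborel)"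
    unfolding R_def F1_def H1_def by (simp add: ennreal_mult nn mult_ac)
  then have R: "l2 R \<le> ennreal C * (l2 F * l2 H)"
    using tri_bilinear[OF tri, of F H] by simp
  have "triform (\<lambda>x y. \<phi> x * \<psi> (x + y)) F G H = (\<integral>\<^sup>+ y. \<integral>\<^sup>+ x. F x * G y * H (x + y) * ennreal (\<phi> x * \<psi> (x + y)) \<partial>lborel \<partial>lborel)"
    unfolding triform_def by (rule lborel_pair.Fubini') measurable
  also have "\<dots> = (\<integral>\<^sup>+ y. G y * Q y \<partial>lborel)"
    unfolding Q_def F1_def H1_def
    by (simp add: nn_integral_cmult[symmetric] ennreal_mult nn mult_ac)
  also have "\<dots> \<le> l2 G * l2 Q" by (rule nn_integral_mult_le_l2) measurable
  also have "\<dots> \<le> l2 G * (ennreal C * (l2 F * l2 H))"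
    unfolding QR by (intro mult_left_mono R) auto
  finally show "triform (\<lambda>x y. \<phi> x * \<psi> (x + y)) F G H \<le> ennreal C * (l2 F * l2 G * l2 H)"
    by (simp add: mult_ac)
qed

section \<open>Dyadic shells and geometric series\<close>

lemma ex_dyadic:
  fixes x :: real
  assumes "1 \<le> x" shows "\<exists>n. 2 ^ n \<le> x \<and> x < 2 ^ (n + 1)"
proof -
  obtain m where m: "x < 2 ^ m" using real_arch_pow[of 2 x] by auto
  define l where "l = (LEAST m. x < 2 ^ m)"
  have l: "x < 2 ^ l" unfolding l_def by (rule LeastI[of _ m]) (rule m)
  have "l \<noteq> 0" using l assms by (cases l) auto
  then obtain n where n: "l = Suc n" by (cases l) auto
  have "\<not> x < 2 ^ n" using not_less_Least[of n "\<lambda>m. x < 2 ^ m"] n unfolding l_def by simp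
  then show ?thesis using l n by (intro exI[of _ n]) auto
qed

lemma powr_dyadic_le:
  fixes x a :: real
  assumes "2 ^ n \<le> x" "x < 2 ^ (n + 1)"
  shows "x powr a \<le> 2 powr \<bar>a\<bar> * 2 powr (a * real n)"
proof -
  have p: "(2::real) ^ n = 2 powr real n" "(2::real) ^ (n + 1) = 2 powr (real n + 1)"
    by (simp_all add: powr_add powr_realpow)
  have "0 < x" using assms(1) by (rule less_le_trans[rotated]) simp
  show ?thesis
  proof (cases "0 \<le> a")
    case True
    have "x powr a \<le> (2 powr (real n + 1)) powr a"
      using assms(2) True \<open>0 < x\<close> unfolding p by (intro powr_mono2) auto
    also have "\<dots> = 2 powr \<bar>a\<bar> * 2 powr (a * real n)"
      using True by (simp add: powr_powr powr_add[symmetric] algebra_simps)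
    finally show ?thesis .
  next
    case False
    have "x powr a \<le> (2 powr real n) powr a"
      using assms(1) False unfolding p by (intro powr_mono2') auto
    also have "\<dots> = 1 * 2 powr (a * real n)" by (simp add: powr_powr mult.commute)
    also have "\<dots> \<le> 2 powr \<bar>a\<bar> * 2 powr (a * real n)"
      by (intro mult_right_mono ge_one_powr_ge_zero) auto
    finally show ?thesis .
  qed
qed

lemma summable_2_powr: "0 < e \<Longrightarrow> summable (\<lambda>n. 2 powr (- e * real n))"
proof -
  assume "0 < e"
  then have "summable (\<lambda>n. (2 powr (- e)) ^ n)"
    by (intro summable_geometric) (simp add: powr_less_one)
  then show ?thesis by (simp add: powr_realpow[symmetric] powr_powr)
qed

text \<open>A bound of size 2^(a n) on the shell where \<open>m\<close> is about 2^n becomes a bound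
  with the weight m^(- a - e): the spare \<open>e\<close> produces a geometric series, and 2^|a + e|
  is the price of replacing \<open>m\<close> by 2^n on a shell.\<close>

lemma tri_dyadic_sum:
  fixes m :: "'a::euclidean_space \<Rightarrow> 'a \<Rightarrow> real"
  assumes k: "kernel k" and m: "kernel m" and m1: "\<And>x y. 1 \<le> m x y" and e: "0 < e"
    and *: "\<And>n. tri (\<lambda>x y. k x y * of_bool (2 ^ n \<le> m x y \<and> m x y < 2 ^ (n + 1))) (C * 2 powr (a * real n))"
  shows "tri (\<lambda>x y. k x y * m x y powr (- a - e)) (C * (2 powr \<bar>a + e\<bar> * (\<Sum>n. 2 powr (- e * real n))))"
proof -
  note [measurable] = kernel_measurable_compose[OF k] kernel_measurable_compose[OF m]
  let ?c = "\<lambda>n. 2 powr \<bar>a + e\<bar> * 2 powr (- (a + e) * real n)"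
  have eq: "?c n * (C * 2 powr (a * real n)) = C * 2 powr \<bar>a + e\<bar> * 2 powr (- e * real n)" for n
    by (simp add: powr_add[symmetric] algebra_simps)
  have "tri (\<lambda>x y. k x y * m x y powr (- a - e)) (\<Sum>n. ?c n * (C * 2 powr (a * real n)))"
  proof (rule tri_suminf)
    show "tri (\<lambda>x y. ?c n * (k x y * of_bool (2 ^ n \<le> m x y \<and> m x y < 2 ^ (n + 1)))) (?c n * (C * 2 powr (a * real n)))" for n
      by (rule tri_cmult[OF *]) simp
    show "summable (\<lambda>n. ?c n * (C * 2 powr (a * real n)))"
      unfolding eq using summable_2_powr[OF e] by (intro summable_mult)
    show "kernel (\<lambda>x y. k x y * m x y powr (- a - e))"
      by (auto simp: kernel_def kernel_nonneg[OF k])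
    fix x y
    obtain n where n: "2 ^ n \<le> m x y" "m x y < 2 ^ (n + 1)" using ex_dyadic[OF m1] by blast
    let ?f = "\<lambda>n. ennreal (?c n * (k x y * of_bool (2 ^ n \<le> m x y \<and> m x y < 2 ^ (n + 1))))"
    have "ennreal (k x y * m x y powr (- a - e)) \<le> ?f n"
    proof (rule ennreal_leI)
      have "\<bar>- a - e\<bar> = \<bar>a + e\<bar>" "(- a - e) * real n = - (a + e) * real n" by (auto simp: algebra_simps)
      then have "m x y powr (- a - e) \<le> ?c n" using powr_dyadic_le[OF n, of "- a - e"] by simp
      then show "k x y * m x y powr (- a - e) \<le> ?c n * (k x y * of_bool (2 ^ n \<le> m x y \<and> m x y < 2 ^ (n + 1)))"
        using n mult_left_mono[of "m x y powr (- a - e)" "?c n" "k x y"] kernel_nonneg[OF k, of x y]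
        by (simp add: mult_ac)
    qed
    also have "\<dots> = sum ?f {n}" by simp
    also have "\<dots> \<le> (\<Sum>n. ?f n)" by (intro sum_le_suminf) auto
    finally show "ennreal (k x y * m x y powr (- a - e)) \<le> (\<Sum>n. ?f n)" .
  qed
  also have "(\<Sum>n. ?c n * (C * 2 powr (a * real n))) = C * (2 powr \<bar>a + e\<bar> * (\<Sum>n. 2 powr (- e * real n)))"
    unfolding eq using suminf_mult[OF summable_2_powr[OF e], of "C * 2 powr \<bar>a + e\<bar>"] by (simp add: mult.assoc)
  finally show ?thesis .
qed

subsection \<open>Slicing the plane and space-time\<close>

lemma measurable_vec_nth [measurable (raw)]:
  fixes f :: "'c \<Rightarrow> real ^ 'n"
  assumes "f \<in> borel_measurable M" shows "(\<lambda>x. f x $ i) \<in> borel_measurable M"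
proof -
  have "(\<lambda>x::real ^ 'n. x $ i) \<in> borel_measurable borel"
    by (intro borel_measurable_continuous_onI continuous_intros)
  from measurable_compose[OF assms this] show ?thesis .
qed


lemma UNIV_2_distinct: "i \<noteq> j \<Longrightarrow> UNIV = {i, j::2}"
  using UNIV_2 exhaust_2[of i] exhaust_2[of j] by auto

lemma inner_vec2: "i \<noteq> j \<Longrightarrow> inner x y = x $ i * y $ i + x $ j * y $ (j::2)" for x y :: "real ^ 2"
  by (simp add: inner_vec_def UNIV_2_distinct[of i j])

lemma norm_vec2_le: "i \<noteq> j \<Longrightarrow> norm x \<le> \<bar>x $ i\<bar> + \<bar>x $ (j::2)\<bar>" for x :: "real ^ 2"
  using norm_le_l1_cart[of x] by (simp add: UNIV_2_distinct[of i j])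

text \<open>The index selects which coordinate comes first, so that arguments can be run in the
  frame where a chosen coordinate dominates.\<close>

definition vec2 :: "2 \<Rightarrow> real \<Rightarrow> real \<Rightarrow> real ^ 2" where
  "vec2 i x y = (\<chi> k. if k = i then x else y)"

lemma vec2_nth [simp]: "vec2 i x y $ i = x" "j \<noteq> i \<Longrightarrow> vec2 i x y $ j = y"
  by (simp_all add: vec2_def)

lemma measurable_vec2: "(\<lambda>z. vec2 i (fst z) (snd z)) \<in> borel_measurable borel"
proof -
  have "continuous_on UNIV (\<lambda>z::real \<times> real. if k = i then fst z else snd z)" for k
    by (cases "k = i") (auto intro!: continuous_intros)
  then show ?thesis
    unfolding vec2_def by (intro borel_measurable_continuous_onI continuous_on_vec_lambda)
qed

lemma measurable_vec2' [measurable (raw)]: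
  assumes "f \<in> borel_measurable M" "g \<in> borel_measurable M"
  shows "(\<lambda>x. vec2 i (f x) (g x)) \<in> borel_measurable M"
  using measurable_compose[OF borel_measurable_Pair[OF assms] measurable_vec2] by simp

lemma lborel_vec2: "distr lborel borel (\<lambda>z. vec2 i (fst z) (snd z)) = lborel"
proof (rule lborel_eqI[symmetric])
  fix l u :: "real ^ 2"
  assume lu: "\<And>b. b \<in> Basis \<Longrightarrow> l \<bullet> b \<le> u \<bullet> b"
  define j where "j = i + 1"
  have ij: "i \<noteq> j" unfolding j_def using exhaust_2[of i] by auto
  have B: "(Basis :: (real ^ 2) set) = {axis i 1, axis j 1}"
    unfolding Basis_vec_def by (auto simp: UNIV_2_distinct[OF ij])
  have ax: "axis i (1::real) \<noteq> axis j 1" using ij by (simp add: axis_eq_axis)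
  have "(\<lambda>z. vec2 i (fst z) (snd z)) -` box l u = box (l $ i, l $ j) (u $ i, u $ j)"
    using ij by (auto simp: mem_box B inner_axis Basis_prod_def vec2_def)
  then have "emeasure (distr lborel borel (\<lambda>z. vec2 i (fst z) (snd z))) (box l u)
      = emeasure lborel (box (l $ i, l $ j) (u $ i, u $ j))"
    by (subst emeasure_distr) (auto intro: measurable_vec2)
  also have "\<dots> = (\<Prod>b\<in>Basis. ((u $ i, u $ j) - (l $ i, l $ j)) \<bullet> b)"
    using lu[of "axis i 1"] lu[of "axis j 1"]
    by (intro emeasure_lborel_box) (auto simp: Basis_prod_def B inner_axis)
  also have "\<dots> = (\<Prod>b\<in>Basis. (u - l) \<bullet> b)"
    by (simp add: B ax inner_axis Basis_prod_def mult.commute)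
  finally show "emeasure (distr lborel borel (\<lambda>z. vec2 i (fst z) (snd z))) (box l u) = (\<Prod>b\<in>Basis. (u - l) \<bullet> b)" .
qed simp

lemma nn_integral_vec2:
  assumes [measurable]: "F \<in> borel_measurable borel"
  shows "(\<integral>\<^sup>+ \<xi>. F \<xi> \<partial>lborel) = (\<integral>\<^sup>+ x. \<integral>\<^sup>+ y. F (vec2 i x y) \<partial>lborel \<partial>lborel)"
proof -
  have "(\<integral>\<^sup>+ \<xi>. F \<xi> \<partial>lborel) = (\<integral>\<^sup>+ z. F (vec2 i (fst z) (snd z)) \<partial>(lborel :: (real \<times> real) measure))"
    by (subst lborel_vec2[symmetric, of i]) (simp add: nn_integral_distr measurable_vec2)
  also have "\<dots> = (\<integral>\<^sup>+ z. F (vec2 i (fst z) (snd z)) \<partial>(lborel \<Otimes>\<^sub>M lborel))"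
    by (simp add: lborel_prod)
  also have "\<dots> = (\<integral>\<^sup>+ x. \<integral>\<^sup>+ y. F (vec2 i x y) \<partial>lborel \<partial>lborel)"
    by (subst lborel.nn_integral_fst[symmetric]) auto
  finally show ?thesis .
qed

lemma nn_integral_spacetime:
  fixes F :: "spacetime \<Rightarrow> ennreal"
  assumes [measurable]: "F \<in> borel_measurable borel"
  shows "(\<integral>\<^sup>+ p. F p \<partial>lborel) = (\<integral>\<^sup>+ \<xi>. \<integral>\<^sup>+ \<tau>. F (\<xi>, \<tau>) \<partial>lborel \<partial>lborel)"
proof -
  have "(\<integral>\<^sup>+ p. F p \<partial>lborel) = (\<integral>\<^sup>+ p. F p \<partial>(lborel \<Otimes>\<^sub>M lborel))"
    by (simp add: lborel_prod)
  also have "\<dots> = (\<integral>\<^sup>+ \<xi>. \<integral>\<^sup>+ \<tau>. F (\<xi>, \<tau>) \<partial>lborel \<partial>lborel)"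
    by (subst lborel.nn_integral_fst[symmetric]) (auto simp: lborel_prod)
  finally show ?thesis .
qed

lemma emeasure_real_diameter:
  fixes T :: "real set"
  assumes "\<And>x y. x \<in> T \<Longrightarrow> y \<in> T \<Longrightarrow> \<bar>y - x\<bar> \<le> \<kappa>"
  shows "emeasure lborel T \<le> ennreal (2 * \<kappa>)"
proof (cases "T = {}")
  case False
  then obtain x where "x \<in> T" by auto
  then have "T \<subseteq> {x - \<kappa>..x + \<kappa>}" using assms[OF \<open>x \<in> T\<close>] by (force simp: abs_le_iff)
  then have "emeasure lborel T \<le> emeasure lborel {x - \<kappa>..x + \<kappa>}" by (intro emeasure_mono) auto
  also have "\<dots> = ennreal (2 * \<kappa>)" using assms[OF \<open>x \<in> T\<close> \<open>x \<in> T\<close>] by simp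
  finally show ?thesis .
qed simp

text \<open>After the shear y = t x + b the strip becomes an interval of length 2 \<rho> in
  \<open>b\<close>, and each line of slope \<open>t\<close> meets \<open>S\<close> in a set of
  diameter at most \<kappa>, hence of length at most 2 \<kappa>.\<close>

lemma emeasure_plane_le:
  fixes S :: "(real ^ 2) set"
  assumes S [measurable]: "S \<in> sets borel" and ij: "i \<noteq> j" and nn: "0 \<le> \<rho>" "0 \<le> \<kappa>"
    and strip: "\<And>\<xi>. \<xi> \<in> S \<Longrightarrow> \<bar>\<xi> $ j - t * \<xi> $ i - c\<bar> \<le> \<rho>"
    and slice: "\<And>\<xi> \<eta>. \<xi> \<in> S \<Longrightarrow> \<eta> \<in> S \<Longrightarrow> \<eta> $ j - \<xi> $ j = t * (\<eta> $ i - \<xi> $ i) \<Longrightarrow> \<bar>\<eta> $ i - \<xi> $ i\<bar> \<le> \<kappa>"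
  shows "emeasure lborel S \<le> ennreal (4 * \<rho> * \<kappa>)"
proof -
  have "emeasure lborel S = (\<integral>\<^sup>+ \<xi>. indicator S \<xi> \<partial>lborel)" by simp
  also have "\<dots> = (\<integral>\<^sup>+ x. \<integral>\<^sup>+ y. indicator S (vec2 i x y) \<partial>lborel \<partial>lborel)"
    by (rule nn_integral_vec2) simp
  also have "\<dots> = (\<integral>\<^sup>+ x. \<integral>\<^sup>+ b. indicator S (vec2 i x (t * x + b)) \<partial>lborel \<partial>lborel)"
  proof (rule nn_integral_cong)
    fix x :: real
    show "(\<integral>\<^sup>+ y. indicator S (vec2 i x y) \<partial>lborel) = (\<integral>\<^sup>+ b. indicator S (vec2 i x (t * x + b)) \<partial>lborel)"
      by (rule nn_integral_lborel_plus[symmetric]) measurable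
  qed
  also have "\<dots> = (\<integral>\<^sup>+ b. \<integral>\<^sup>+ x. indicator S (vec2 i x (t * x + b)) \<partial>lborel \<partial>lborel)"
    by (rule lborel_pair.Fubini') measurable
  also have "\<dots> \<le> (\<integral>\<^sup>+ b. ennreal (2 * \<kappa>) * indicator {c - \<rho>..c + \<rho>} b \<partial>lborel)"
  proof (rule nn_integral_mono)
    fix b :: real
    define T where "T = {x. vec2 i x (t * x + b) \<in> S}"
    have [measurable]: "T \<in> sets borel" unfolding T_def by measurable
    have "(\<integral>\<^sup>+ x. indicator S (vec2 i x (t * x + b)) \<partial>lborel) = (\<integral>\<^sup>+ x. indicator T x \<partial>lborel)"
      by (intro nn_integral_cong) (auto simp: T_def indicator_def)
    also have "\<dots> = emeasure lborel T" by simp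
    also have "\<dots> \<le> ennreal (2 * \<kappa>) * indicator {c - \<rho>..c + \<rho>} b"
    proof (cases "T = {}")
      case False
      then obtain x where x: "x \<in> T" by auto
      have "\<bar>b - c\<bar> \<le> \<rho>" using strip[of "vec2 i x (t * x + b)"] x ij by (simp add: T_def)
      then have "b \<in> {c - \<rho>..c + \<rho>}" by auto
      moreover have "emeasure lborel T \<le> ennreal (2 * \<kappa>)"
      proof (rule emeasure_real_diameter)
        fix x y assume "x \<in> T" "y \<in> T"
        then show "\<bar>y - x\<bar> \<le> \<kappa>"
          using slice[of "vec2 i x (t * x + b)" "vec2 i y (t * y + b)"] ij by (simp add: T_def algebra_simps)
      qed
      ultimately show ?thesis by simp
    qed simp
    finally show "(\<integral>\<^sup>+ x. indicator S (vec2 i x (t * x + b)) \<partial>lborel) \<le> ennreal (2 * \<kappa>) * indicator {c - \<rho>..c + \<rho>} b" .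
  qed
  also have "\<dots> = ennreal (2 * \<kappa>) * ennreal (2 * \<rho>)"
    using nn by (subst nn_integral_cmult_indicator) auto
  also have "\<dots> = ennreal (4 * \<rho> * \<kappa>)"
    using nn by (simp add: ennreal_mult[symmetric] mult_ac)
  finally show ?thesis .
qed

text \<open>The area depends only on the difference of the squared radii, which is at most
  \<open>E\<close> whatever \<open>c\<close> is; the 4 replaces \<pi>.\<close>

lemma emeasure_annulus_le:
  fixes a :: "real ^ 2"
  assumes "0 \<le> E"
  shows "emeasure lborel {x. \<bar>c - 2 * (norm (x - a))\<^sup>2\<bar> \<le> E} \<le> ennreal (4 * E)"
proof (cases "c + E < 0")
  case True
  have "\<not> \<bar>c - 2 * (norm (x - a))\<^sup>2\<bar> \<le> E" for x
    using True zero_le_power2[of "norm (x - a)"] by linarith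
  then show ?thesis by simp
next
  case False
  define R where "R = sqrt ((c + E) / 2)"
  define r where "r = sqrt (max 0 ((c - E) / 2))"
  have rR: "0 \<le> r" "r \<le> R" "0 \<le> R" unfolding r_def R_def using False assms
    by (auto intro!: real_sqrt_le_mono simp: max_def)
  have R2: "R\<^sup>2 = (c + E) / 2" unfolding R_def using False by simp
  have r2: "r\<^sup>2 = max 0 ((c - E) / 2)" unfolding r_def by simp
  have "{x. \<bar>c - 2 * (norm (x - a))\<^sup>2\<bar> \<le> E} \<subseteq> cball a R - ball a r"
  proof
    fix x assume "x \<in> {x. \<bar>c - 2 * (norm (x - a))\<^sup>2\<bar> \<le> E}"
    then have x: "(norm (x - a))\<^sup>2 \<le> R\<^sup>2" "r\<^sup>2 \<le> (norm (x - a))\<^sup>2" unfolding R2 r2 by (auto simp: abs_le_iff)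
    have "norm (x - a) \<le> R" "r \<le> norm (x - a)"
      using power2_le_imp_le[OF x(1)] power2_le_imp_le[OF x(2)] rR by auto
    then show "x \<in> cball a R - ball a r" by (simp add: dist_norm norm_minus_commute)
  qed
  then have "emeasure lborel {x. \<bar>c - 2 * (norm (x - a))\<^sup>2\<bar> \<le> E} \<le> emeasure lborel (cball a R - ball a r)"
    by (intro emeasure_mono) auto
  also have "\<dots> = emeasure lborel (cball a R) - emeasure lborel (ball a r)"
    using rR emeasure_lborel_ball_finite[of a r] by (intro emeasure_Diff) (auto simp: subset_iff)
  also have "\<dots> = ennreal (pi * R\<^sup>2) - ennreal (pi * r\<^sup>2)"
    using rR by (simp add: emeasure_cball emeasure_ball unit_ball_vol_2)
  also have "\<dots> = ennreal (pi * R\<^sup>2 - pi * r\<^sup>2)"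
    by (subst ennreal_minus) auto
  also have "\<dots> \<le> ennreal (4 * E)"
  proof (rule ennreal_leI)
    have "R\<^sup>2 - r\<^sup>2 \<le> E" unfolding R2 r2 by (auto simp: max_def field_simps)
    then have "pi * (R\<^sup>2 - r\<^sup>2) \<le> pi * E" by simp
    also have "\<dots> \<le> 4 * E" using pi_less_4 assms by (intro mult_right_mono) auto
    finally show "pi * R\<^sup>2 - pi * r\<^sup>2 \<le> 4 * E" by (simp add: algebra_simps)
  qed
  finally show ?thesis .
qed

lemma emeasure_spacetime_le:
  fixes E :: "spacetime set"
  assumes [measurable]: "E \<in> sets borel" "S \<in> sets borel"
    and E: "\<And>\<xi> \<tau>. (\<xi>, \<tau>) \<in> E \<Longrightarrow> \<xi> \<in> S" and nn: "0 \<le> m"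
    and slice: "\<And>\<xi> \<tau> \<tau>'. (\<xi>, \<tau>) \<in> E \<Longrightarrow> (\<xi>, \<tau>') \<in> E \<Longrightarrow> \<bar>\<tau>' - \<tau>\<bar> \<le> m"
  shows "emeasure lborel E \<le> ennreal (2 * m) * emeasure lborel S"
proof -
  have "emeasure lborel E = (\<integral>\<^sup>+ p. indicator E p \<partial>lborel)" by simp
  also have "\<dots> = (\<integral>\<^sup>+ \<xi>. \<integral>\<^sup>+ \<tau>. indicator E (\<xi>, \<tau>) \<partial>lborel \<partial>lborel)"
    by (rule nn_integral_spacetime) simp
  also have "\<dots> \<le> (\<integral>\<^sup>+ \<xi>. ennreal (2 * m) * indicator S \<xi> \<partial>lborel)"
  proof (rule nn_integral_mono)
    fix \<xi> :: "real ^ 2"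
    define T where "T = {\<tau>. (\<xi>, \<tau>) \<in> E}"
    have [measurable]: "T \<in> sets borel" unfolding T_def by measurable
    have "(\<integral>\<^sup>+ \<tau>. indicator E (\<xi>, \<tau>) \<partial>lborel) = (\<integral>\<^sup>+ x. indicator T x \<partial>lborel)"
      by (intro nn_integral_cong) (auto simp: T_def indicator_def)
    also have "\<dots> = emeasure lborel T" by simp
    also have "\<dots> \<le> ennreal (2 * m) * indicator S \<xi>"
    proof (cases "T = {}")
      case False
      then have "\<xi> \<in> S" using E by (auto simp: T_def)
      then show ?thesis using emeasure_real_diameter[of T m] slice by (simp add: T_def)
    qed simp
    finally show "(\<integral>\<^sup>+ \<tau>. indicator E (\<xi>, \<tau>) \<partial>lborel) \<le> ennreal (2 * m) * indicator S \<xi>" .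
  qed
  also have "\<dots> = ennreal (2 * m) * emeasure lborel S"
    by (subst nn_integral_cmult_indicator) auto
  finally show ?thesis .
qed


subsection \<open>Measurability\<close>

text \<open>The library rules for projections only see product measures, not \<open>borel\<close> on a product type.\<close>

declare measurable_fst [measurable del] measurable_snd [measurable del]

lemma measurable_fst_borel [measurable]:
  "fst \<in> borel_measurable (borel :: ('a::second_countable_topology \<times> 'b::second_countable_topology) measure)"
  by (intro borel_measurable_continuous_onI continuous_intros)

lemma measurable_snd_borel [measurable]:
  "snd \<in> borel_measurable (borel :: ('a::second_countable_topology \<times> 'b::second_countable_topology) measure)"
  by (intro borel_measurable_continuous_onI continuous_intros)

lemma measurable_bracket [measurable (raw)]:
  assumes [measurable]: "f \<in> borel_measurable M"
  shows "(\<lambda>x. bracket (f x)) \<in> borel_measurable M"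
  unfolding bracket_def by measurable

lemma modulation_eq: "modulation p = bracket (snd p - (norm (fst p))\<^sup>2)"
  by (simp add: modulation_def case_prod_unfold)

lemma parabolic_abs_eq: "parabolic_abs p = sqrt (\<bar>snd p\<bar> + (norm (fst p))\<^sup>2)"
  by (simp add: parabolic_abs_def case_prod_unfold)

lemma measurable_modulation [measurable (raw)]:
  assumes [measurable]: "f \<in> borel_measurable M"
  shows "(\<lambda>x. modulation (f x)) \<in> borel_measurable M"
  unfolding modulation_eq by measurable

lemma measurable_parabolic_abs [measurable (raw)]:
  assumes [measurable]: "f \<in> borel_measurable M"
  shows "(\<lambda>x. parabolic_abs (f x)) \<in> borel_measurable M"
  unfolding parabolic_abs_eq by measurable

lemma bracket_ge_1: "1 \<le> bracket x"
  by (simp add: bracket_def)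

lemma bracket_pos: "0 < bracket x"
  by (simp add: bracket_def add_pos_nonneg)

lemma modulation_ge_1: "1 \<le> modulation p"
  by (simp add: modulation_eq bracket_ge_1)

lemma kernelI:
  "(\<lambda>z. k (fst z) (snd z)) \<in> borel_measurable borel \<Longrightarrow> (\<And>x y. 0 \<le> k x y) \<Longrightarrow> kernel k"
  by (simp add: kernel_def borel_prod)


subsection \<open>Kernels that are indicator functions\<close>

lemma kernel_of_bool:
  assumes "Measurable.pred borel (\<lambda>z. P (fst z) (snd z))"
  shows "kernel (\<lambda>x y. of_bool (P x y))"
  using measurable_of_bool[OF assms] by (intro kernelI) auto

lemma nn_integral_of_bool_power2:
  assumes "Measurable.pred borel P"
  shows "(\<integral>\<^sup>+ x. ennreal (of_bool (P x)) ^ 2 \<partial>lborel) = emeasure lborel {x. P x}"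
proof -
  have "{x. P x} \<in> sets lborel" using assms by (simp add: pred_def)
  then have "emeasure lborel {x. P x} = (\<integral>\<^sup>+ x. indicator {x. P x} x \<partial>lborel)" by simp
  also have "\<dots> = (\<integral>\<^sup>+ x. ennreal (of_bool (P x)) ^ 2 \<partial>lborel)"
    by (intro nn_integral_cong) (auto simp: indicator_def)
  finally show ?thesis by simp
qed

lemma pred_compose:
  fixes P :: "'a::euclidean_space \<Rightarrow> 'a \<Rightarrow> bool"
  assumes "Measurable.pred borel (\<lambda>z. P (fst z) (snd z))"
    and "f \<in> borel_measurable M" "g \<in> borel_measurable M"
  shows "Measurable.pred M (\<lambda>x. P (f x) (g x))"
  using measurable_compose[OF borel_measurable_Pair[OF assms(2,3)] assms(1)] by simp

lemma tri_of_bool_first: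
  assumes P: "Measurable.pred borel (\<lambda>z. P (fst z) (snd z))" and C: "0 \<le> C"
    and *: "\<And>x. emeasure lborel {y. P x y} \<le> ennreal (C\<^sup>2)"
  shows "tri (\<lambda>x y. of_bool (P x y)) C"
proof (rule tri_fix_first[OF kernel_of_bool[OF P] C])
  fix x
  show "(\<integral>\<^sup>+ y. ennreal (of_bool (P x y)) ^ 2 \<partial>lborel) \<le> ennreal C ^ 2"
    unfolding ennreal_power[OF C]
    by (subst nn_integral_of_bool_power2, rule pred_compose[OF P]) (use * in auto)
qed

lemma tri_of_bool_sum:
  assumes P: "Measurable.pred borel (\<lambda>z. P (fst z) (snd z))" and C: "0 \<le> C"
    and *: "\<And>z. emeasure lborel {x. P x (z - x)} \<le> ennreal (C\<^sup>2)"
  shows "tri (\<lambda>x y. of_bool (P x y)) C"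
proof (rule tri_fix_sum[OF kernel_of_bool[OF P] C])
  fix z
  show "(\<integral>\<^sup>+ x. ennreal (of_bool (P x (z - x))) ^ 2 \<partial>lborel) \<le> ennreal C ^ 2"
    unfolding ennreal_power[OF C]
    by (subst nn_integral_of_bool_power2, rule pred_compose[OF P]) (use * in auto)
qed

subsection \<open>Kernels controlled by integrability\<close>

lemma nn_integral_bracket_powr:
  fixes a :: real
  assumes a: "real DIM('a::euclidean_space) < a"
  shows "\<exists>C\<ge>0. \<forall>c::'a. (\<integral>\<^sup>+ x. ennreal (bracket (x - c) powr - a) \<partial>lborel) \<le> ennreal C"
proof -
  let ?d = "DIM('a)"
  define V where "V = unit_ball_vol (real ?d)"
  have V: "0 \<le> V" by (simp add: V_def)
  define e where "e = a - real ?d"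
  have e: "0 < e" using a by (simp add: e_def)
  define w where "w n = 2 powr \<bar>- a\<bar> * 2 powr (- a * real n)" for n :: nat
  define K where "K = 2 powr \<bar>- a\<bar> * V * 2 ^ ?d"
  have K: "0 \<le> K" using V by (simp add: K_def)
  have eq: "w n * (V * (2 ^ (n + 1)) ^ ?d) = K * 2 powr (- e * real n)" for n
  proof -
    have "((2::real) ^ (n + 1)) ^ ?d = 2 ^ ?d * 2 powr (real n * real ?d)"
      by (simp add: power_mult_distrib powr_powr[symmetric] powr_realpow flip: power_mult)
    moreover have "2 powr (- a * real n) * 2 powr (real n * real ?d) = 2 powr (- e * real n)"
      by (simp add: powr_add[symmetric] e_def algebra_simps)
    ultimately show ?thesis by (simp add: w_def K_def mult_ac)
  qed
  have le: "ennreal (bracket (x::'a) powr - a) \<le> (\<Sum>n. ennreal (w n) * indicator (cball 0 (2 ^ (n + 1))) x)" for x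
  proof -
    obtain n where n: "2 ^ n \<le> bracket x" "bracket x < 2 ^ (n + 1)" using ex_dyadic[OF bracket_ge_1] by blast
    then have "x \<in> cball 0 (2 ^ (n + 1))" unfolding mem_cball by (simp add: bracket_def)
    define f where "f n = ennreal (w n) * indicator (cball 0 (2 ^ (n + 1))) x" for n
    have "ennreal (bracket x powr - a) \<le> f n"
      using powr_dyadic_le[OF n, of "- a"] \<open>x \<in> cball 0 (2 ^ (n + 1))\<close>
      by (simp add: w_def f_def ennreal_leI)
    also have "\<dots> = sum f {n}" by simp
    also have "\<dots> \<le> (\<Sum>n. f n)" by (intro sum_le_suminf) auto
    finally show ?thesis unfolding f_def .
  qed
  have "(\<integral>\<^sup>+ x. ennreal (bracket (x::'a) powr - a) \<partial>lborel) \<le> (\<integral>\<^sup>+ x. (\<Sum>n. ennreal (w n) * indicator (cball 0 (2 ^ (n + 1))) (x::'a)) \<partial>lborel)"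
    by (intro nn_integral_mono le)
  also have "\<dots> = (\<Sum>n. ennreal (w n) * emeasure lborel (cball (0::'a) (2 ^ (n + 1))))"
    by (subst nn_integral_suminf)
      (auto simp: nn_integral_cmult_indicator intro!: borel_measurable_times_ennreal borel_measurable_indicator)
  also have "\<dots> = (\<Sum>n. ennreal (K * 2 powr (- e * real n)))"
  proof -
    have "ennreal (w n) * emeasure lborel (cball (0::'a) (2 ^ (n + 1))) = ennreal (K * 2 powr (- e * real n))" for n
      unfolding eq[symmetric] by (subst emeasure_cball) (auto simp: ennreal_mult' w_def V_def)
    then show ?thesis by simp
  qed
  also have "\<dots> = ennreal (\<Sum>n. K * 2 powr (- e * real n))"
    using K by (intro suminf_ennreal2 summable_mult summable_2_powr e) auto
  finally have fin: "(\<integral>\<^sup>+ x. ennreal (bracket (x::'a) powr - a) \<partial>lborel) \<le> ennreal (\<Sum>n. K * 2 powr (- e * real n))" .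
  have "(\<integral>\<^sup>+ x. ennreal (bracket (x - c :: 'a) powr - a) \<partial>lborel) = (\<integral>\<^sup>+ x. ennreal (bracket (x::'a) powr - a) \<partial>lborel)" for c
    using nn_integral_lborel_plus[of "\<lambda>x. ennreal (bracket x powr - a)" "- c"] by simp
  moreover have "0 \<le> (\<Sum>n. K * 2 powr (- e * real n))"
    using K by (intro suminf_nonneg summable_mult summable_2_powr e) auto
  ultimately show ?thesis using fin by (intro exI[of _ "\<Sum>n. K * 2 powr (- e * real n)"]) simp
qed

text \<open>The centre in time may be any measurable function of the spatial variable, since the
  time integral is done first and is translation invariant. This covers the modulation of one input
  and also that of the sum with one input frozen.\<close>

lemma nn_integral_weights:
  fixes \<eta> :: real
  assumes "0 < \<eta>"
  shows "\<exists>C\<ge>0. \<forall>a\<in>borel_measurable borel. \<forall>c :: real ^ 2.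
    (\<integral>\<^sup>+ p. ennreal (bracket (snd p - a (fst p) :: real) powr (- 1 / 2 - \<eta>) * bracket (fst p - c) powr (- 1 - \<eta>)) ^ 2 \<partial>lborel) \<le> ennreal C ^ 2"
proof -
  obtain C1 where C1: "0 \<le> C1" "\<And>c::real. (\<integral>\<^sup>+ x. ennreal (bracket (x - c) powr - (1 + 2 * \<eta>)) \<partial>lborel) \<le> ennreal C1"
    using nn_integral_bracket_powr[where 'a = real, of "1 + 2 * \<eta>"] assms by auto
  obtain C2 where C2: "0 \<le> C2" "\<And>c::real ^ 2. (\<integral>\<^sup>+ x. ennreal (bracket (x - c) powr - (2 + 2 * \<eta>)) \<partial>lborel) \<le> ennreal C2"
    using nn_integral_bracket_powr[where 'a = "real ^ 2", of "2 + 2 * \<eta>"] assms by auto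
  have sq: "(u powr b)\<^sup>2 = u powr (2 * b)" if "0 < u" for u b :: real
    using that by (simp add: powr_powr power2_eq_square powr_add[symmetric])
  have "(\<integral>\<^sup>+ p. ennreal (bracket (snd p - a (fst p) :: real) powr (- 1 / 2 - \<eta>) * bracket (fst p - c) powr (- 1 - \<eta>)) ^ 2 \<partial>lborel) \<le> ennreal (sqrt (C1 * C2)) ^ 2"
    if [measurable]: "a \<in> borel_measurable borel" for a and c :: "real ^ 2"
  proof -
    have "(\<integral>\<^sup>+ p. ennreal (bracket (snd p - a (fst p) :: real) powr (- 1 / 2 - \<eta>) * bracket (fst p - c) powr (- 1 - \<eta>)) ^ 2 \<partial>lborel)
      = (\<integral>\<^sup>+ p. ennreal (bracket (fst p - c) powr - (2 + 2 * \<eta>)) * ennreal (bracket (snd p - a (fst p) :: real) powr - (1 + 2 * \<eta>)) \<partial>lborel)"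
      by (intro nn_integral_cong)
        (simp add: ennreal_power power_mult_distrib sq bracket_pos ennreal_mult[symmetric] algebra_simps)
    also have "\<dots> = (\<integral>\<^sup>+ \<xi>. \<integral>\<^sup>+ \<tau>. ennreal (bracket (\<xi> - c) powr - (2 + 2 * \<eta>)) * ennreal (bracket (\<tau> - a \<xi>) powr - (1 + 2 * \<eta>)) \<partial>lborel \<partial>lborel)"
      by (rule trans[OF nn_integral_spacetime]) measurable
    also have "\<dots> = (\<integral>\<^sup>+ \<xi>. ennreal (bracket (\<xi> - c) powr - (2 + 2 * \<eta>)) * (\<integral>\<^sup>+ \<tau>. ennreal (bracket (\<tau> - a \<xi>) powr - (1 + 2 * \<eta>)) \<partial>lborel) \<partial>lborel)"
      by (intro nn_integral_cong nn_integral_cmult) measurable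
    also have "\<dots> \<le> (\<integral>\<^sup>+ \<xi>. ennreal (bracket (\<xi> - c) powr - (2 + 2 * \<eta>)) * ennreal C1 \<partial>lborel)"
      by (intro nn_integral_mono mult_left_mono C1) auto
    also have "\<dots> = (\<integral>\<^sup>+ \<xi>. ennreal (bracket (\<xi> - c) powr - (2 + 2 * \<eta>)) \<partial>lborel) * ennreal C1"
      by (rule nn_integral_multc) measurable
    also have "\<dots> \<le> ennreal C2 * ennreal C1"
      by (intro mult_right_mono C2) auto
    also have "\<dots> = ennreal (sqrt (C1 * C2)) ^ 2"
      using C1(1) C2(1) by (simp add: ennreal_power ennreal_mult[symmetric] mult.commute)
    finally show ?thesis .
  qed
  then show ?thesis using C1(1) C2(1) by (intro exI[of _ "sqrt (C1 * C2)"]) auto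
qed

definition Mw :: "real \<Rightarrow> spacetime \<Rightarrow> real" where
  "Mw \<eta> p = modulation p powr (- 1 / 2 - \<eta>)"

definition Nw :: "real \<Rightarrow> spacetime \<Rightarrow> real" where
  "Nw \<eta> p = bracket (fst p) powr (- 1 - \<eta>)"

lemma measurable_Mw [measurable]: "Mw \<eta> \<in> borel_measurable borel"
  unfolding Mw_def by measurable

lemma measurable_Nw [measurable]: "Nw \<eta> \<in> borel_measurable borel"
  unfolding Nw_def by measurable

lemma Mw_nonneg [simp]: "0 \<le> Mw \<eta> p" and Nw_nonneg [simp]: "0 \<le> Nw \<eta> p"
  by (simp_all add: Mw_def Nw_def)

text \<open>One power of the modulation compensates the integration in time and one power of a spatial
  frequency the integration in space; the two may belong to different functions.\<close>

lemma tri_weights: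
  fixes \<eta> :: real
  assumes \<eta>: "0 < \<eta>"
  shows "\<exists>C. tri (\<lambda>x y. Mw \<eta> (x + y) * Nw \<eta> (x + y)) C \<and> tri (\<lambda>x y. Mw \<eta> (x + y) * Nw \<eta> x) C \<and>
    tri (\<lambda>x y. Mw \<eta> (x + y) * Nw \<eta> y) C \<and> tri (\<lambda>x y. Mw \<eta> x * Nw \<eta> (x + y)) C \<and>
    tri (\<lambda>x y. Mw \<eta> x * Nw \<eta> x) C \<and> tri (\<lambda>x y. Mw \<eta> x * Nw \<eta> y) C"
proof -
  obtain C where C0: "0 \<le> C" and C: "\<And>a (c::real ^ 2). a \<in> borel_measurable borel \<Longrightarrow>
    (\<integral>\<^sup>+ p. ennreal (bracket (snd p - a (fst p) :: real) powr (- 1 / 2 - \<eta>) * bracket (fst p - c) powr (- 1 - \<eta>)) ^ 2 \<partial>lborel) \<le> ennreal C ^ 2"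
    using nn_integral_weights[OF \<eta>] by blast
  have mod_add: "modulation (x + y) = bracket (snd x - ((norm (fst x + fst y))\<^sup>2 - snd y))" for x y
    by (simp add: modulation_eq algebra_simps)
  have mod_add': "modulation (x + y) = bracket (snd y - ((norm (fst x + fst y))\<^sup>2 - snd x))" for x y
    by (simp add: modulation_eq algebra_simps)
  have br_add: "bracket (fst (x + y)) = bracket (fst x - (- fst y))" for x y :: spacetime
    by simp
  have br_add': "bracket (fst (x + y)) = bracket (fst y - (- fst x))" for x y :: spacetime
    by (simp add: add.commute)
  have br_0: "bracket (fst x) = bracket (fst x - 0)" for x :: spacetime
    by simp
  have br_diff: "bracket (fst (z - x)) = bracket (fst x - fst z)" for x z :: spacetime
    by (simp add: bracket_def norm_minus_commute)
  have "tri (\<lambda>x y. Mw \<eta> (x + y) * Nw \<eta> (x + y)) C"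
  proof (rule tri_fix_first[OF _ C0])
    show "kernel (\<lambda>x y. Mw \<eta> (x + y) * Nw \<eta> (x + y))" by (rule kernelI) measurable
    fix x show "(\<integral>\<^sup>+ y. ennreal (Mw \<eta> (x + y) * Nw \<eta> (x + y)) ^ 2 \<partial>lborel) \<le> ennreal C ^ 2"
      unfolding Mw_def Nw_def mod_add' br_add' by (rule C) measurable
  qed
  moreover have "tri (\<lambda>x y. Mw \<eta> (x + y) * Nw \<eta> x) C"
  proof (rule tri_fix_second[OF _ C0])
    show "kernel (\<lambda>x y. Mw \<eta> (x + y) * Nw \<eta> x)" by (rule kernelI) measurable
    fix y show "(\<integral>\<^sup>+ x. ennreal (Mw \<eta> (x + y) * Nw \<eta> x) ^ 2 \<partial>lborel) \<le> ennreal C ^ 2"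
      unfolding Mw_def Nw_def mod_add by (subst br_0) (rule C, measurable)
  qed
  moreover have "tri (\<lambda>x y. Mw \<eta> (x + y) * Nw \<eta> y) C"
  proof (rule tri_fix_first[OF _ C0])
    show "kernel (\<lambda>x y. Mw \<eta> (x + y) * Nw \<eta> y)" by (rule kernelI) measurable
    fix x show "(\<integral>\<^sup>+ y. ennreal (Mw \<eta> (x + y) * Nw \<eta> y) ^ 2 \<partial>lborel) \<le> ennreal C ^ 2"
      unfolding Mw_def Nw_def mod_add' by (subst br_0) (rule C, measurable)
  qed
  moreover have "tri (\<lambda>x y. Mw \<eta> x * Nw \<eta> (x + y)) C"
  proof (rule tri_fix_second[OF _ C0])
    show "kernel (\<lambda>x y. Mw \<eta> x * Nw \<eta> (x + y))" by (rule kernelI) measurable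
    fix y show "(\<integral>\<^sup>+ x. ennreal (Mw \<eta> x * Nw \<eta> (x + y)) ^ 2 \<partial>lborel) \<le> ennreal C ^ 2"
      unfolding Mw_def Nw_def br_add modulation_eq by (rule C) measurable
  qed
  moreover have "tri (\<lambda>x y. Mw \<eta> x * Nw \<eta> x) C"
  proof (rule tri_fix_second[OF _ C0])
    show "kernel (\<lambda>x y. Mw \<eta> x * Nw \<eta> x)" by (rule kernelI) measurable
    fix y show "(\<integral>\<^sup>+ x. ennreal (Mw \<eta> x * Nw \<eta> x) ^ 2 \<partial>lborel) \<le> ennreal C ^ 2"
      unfolding Mw_def Nw_def modulation_eq by (subst br_0) (rule C, measurable)
  qed
  moreover have "tri (\<lambda>x y. Mw \<eta> x * Nw \<eta> y) C"
  proof (rule tri_fix_sum[OF _ C0])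
    show "kernel (\<lambda>x y. Mw \<eta> x * Nw \<eta> y)" by (rule kernelI) measurable
    fix z show "(\<integral>\<^sup>+ x. ennreal (Mw \<eta> x * Nw \<eta> (z - x)) ^ 2 \<partial>lborel) \<le> ennreal C ^ 2"
      unfolding Mw_def Nw_def br_diff modulation_eq by (rule C) measurable
  qed
  ultimately show ?thesis by blast
qed


subsection \<open>The bilinear \<open>L4\<close> Strichartz estimate\<close>

lemma modulation_less: "modulation p < A \<Longrightarrow> \<bar>snd p - (norm (fst p))\<^sup>2\<bar> < A"
  by (simp add: modulation_eq bracket_def)

lemma norm_add_power2: "(norm (\<xi> + \<eta>))\<^sup>2 = (norm \<xi>)\<^sup>2 + 2 * inner \<xi> \<eta> + (norm \<eta>)\<^sup>2" for \<xi> \<eta> :: "'a::real_inner"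
  by (simp add: power2_norm_eq_inner inner_add_left inner_add_right inner_commute)

lemma resonance:
  "snd (x + y) - (norm (fst (x + y)))\<^sup>2 = (snd x - (norm (fst x))\<^sup>2) + (snd y - (norm (fst y))\<^sup>2) - 2 * inner (fst x) (fst y)"
  for x y :: spacetime
  by (simp add: norm_add_power2)

lemma parallelogram_centered:
  fixes \<xi> \<zeta> :: "'a::real_inner"
  shows "(norm \<xi>)\<^sup>2 + (norm (\<zeta> - \<xi>))\<^sup>2 = (norm \<zeta>)\<^sup>2 / 2 + 2 * (norm (\<xi> - (1/2) *\<^sub>R \<zeta>))\<^sup>2"
  by (simp add: power2_norm_eq_inner inner_diff_left inner_diff_right inner_commute algebra_simps)

lemma min_mult_add_le:
  fixes a b :: real
  assumes "0 \<le> a" "0 \<le> b" shows "min a b * (a + b) \<le> 2 * (a * b)"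
proof (cases "a \<le> b")
  case True
  then have "a * (a + b) \<le> a * (2 * b)" using assms by (intro mult_left_mono) auto
  then show ?thesis using True by (simp add: algebra_simps)
next
  case False
  then have "b * (a + b) \<le> b * (2 * a)" using assms by (intro mult_left_mono) auto
  then show ?thesis using False by (simp add: algebra_simps)
qed

text \<open>For a fixed sum the time is confined to a set of length about min(A, B) and, by the
  parallelogram identity, the frequency to an annulus around half of the total frequency, of area at
  most 4 (A + B). The product is at most 32 A B, below 6^2 A B.\<close>

lemma tri_strichartz:
  assumes AB: "0 < A" "0 < B"
  shows "tri (\<lambda>x y. of_bool (modulation x < A \<and> modulation y < B)) (6 * sqrt (A * B))"
proof (rule tri_of_bool_sum)
  show "Measurable.pred borel (\<lambda>z::spacetime \<times> spacetime. modulation (fst z) < A \<and> modulation (snd z) < B)" by measurable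
  show "0 \<le> 6 * sqrt (A * B)" using AB by simp
  fix z :: spacetime
  define c where "c = snd z - (norm (fst z))\<^sup>2 / 2"
  define S where "S = {\<xi> :: real ^ 2. \<bar>c - 2 * (norm (\<xi> - (1/2) *\<^sub>R fst z))\<^sup>2\<bar> \<le> A + B}"
  have "emeasure lborel {x. modulation x < A \<and> modulation (z - x) < B} \<le> ennreal (2 * (2 * min A B)) * emeasure lborel S"
  proof (rule emeasure_spacetime_le)
    show "{x. modulation x < A \<and> modulation (z - x) < B} \<in> sets borel" by measurable
    show "S \<in> sets borel" unfolding S_def by measurable
    show "0 \<le> 2 * min A B" using AB by simp
  next
    fix \<xi> :: "real ^ 2" and \<tau> \<tau>' :: real
    assume "(\<xi>, \<tau>) \<in> {x. modulation x < A \<and> modulation (z - x) < B}"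
    then have 1: "\<bar>\<tau> - (norm \<xi>)\<^sup>2\<bar> < A" "\<bar>(snd z - \<tau>) - (norm (fst z - \<xi>))\<^sup>2\<bar> < B"
      using modulation_less[of "(\<xi>, \<tau>)" A] modulation_less[of "z - (\<xi>, \<tau>)" B] by auto
    then show "\<xi> \<in> S"
      unfolding S_def c_def using parallelogram_centered[of \<xi> "fst z"] by auto
    assume "(\<xi>, \<tau>') \<in> {x. modulation x < A \<and> modulation (z - x) < B}"
    then have "\<bar>\<tau>' - (norm \<xi>)\<^sup>2\<bar> < A" "\<bar>(snd z - \<tau>') - (norm (fst z - \<xi>))\<^sup>2\<bar> < B"
      using modulation_less[of "(\<xi>, \<tau>')" A] modulation_less[of "z - (\<xi>, \<tau>')" B] by auto
    with 1 show "\<bar>\<tau>' - \<tau>\<bar> \<le> 2 * min A B" by auto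
  qed
  also have "\<dots> \<le> ennreal (2 * (2 * min A B)) * ennreal (4 * (A + B))"
    unfolding S_def using AB by (intro mult_left_mono emeasure_annulus_le) auto
  also have "\<dots> = ennreal (2 * (2 * min A B) * (4 * (A + B)))"
    using AB by (simp add: ennreal_mult)
  also have "\<dots> \<le> ennreal ((6 * sqrt (A * B))\<^sup>2)"
  proof (rule ennreal_leI)
    have "2 * (2 * min A B) * (4 * (A + B)) = 16 * (min A B * (A + B))" by simp
    also have "\<dots> \<le> 36 * (A * B)" using min_mult_add_le[of A B] mult_pos_pos[OF AB] AB by linarith
    finally show "2 * (2 * min A B) * (4 * (A + B)) \<le> (6 * sqrt (A * B))\<^sup>2"
      using AB by (simp add: power_mult_distrib)
  qed
  finally show "emeasure lborel {x. modulation x < A \<and> modulation (z - x) < B} \<le> ennreal ((6 * sqrt (A * B))\<^sup>2)" .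
qed

lemma tri_strichartz_reflected:
  assumes AB: "0 < A" "0 < B"
  shows "tri (\<lambda>x y. of_bool (modulation x < A \<and> modulation (x + y) < B)) (6 * sqrt (A * B))"
  using tri_reflect[of "\<lambda>x. of_bool (modulation x < A)" "\<lambda>x. of_bool (modulation x < B)" "6 * sqrt (A * B)"]
    tri_strichartz[OF AB]
  by (simp add: of_bool_conj)


subsection \<open>A transversality estimate for one low frequency\<close>

lemma norm_frequency_ge: "4 \<le> bracket \<xi> \<Longrightarrow> 3 / 4 * bracket \<xi> \<le> norm \<xi>"
  by (simp add: bracket_def)

lemma ex_large_coordinate:
  fixes \<xi> :: "real ^ 2"
  obtains i j :: 2 where "i \<noteq> j" "norm \<xi> \<le> 2 * \<bar>\<xi> $ i\<bar>"
proof (cases "\<bar>\<xi> $ 2\<bar> \<le> \<bar>\<xi> $ 1\<bar>")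
  case True
  then have "norm \<xi> \<le> 2 * \<bar>\<xi> $ 1\<bar>" using norm_vec2_le[of 1 2 \<xi>] by simp
  then show ?thesis using that[of 1 2] by simp
next
  case False
  then have "norm \<xi> \<le> 2 * \<bar>\<xi> $ 2\<bar>" using norm_vec2_le[of 1 2 \<xi>] by simp
  then show ?thesis using that[of 2 1] by simp
qed

lemma parabolic_le:
  assumes "bracket (parabolic_abs p) \<le> R"
  shows "norm (fst p) \<le> R" "\<bar>snd p\<bar> \<le> R\<^sup>2"
proof -
  have *: "sqrt (\<bar>snd p\<bar> + (norm (fst p))\<^sup>2) \<le> R - 1"
    using assms by (simp add: bracket_def parabolic_abs_eq)
  then have R: "0 \<le> R - 1" by (rule order_trans[rotated]) simp
  have "\<bar>snd p\<bar> + (norm (fst p))\<^sup>2 \<le> (R - 1)\<^sup>2"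
    using power_mono[OF *, of 2] by simp
  also have "\<dots> \<le> R\<^sup>2" using R by (intro power_mono) auto
  finally have **: "\<bar>snd p\<bar> + (norm (fst p))\<^sup>2 \<le> R\<^sup>2" .
  then show "\<bar>snd p\<bar> \<le> R\<^sup>2" using zero_le_power2[of "norm (fst p)"] by linarith
  have "(norm (fst p))\<^sup>2 \<le> R\<^sup>2" using ** by simp
  then show "norm (fst p) \<le> R" using R power2_le_imp_le[of "norm (fst p)" R] by simp
qed

text \<open>The small \<open>y\<close> changes the modulation of \<open>x + y\<close>, apart from
  the term 2 x . y of the frequencies, by at most 2 R^2. Hence its frequency lies in a strip
  orthogonal to that of \<open>x\<close>, of width about (B + R^2) / N. Time, length and width of
  the strip contribute R^2, R and B R^2 / N.\<close>

lemma emeasure_low_frequency: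
  fixes x :: spacetime
  assumes N: "4 \<le> bracket (fst x)" and R: "1 \<le> R" and B: "1 \<le> B"
  shows "emeasure lborel {y. bracket (parabolic_abs y) \<le> R \<and> modulation (x + y) < B}
    \<le> ennreal (144 * R ^ 5 * B / bracket (fst x))"
proof -
  obtain i j :: 2 where ij: "i \<noteq> j" and i: "norm (fst x) \<le> 2 * \<bar>fst x $ i\<bar>"
    by (rule ex_large_coordinate)
  define n where "n = bracket (fst x)"
  have n: "4 \<le> n" "3 / 8 * n \<le> \<bar>fst x $ i\<bar>" using N i norm_frequency_ge[OF N] by (auto simp: n_def)
  define c where "c = snd x - (norm (fst x))\<^sup>2"
  define S where "S = {\<xi> :: real ^ 2. norm \<xi> \<le> R \<and> \<bar>c - 2 * inner (fst x) \<xi>\<bar> \<le> B + 2 * R\<^sup>2}"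
  have "emeasure lborel {y. bracket (parabolic_abs y) \<le> R \<and> modulation (x + y) < B} \<le> ennreal (2 * (2 * R\<^sup>2)) * emeasure lborel S"
  proof (rule emeasure_spacetime_le)
    show "{y. bracket (parabolic_abs y) \<le> R \<and> modulation (x + y) < B} \<in> sets borel" by measurable
    show "S \<in> sets borel" unfolding S_def by measurable
    show "0 \<le> 2 * R\<^sup>2" by simp
  next
    fix \<xi> :: "real ^ 2" and \<tau> \<tau>' :: real
    assume y: "(\<xi>, \<tau>) \<in> {y. bracket (parabolic_abs y) \<le> R \<and> modulation (x + y) < B}"
    then have 1: "norm \<xi> \<le> R" "\<bar>\<tau>\<bar> \<le> R\<^sup>2" using parabolic_le[of "(\<xi>, \<tau>)" R] by auto
    have 2: "\<bar>c + (\<tau> - (norm \<xi>)\<^sup>2) - 2 * inner (fst x) \<xi>\<bar> < B"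
      using modulation_less[of "x + (\<xi>, \<tau>)" B] resonance[of x "(\<xi>, \<tau>)"] y unfolding c_def by auto
    have "(norm \<xi>)\<^sup>2 \<le> R\<^sup>2" using 1 by (intro power_mono) auto
    then have "\<bar>c - 2 * inner (fst x) \<xi>\<bar> \<le> B + 2 * R\<^sup>2"
      using 1 2 zero_le_power2[of "norm \<xi>"] by linarith
    then show "\<xi> \<in> S" using 1 unfolding S_def by auto
    assume "(\<xi>, \<tau>') \<in> {y. bracket (parabolic_abs y) \<le> R \<and> modulation (x + y) < B}"
    then have "\<bar>\<tau>'\<bar> \<le> R\<^sup>2" using parabolic_le[of "(\<xi>, \<tau>')" R] by auto
    with 1 show "\<bar>\<tau>' - \<tau>\<bar> \<le> 2 * R\<^sup>2" by auto
  qed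
  also have "\<dots> \<le> ennreal (2 * (2 * R\<^sup>2)) * ennreal (4 * R * (9 * B * R\<^sup>2 / n))"
  proof (intro mult_left_mono emeasure_plane_le[where t = 0 and c = 0, OF _ ij])
    show "S \<in> sets borel" unfolding S_def by measurable
    show "0 \<le> R" "0 \<le> 9 * B * R\<^sup>2 / n" using R B n by auto
    show "\<bar>\<xi> $ j - 0 * \<xi> $ i - 0\<bar> \<le> R" if "\<xi> \<in> S" for \<xi>
      using that component_le_norm_cart[of \<xi> j] by (auto simp: S_def)
    fix \<xi> \<eta> assume *: "\<xi> \<in> S" "\<eta> \<in> S" "\<eta> $ j - \<xi> $ j = 0 * (\<eta> $ i - \<xi> $ i)"
    have R2: "1 \<le> R\<^sup>2" using R by simp
    have "2 * (fst x $ i * (\<eta> $ i - \<xi> $ i)) = 2 * inner (fst x) \<eta> - 2 * inner (fst x) \<xi>"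
      using *(3) by (simp add: inner_vec2[OF ij] algebra_simps)
    moreover have "\<bar>c - 2 * inner (fst x) \<xi>\<bar> \<le> B + 2 * R\<^sup>2" "\<bar>c - 2 * inner (fst x) \<eta>\<bar> \<le> B + 2 * R\<^sup>2"
      using * by (auto simp: S_def)
    ultimately have "\<bar>fst x $ i * (\<eta> $ i - \<xi> $ i)\<bar> \<le> B + 2 * R\<^sup>2" by linarith
    then have 1: "\<bar>fst x $ i\<bar> * \<bar>\<eta> $ i - \<xi> $ i\<bar> \<le> B + 2 * R\<^sup>2" by (simp add: abs_mult)
    have "B + 2 * R\<^sup>2 \<le> B * R\<^sup>2 + 2 * (B * R\<^sup>2)"
    proof -
      have "B * 1 \<le> B * R\<^sup>2" using R2 B by (intro mult_left_mono) auto
      moreover have "1 * R\<^sup>2 \<le> B * R\<^sup>2" using B by (intro mult_right_mono) auto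
      ultimately show ?thesis by linarith
    qed
    with 1 have "\<bar>fst x $ i\<bar> * \<bar>\<eta> $ i - \<xi> $ i\<bar> \<le> 3 * (B * R\<^sup>2)" by simp
    moreover have "3 / 8 * n * \<bar>\<eta> $ i - \<xi> $ i\<bar> \<le> \<bar>fst x $ i\<bar> * \<bar>\<eta> $ i - \<xi> $ i\<bar>"
      using n by (intro mult_right_mono) auto
    ultimately have "n * \<bar>\<eta> $ i - \<xi> $ i\<bar> \<le> 8 * (B * R\<^sup>2)" by simp
    moreover have "0 \<le> B * R\<^sup>2" using B by simp
    ultimately have "n * \<bar>\<eta> $ i - \<xi> $ i\<bar> \<le> 9 * B * R\<^sup>2" by simp
    then show "\<bar>\<eta> $ i - \<xi> $ i\<bar> \<le> 9 * B * R\<^sup>2 / n" using n by (simp add: field_simps)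
  qed auto
  also have "\<dots> = ennreal (144 * R ^ 5 * B / n)"
    using R B n by (simp add: ennreal_mult[symmetric] power2_eq_square field_simps eval_nat_numeral)
  finally show ?thesis unfolding n_def .
qed

text \<open>With R = 2 N^(1/8) the measure is 4608 B N^(-3/8), so that even after multiplication by
  the squared weight N^(1/4) a factor N^(-1/8) is left; and 4608 < 70^2.\<close>

lemma tri_low_frequency:
  assumes B: "1 \<le> B"
  shows "tri (\<lambda>x y. bracket (fst x) powr (1/8) * of_bool (4 \<le> bracket (fst x) \<and>
    bracket (parabolic_abs y) \<le> 2 * bracket (fst x) powr (1/8) \<and> modulation (x + y) < B)) (70 * sqrt B)"
proof (rule tri_fix_first)
  show "kernel (\<lambda>x y. bracket (fst x) powr (1/8) * of_bool (4 \<le> bracket (fst x) \<and>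
    bracket (parabolic_abs y) \<le> 2 * bracket (fst x) powr (1/8) \<and> modulation (x + y) < B))"
  proof (rule kernelI)
    show "(\<lambda>z::spacetime \<times> spacetime. bracket (fst (fst z)) powr (1/8) * of_bool (4 \<le> bracket (fst (fst z)) \<and>
      bracket (parabolic_abs (snd z)) \<le> 2 * bracket (fst (fst z)) powr (1/8) \<and> modulation (fst z + snd z) < B)) \<in> borel_measurable borel"
      by measurable
  qed simp
  show "0 \<le> 70 * sqrt B" using B by simp
  fix x :: spacetime
  define n where "n = bracket (fst x)"
  define E where "E = {y. bracket (parabolic_abs y) \<le> 2 * n powr (1/8) \<and> modulation (x + y) < B}"
  have [measurable]: "E \<in> sets borel" unfolding E_def by measurable
  show "(\<integral>\<^sup>+ y. ennreal (bracket (fst x) powr (1/8) * of_bool (4 \<le> bracket (fst x) \<and>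
      bracket (parabolic_abs y) \<le> 2 * bracket (fst x) powr (1/8) \<and> modulation (x + y) < B)) ^ 2 \<partial>lborel) \<le> ennreal (70 * sqrt B) ^ 2"
  proof (cases "4 \<le> bracket (fst x)")
    case True
    have n: "4 \<le> n" using True by (simp add: n_def)
    have "(\<integral>\<^sup>+ y. ennreal (bracket (fst x) powr (1/8) * of_bool (4 \<le> bracket (fst x) \<and>
      bracket (parabolic_abs y) \<le> 2 * bracket (fst x) powr (1/8) \<and> modulation (x + y) < B)) ^ 2 \<partial>lborel)
      = (\<integral>\<^sup>+ y. ennreal (n powr (1/4)) * indicator E y \<partial>lborel)"
    proof (intro nn_integral_cong)
      fix y
      have "(n powr (1/8))\<^sup>2 = n powr (1/4)" using n by (simp add: power2_eq_square powr_add[symmetric])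
      then show "ennreal (bracket (fst x) powr (1/8) * of_bool (4 \<le> bracket (fst x) \<and>
        bracket (parabolic_abs y) \<le> 2 * bracket (fst x) powr (1/8) \<and> modulation (x + y) < B)) ^ 2 = ennreal (n powr (1/4)) * indicator E y"
        using True by (auto simp: E_def n_def ennreal_power)
    qed
    also have "\<dots> = ennreal (n powr (1/4)) * emeasure lborel E"
      by (rule nn_integral_cmult_indicator) simp
    also have "\<dots> \<le> ennreal (n powr (1/4)) * ennreal (144 * (2 * n powr (1/8)) ^ 5 * B / n)"
      unfolding E_def n_def
    proof (intro mult_left_mono emeasure_low_frequency[OF True _ B])
      have "1 \<le> bracket (fst x) powr (1/8)" by (rule ge_one_powr_ge_zero) (auto simp: bracket_ge_1)
      then show "1 \<le> 2 * bracket (fst x) powr (1/8)" by simp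
    qed simp
    also have "\<dots> = ennreal (4608 * B * n powr (- 1/8))"
    proof -
      have "n powr (1/4) * (144 * (2 * n powr (1/8)) ^ 5 * B / n) = 4608 * B * (n powr (1/4) * (n powr (1/8)) ^ 5 * n powr (- 1))"
        using n by (simp add: power_mult_distrib powr_minus_divide)
      also have "n powr (1/4) * (n powr (1/8)) ^ 5 * n powr (- 1) = n powr (- 1/8)"
      proof -
        have "(n powr (1/8)) ^ 5 = n powr (5/8)" using n by (simp add: eval_nat_numeral powr_add[symmetric])
        moreover have "n powr (1/4) * n powr (5/8) * n powr (- 1) = n powr (- 1/8)"
          unfolding powr_add[symmetric] by simp
        ultimately show ?thesis by simp
      qed
      finally show ?thesis using n B by (simp add: ennreal_mult[symmetric])
    qed
    also have "\<dots> \<le> ennreal ((70 * sqrt B)\<^sup>2)"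
    proof (rule ennreal_leI)
      have "n powr (- 1/8) \<le> 1" using powr_mono[of "- 1/8" 0 n] n by simp
      then have "4608 * B * n powr (- 1/8) \<le> 4608 * B * 1" using B by (intro mult_left_mono) auto
      then show "4608 * B * n powr (- 1/8) \<le> (70 * sqrt B)\<^sup>2" using B by (simp add: power_mult_distrib)
    qed
    finally show ?thesis using B by (simp add: ennreal_power)
  qed simp
qed

subsection \<open>Transversal interactions\<close>

text \<open>Two nearly orthogonal frequencies \<open>\<xi>\<close>, \<open>\<eta>\<close>: in a frame where the first coordinate of \<open>\<xi>\<close>
  dominates, the slope of \<open>\<xi>\<close> and the negative inverse slope of \<open>\<eta>\<close> almost agree.\<close>

lemma orthogonal_slopes:
  fixes \<xi> \<eta> :: "real ^ 2"
  assumes ij: "i \<noteq> j" and n: "0 < n1" "0 < n2"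
    and \<xi>: "3 / 4 * n1 \<le> norm \<xi>" "norm \<xi> \<le> 2 * n1" and \<eta>: "3 / 4 * n2 \<le> norm \<eta>" "norm \<eta> \<le> 2 * n2"
    and frame: "\<bar>\<xi> $ j\<bar> \<le> \<bar>\<xi> $ i\<bar>" and ip: "2 * \<bar>inner \<xi> \<eta>\<bar> \<le> 3 * L" and L: "0 < L" "1000 * L \<le> n1 * n2"
  shows "3 / 8 * n1 \<le> \<bar>\<xi> $ i\<bar>" "\<bar>\<xi> $ i\<bar> \<le> 2 * n1" "n2 / 3 \<le> \<bar>\<eta> $ j\<bar>" "\<bar>\<eta> $ j\<bar> \<le> 2 * n2"
    "\<bar>\<xi> $ j / \<xi> $ i\<bar> \<le> 1" "\<bar>\<xi> $ j / \<xi> $ i + \<eta> $ i / \<eta> $ j\<bar> \<le> 12 * L / (n1 * n2)"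
proof -
  show 1: "3 / 8 * n1 \<le> \<bar>\<xi> $ i\<bar>" using norm_vec2_le[OF ij, of \<xi>] frame \<xi> by linarith
  show "\<bar>\<xi> $ i\<bar> \<le> 2 * n1" using component_le_norm_cart[of \<xi> i] \<xi> by linarith
  show "\<bar>\<eta> $ j\<bar> \<le> 2 * n2" using component_le_norm_cart[of \<eta> j] \<eta> by linarith
  have xi0: "0 < \<bar>\<xi> $ i\<bar>" using 1 n by linarith
  show t1: "\<bar>\<xi> $ j / \<xi> $ i\<bar> \<le> 1" using frame xi0 by (simp add: abs_divide)
  define X where "X = \<bar>\<eta> $ i + \<xi> $ j / \<xi> $ i * \<eta> $ j\<bar>"
  define Y where "Y = \<bar>\<xi> $ j / \<xi> $ i + \<eta> $ i / \<eta> $ j\<bar>"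
  have XY: "0 \<le> X" "0 \<le> Y" by (simp_all add: X_def Y_def)
  have "X * \<bar>\<xi> $ i\<bar> = \<bar>inner \<xi> \<eta>\<bar>"
    using xi0 unfolding X_def abs_mult[symmetric] by (simp add: inner_vec2[OF ij] algebra_simps)
  moreover have "X * (3 / 8 * n1) \<le> X * \<bar>\<xi> $ i\<bar>"
    using 1 XY by (intro mult_left_mono) auto
  ultimately have 2: "X * n1 \<le> 4 * L" using ip by linarith
  \<comment> \<open>The factor 1000 makes the deviation of \<eta> from exact orthogonality
    negligible against \<open>n2\<close>, so its coordinate \<open>j\<close> has to be
    large.\<close>
  also have "\<dots> \<le> (n2 / 250) * n1" using L by (simp add: mult.commute)
  finally have 3: "X \<le> n2 / 250" using n by (simp add: mult_le_cancel_right)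
  have "\<bar>\<xi> $ j / \<xi> $ i * \<eta> $ j\<bar> \<le> 1 * \<bar>\<eta> $ j\<bar>" unfolding abs_mult by (intro mult_right_mono t1) auto
  with 3 have "\<bar>\<eta> $ i\<bar> \<le> \<bar>\<eta> $ j\<bar> + n2 / 250" unfolding X_def by linarith
  then show 4: "n2 / 3 \<le> \<bar>\<eta> $ j\<bar>" using norm_vec2_le[OF ij, of \<eta>] \<eta> n by linarith
  then have ej0: "0 < \<bar>\<eta> $ j\<bar>" using n by linarith
  have "Y * \<bar>\<eta> $ j\<bar> = X"
    using ej0 unfolding X_def Y_def abs_mult[symmetric] by (simp add: algebra_simps)
  moreover have "Y * (n2 / 3) \<le> Y * \<bar>\<eta> $ j\<bar>"
    using 4 XY by (intro mult_left_mono) auto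
  ultimately have "Y * (n2 / 3) * n1 \<le> X * n1"
    using n by (intro mult_right_mono) auto
  with 2 have "Y * (n1 * n2) \<le> 12 * L" by (simp add: algebra_simps)
  then have "Y \<le> 12 * L / (n1 * n2)" using n by (simp add: field_simps)
  then show "\<bar>\<xi> $ j / \<xi> $ i + \<eta> $ i / \<eta> $ j\<bar> \<le> 12 * L / (n1 * n2)" by (simp only: Y_def)
qed

text \<open>This is the inner product of (1, t) and (1, u). For t near u it is 1 + u^2 up to
  \<alpha>, so a direction of slope \<open>t\<close> is far from orthogonal to one of slope
  \<open>u\<close>.\<close>

lemma slope_product:
  fixes t u \<alpha> :: real
  assumes "\<bar>u - t\<bar> \<le> \<alpha>" "\<bar>u\<bar> \<le> 1" "\<alpha> \<le> 12 / 1000"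
  shows "98 / 100 \<le> 1 + t * u"
proof -
  have "t * u = u * u - (u - t) * u" by (simp add: algebra_simps)
  moreover have "\<bar>(u - t) * u\<bar> \<le> \<alpha> * 1" unfolding abs_mult using assms by (intro mult_mono) auto
  ultimately show ?thesis using assms(3) zero_le_square[of u] by linarith
qed

definition dyad :: "real \<Rightarrow> real \<Rightarrow> spacetime \<Rightarrow> bool" where
  "dyad n A p \<longleftrightarrow> 4 \<le> bracket (fst p) \<and> n \<le> bracket (fst p) \<and> bracket (fst p) < 2 * n \<and> modulation p < A"

lemma measurable_dyad [measurable]: "Measurable.pred borel (dyad n A)"
  unfolding dyad_def by measurable

lemma dyad_norm: "dyad n A p \<Longrightarrow> 3 / 4 * n \<le> norm (fst p)" "dyad n A p \<Longrightarrow> norm (fst p) \<le> 2 * n"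
  using norm_frequency_ge[of "fst p"] by (auto simp: dyad_def bracket_def)

lemma resonance_inner_le:
  assumes "modulation x < A" "modulation y < B" "modulation (x + y) < D"
  shows "2 * \<bar>inner (fst x) (fst y)\<bar> \<le> A + B + D"
  using modulation_less[OF assms(1)] modulation_less[OF assms(2)] modulation_less[OF assms(3)] resonance[of x y]
  by linarith

definition interact :: "real \<Rightarrow> real \<Rightarrow> real \<Rightarrow> real \<Rightarrow> real \<Rightarrow> spacetime \<Rightarrow> spacetime \<Rightarrow> bool" where
  "interact n1 n2 A B D x y \<longleftrightarrow> dyad n1 A x \<and> dyad n2 B y \<and> modulation (x + y) < D"

definition slope :: "2 \<Rightarrow> 2 \<Rightarrow> spacetime \<Rightarrow> real" where
  "slope i j p = fst p $ j / fst p $ i"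

lemma measurable_slope [measurable]: "slope i j \<in> borel_measurable borel"
  unfolding slope_def by measurable

lemma interact_slopes:
  assumes ij: "i \<noteq> j" and n: "0 < n1" "0 < n2" and P: "interact n1 n2 A B D x y"
    and frame: "\<bar>fst x $ j\<bar> \<le> \<bar>fst x $ i\<bar>" and L: "A \<le> L" "B \<le> L" "D \<le> L" "0 < L" "1000 * L \<le> n1 * n2"
  shows "3 / 8 * n1 \<le> \<bar>fst x $ i\<bar>" "\<bar>fst x $ i\<bar> \<le> 2 * n1" "n2 / 3 \<le> \<bar>fst y $ j\<bar>" "\<bar>fst y $ j\<bar> \<le> 2 * n2"
    "\<bar>slope i j x\<bar> \<le> 1" "\<bar>slope i j x + slope j i y\<bar> \<le> 12 * L / (n1 * n2)"
proof -
  have "2 * \<bar>inner (fst x) (fst y)\<bar> \<le> A + B + D"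
    using P by (intro resonance_inner_le) (auto simp: interact_def dyad_def)
  then have ip: "2 * \<bar>inner (fst x) (fst y)\<bar> \<le> 3 * L" using L by linarith
  note D = dyad_norm[of n1 A x] dyad_norm[of n2 B y]
  have d: "dyad n1 A x" "dyad n2 B y" using P by (auto simp: interact_def)
  note * = orthogonal_slopes[OF ij n D(1)[OF d(1)] D(2)[OF d(1)] D(3)[OF d(2)] D(4)[OF d(2)] frame ip L(4,5)]
  from * show "3 / 8 * n1 \<le> \<bar>fst x $ i\<bar>" "\<bar>fst x $ i\<bar> \<le> 2 * n1" "n2 / 3 \<le> \<bar>fst y $ j\<bar>" "\<bar>fst y $ j\<bar> \<le> 2 * n2"
    "\<bar>slope i j x\<bar> \<le> 1" "\<bar>slope i j x + slope j i y\<bar> \<le> 12 * L / (n1 * n2)"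
    by (auto simp: slope_def)
qed

text \<open>The first function has the largest modulation: fix its argument.\<close>

lemma tri_transversal_first:
  assumes ij: "i \<noteq> j" and n: "0 < n1" "0 < n2" and pos: "0 < A" "0 < B" "0 < D"
    and max: "B \<le> A" "D \<le> A" and A: "1000 * A \<le> n1 * n2"
  shows "tri (\<lambda>x y. of_bool (interact n1 n2 A B D x y \<and> \<bar>fst x $ j\<bar> \<le> \<bar>fst x $ i\<bar>)) (192 * sqrt (A * B * D / (n1 * n2)))"
proof -
  \<comment> \<open>The slopes agree up to \<alpha> by \<open>interact_slopes\<close>; as the
    coordinate \<open>i\<close> of \<open>x\<close> is at most 2 n1, its frequency stays within
    \<rho> of the line of slope \<open>t\<close>.\<close>
  define \<alpha> where "\<alpha> = 12 * A / (n1 * n2)"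
  define \<rho> where "\<rho> = 2 * n1 * \<alpha>"
  define C where "C = 48 * sqrt (A * B * D / (n1 * n2))"
  have C: "0 \<le> C" using n pos by (simp add: C_def)
  have \<alpha>: "0 < \<alpha>" "\<alpha> \<le> 12 / 1000" using n pos A by (auto simp: \<alpha>_def field_simps)
  have \<rho>: "0 < \<rho>" using n \<alpha> by (simp add: \<rho>_def)
  let ?P = "\<lambda>x y. interact n1 n2 A B D x y \<and> \<bar>fst x $ j\<bar> \<le> \<bar>fst x $ i\<bar>"
  have [measurable]: "Measurable.pred borel (\<lambda>z. ?P (fst z) (snd z))"
    unfolding interact_def by measurable
  note P = interact_slopes[OF ij n _ _ order_refl max pos(1) A]
  have b1: "\<bar>fst x $ j - t * fst x $ i\<bar> \<le> \<rho>" if "?P x y" "\<bar>slope i j x - t\<bar> \<le> \<alpha>" for x y t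
  proof -
    have xi: "3 / 8 * n1 \<le> \<bar>fst x $ i\<bar>" "\<bar>fst x $ i\<bar> \<le> 2 * n1" using P[of x y] that by auto
    then have "fst x $ i \<noteq> 0" using n by auto
    then have "fst x $ j - t * fst x $ i = fst x $ i * (slope i j x - t)" by (simp add: slope_def algebra_simps)
    also have "\<bar>\<dots>\<bar> \<le> 2 * n1 * \<alpha>" unfolding abs_mult using xi that n by (intro mult_mono) auto
    finally show ?thesis by (simp add: \<rho>_def)
  qed
  \<comment> \<open>After both localisations \<open>y\<close> lies in a strip of slope
    \<open>t\<close> and half-width \<rho>. Since \<open>x\<close> points nearly along that slope,
    the resonance condition |c - 2 x . y| \<le> B + D cuts the strip transversally, in segments of
    length about (B + D) / n1.\<close>
  have window: "tri (\<lambda>x y. of_bool (?P x y \<and> \<bar>slope i j x - t\<bar> \<le> \<alpha> \<and> \<bar>- slope j i y - t\<bar> \<le> 2 * \<alpha> \<and>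
      \<bar>fst y $ j - t * fst y $ i - u\<bar> \<le> \<rho> \<and> \<bar>fst (x + y) $ j - t * fst (x + y) $ i - u\<bar> \<le> 2 * \<rho>)) C" for t u
  proof (rule tri_of_bool_first[OF _ C])
    show "Measurable.pred borel (\<lambda>z. ?P (fst z) (snd z) \<and> \<bar>slope i j (fst z) - t\<bar> \<le> \<alpha> \<and> \<bar>- slope j i (snd z) - t\<bar> \<le> 2 * \<alpha> \<and>
      \<bar>fst (snd z) $ j - t * fst (snd z) $ i - u\<bar> \<le> \<rho> \<and> \<bar>fst (fst z + snd z) $ j - t * fst (fst z + snd z) $ i - u\<bar> \<le> 2 * \<rho>)"
      by measurable
    fix x :: spacetime
    define E where "E = {y. ?P x y \<and> \<bar>slope i j x - t\<bar> \<le> \<alpha> \<and> \<bar>- slope j i y - t\<bar> \<le> 2 * \<alpha> \<and>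
      \<bar>fst y $ j - t * fst y $ i - u\<bar> \<le> \<rho> \<and> \<bar>fst (x + y) $ j - t * fst (x + y) $ i - u\<bar> \<le> 2 * \<rho>}"
    have E [measurable]: "E \<in> sets borel" unfolding E_def interact_def by measurable
    show "emeasure lborel E \<le> ennreal (C\<^sup>2)"
    proof (cases "E = {}")
      case False
      then obtain y where y: "y \<in> E" by auto
      then have xy: "?P x y" and slx: "\<bar>slope i j x - t\<bar> \<le> \<alpha>" by (auto simp: E_def)
      have xi: "3 / 8 * n1 \<le> \<bar>fst x $ i\<bar>" "\<bar>slope i j x\<bar> \<le> 1" using P[of x y] xy by auto
      have "fst x $ i \<noteq> 0" using xi n by auto
      then have "fst x $ i + t * fst x $ j = fst x $ i * (1 + t * slope i j x)" by (simp add: slope_def algebra_simps)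
      then have "\<bar>fst x $ i + t * fst x $ j\<bar> = \<bar>fst x $ i\<bar> * (1 + t * slope i j x)"
        using slope_product[OF slx xi(2) \<alpha>(2)] by (simp add: abs_mult)
      also have "\<dots> \<ge> 3 / 8 * n1 * (98 / 100)"
        using slope_product[OF slx xi(2) \<alpha>(2)] xi n by (intro mult_mono) auto
      finally have grad: "n1 / 3 \<le> \<bar>fst x $ i + t * fst x $ j\<bar>" using n by linarith
      define c where "c = snd x - (norm (fst x))\<^sup>2"
      define S where "S = {\<xi> :: real ^ 2. \<bar>\<xi> $ j - t * \<xi> $ i - u\<bar> \<le> \<rho> \<and> \<bar>c - 2 * inner (fst x) \<xi>\<bar> \<le> B + D}"
      have S: "S \<in> sets borel" unfolding S_def by measurable
      have "emeasure lborel E \<le> ennreal (2 * (2 * min B D)) * emeasure lborel S"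
      proof (rule emeasure_spacetime_le[OF E S])
        show "0 \<le> 2 * min B D" using pos by simp
      next
        fix \<xi> :: "real ^ 2" and \<tau> \<tau>' :: real
        assume y: "(\<xi>, \<tau>) \<in> E"
        then have 1: "\<bar>\<tau> - (norm \<xi>)\<^sup>2\<bar> < B" "\<bar>snd x + \<tau> - (norm (fst x + \<xi>))\<^sup>2\<bar> < D"
          using modulation_less[of "(\<xi>, \<tau>)" B] modulation_less[of "x + (\<xi>, \<tau>)" D] by (auto simp: E_def interact_def dyad_def)
        have "\<bar>c - 2 * inner (fst x) \<xi>\<bar> \<le> B + D"
          using 1 resonance[of x "(\<xi>, \<tau>)"] unfolding c_def fst_add snd_add fst_conv snd_conv by linarith
        with y show "\<xi> \<in> S" by (simp add: S_def E_def)
        assume y': "(\<xi>, \<tau>') \<in> E"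
        then have "\<bar>\<tau>' - (norm \<xi>)\<^sup>2\<bar> < B" "\<bar>snd x + \<tau>' - (norm (fst x + \<xi>))\<^sup>2\<bar> < D"
          using modulation_less[of "(\<xi>, \<tau>')" B] modulation_less[of "x + (\<xi>, \<tau>')" D] by (auto simp: E_def interact_def dyad_def)
        with 1 show "\<bar>\<tau>' - \<tau>\<bar> \<le> 2 * min B D" by (auto simp: min_def)
      qed
      also have "\<dots> \<le> ennreal (2 * (2 * min B D)) * ennreal (4 * \<rho> * (3 * (B + D) / n1))"
      proof (intro mult_left_mono emeasure_plane_le[OF S ij])
        show "0 \<le> \<rho>" "0 \<le> 3 * (B + D) / n1" using \<rho> pos n by auto
        show "\<bar>\<xi> $ j - t * \<xi> $ i - u\<bar> \<le> \<rho>" if "\<xi> \<in> S" for \<xi> using that by (simp add: S_def)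
        fix \<xi> \<eta> assume *: "\<xi> \<in> S" "\<eta> \<in> S" "\<eta> $ j - \<xi> $ j = t * (\<eta> $ i - \<xi> $ i)"
        have "inner (fst x) \<eta> - inner (fst x) \<xi> = fst x $ i * (\<eta> $ i - \<xi> $ i) + fst x $ j * (\<eta> $ j - \<xi> $ j)"
          by (simp add: inner_vec2[OF ij] algebra_simps)
        also have "\<dots> = (fst x $ i + t * fst x $ j) * (\<eta> $ i - \<xi> $ i)" unfolding *(3) by (simp add: algebra_simps)
        finally have eq: "inner (fst x) \<eta> - inner (fst x) \<xi> = (fst x $ i + t * fst x $ j) * (\<eta> $ i - \<xi> $ i)" .
        have "\<bar>c - 2 * inner (fst x) \<xi>\<bar> \<le> B + D" "\<bar>c - 2 * inner (fst x) \<eta>\<bar> \<le> B + D" using * by (auto simp: S_def)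
        then have "\<bar>inner (fst x) \<eta> - inner (fst x) \<xi>\<bar> \<le> B + D" by linarith
        then have "\<bar>fst x $ i + t * fst x $ j\<bar> * \<bar>\<eta> $ i - \<xi> $ i\<bar> \<le> B + D" unfolding eq abs_mult .
        moreover have "n1 / 3 * \<bar>\<eta> $ i - \<xi> $ i\<bar> \<le> \<bar>fst x $ i + t * fst x $ j\<bar> * \<bar>\<eta> $ i - \<xi> $ i\<bar>"
          by (intro mult_right_mono grad) auto
        ultimately show "\<bar>\<eta> $ i - \<xi> $ i\<bar> \<le> 3 * (B + D) / n1" using n by (simp add: field_simps)
      qed auto
      also have "\<dots> = ennreal (48 * \<rho> / n1 * (min B D * (B + D)))"
        using pos n \<rho> by (simp add: ennreal_mult[symmetric] field_simps)
      also have "\<dots> \<le> ennreal (48 * \<rho> / n1 * (2 * (B * D)))"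
        using pos n \<rho> by (intro ennreal_leI mult_left_mono min_mult_add_le) auto
      \<comment> \<open>48^2 = 48 * 2 * 2 * 12, where the last two factors come from \<rho> and
        \<alpha>.\<close>
      also have "\<dots> = ennreal (C\<^sup>2)"
        using n pos by (simp add: \<rho>_def \<alpha>_def C_def power_mult_distrib field_simps)
      finally show ?thesis .
    qed simp
  qed
  \<comment> \<open>\<open>x\<close> is within \<rho> of the line of slope \<open>t\<close> through
    the origin, so \<open>y\<close> and \<open>x + y\<close> have nearly the same offset from that
    line; this permits the second localisation.\<close>
  have loc: "tri (\<lambda>x y. of_bool (?P x y \<and> \<bar>slope i j x - t\<bar> \<le> \<alpha> \<and> \<bar>- slope j i y - t\<bar> \<le> 2 * \<alpha>)) (2 * C)" for t
  proof (rule tri_localize_sum[where \<psi> = "\<lambda>y. fst y $ j - t * fst y $ i" and \<theta> = "\<lambda>y. fst y $ j - t * fst y $ i" and \<alpha> = \<rho>])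
    show "kernel (\<lambda>x y. of_bool (?P x y \<and> \<bar>slope i j x - t\<bar> \<le> \<alpha> \<and> \<bar>- slope j i y - t\<bar> \<le> 2 * \<alpha>))"
      by (rule kernel_of_bool) measurable
    show "\<bar>fst y $ j - t * fst y $ i - (fst (x + y) $ j - t * fst (x + y) $ i)\<bar> \<le> \<rho>"
      if "of_bool (?P x y \<and> \<bar>slope i j x - t\<bar> \<le> \<alpha> \<and> \<bar>- slope j i y - t\<bar> \<le> 2 * \<alpha>) \<noteq> (0::real)" for x y :: spacetime
    proof -
      have "\<bar>fst x $ j - t * fst x $ i\<bar> \<le> \<rho>" using that b1[of x y t] by (auto split: if_splits)
      moreover have "fst y $ j - t * fst y $ i - (fst (x + y) $ j - t * fst (x + y) $ i) = - (fst x $ j - t * fst x $ i)"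
        by (simp add: algebra_simps)
      ultimately show ?thesis by simp
    qed
    show "tri (\<lambda>x y. of_bool (?P x y \<and> \<bar>slope i j x - t\<bar> \<le> \<alpha> \<and> \<bar>- slope j i y - t\<bar> \<le> 2 * \<alpha>) *
        of_bool (\<bar>fst y $ j - t * fst y $ i - u\<bar> \<le> \<rho>) * of_bool (\<bar>fst (x + y) $ j - t * fst (x + y) $ i - u\<bar> \<le> 2 * \<rho>)) C" for u
      using window[of t u] by (simp only: of_bool_conj mult.assoc)
  qed (use \<rho> C in \<open>auto\<close>)
  have "tri (\<lambda>x y. of_bool (?P x y)) (2 * (2 * C))"
  proof (rule tri_localize[where \<phi> = "slope i j" and \<psi> = "\<lambda>y. - slope j i y" and \<alpha> = \<alpha>])
    show "kernel (\<lambda>x y. of_bool (?P x y))" by (rule kernel_of_bool) measurable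
    show "\<bar>slope i j x - - slope j i y\<bar> \<le> \<alpha>" if "of_bool (?P x y) \<noteq> (0::real)" for x y
      using that P[of x y] by (auto simp: \<alpha>_def split: if_splits)
    show "tri (\<lambda>x y. of_bool (?P x y) * of_bool (\<bar>slope i j x - t\<bar> \<le> \<alpha>) * of_bool (\<bar>- slope j i y - t\<bar> \<le> 2 * \<alpha>)) (2 * C)" for t
      using loc[of t] by (simp only: of_bool_conj mult.assoc)
  qed (use \<alpha> C in \<open>auto\<close>)
  then show ?thesis by (simp add: C_def)
qed

text \<open>The output has the largest modulation: fix the sum. In the frame the level sets of
  \<open>|\<xi>|\<^sup>2 + |\<zeta> - \<xi>|\<^sup>2\<close> cross the sector transversally, since \<open>\<xi>\<close> is the larger frequency.\<close>

lemma tri_transversal_sum: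
  assumes ij: "i \<noteq> j" and n: "0 < n1" "0 < n2" "n2 \<le> n1" and pos: "0 < A" "0 < B" "0 < D"
    and max: "A \<le> D" "B \<le> D" and D: "1000 * D \<le> n1 * n2"
  shows "tri (\<lambda>x y. of_bool (interact n1 n2 A B D x y \<and> \<bar>fst x $ j\<bar> \<le> \<bar>fst x $ i\<bar>)) (192 * sqrt (A * B * D / (n1 * n2)))"
proof -
  define \<alpha> where "\<alpha> = 12 * D / (n1 * n2)"
  define \<rho> where "\<rho> = 2 * n1 * \<alpha>"
  define C where "C = 96 * sqrt (A * B * D / (n1 * n2))"
  have C: "0 \<le> C" using n pos by (simp add: C_def)
  have \<alpha>: "0 < \<alpha>" "\<alpha> \<le> 12 / 1000" using n pos D by (auto simp: \<alpha>_def field_simps)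
  have \<rho>: "0 < \<rho>" using n \<alpha> by (simp add: \<rho>_def)
  let ?P = "\<lambda>x y. interact n1 n2 A B D x y \<and> \<bar>fst x $ j\<bar> \<le> \<bar>fst x $ i\<bar>"
  have [measurable]: "Measurable.pred borel (\<lambda>z. ?P (fst z) (snd z))"
    unfolding interact_def by measurable
  note P = interact_slopes[OF ij n(1,2) _ _ max order_refl pos(3) D]
  have window: "tri (\<lambda>x y. of_bool (?P x y \<and> \<bar>slope i j x - t\<bar> \<le> \<alpha> \<and> \<bar>- slope j i y - t\<bar> \<le> 2 * \<alpha>)) C" for t
  proof (rule tri_of_bool_sum[OF _ C])
    show "Measurable.pred borel (\<lambda>z. ?P (fst z) (snd z) \<and> \<bar>slope i j (fst z) - t\<bar> \<le> \<alpha> \<and> \<bar>- slope j i (snd z) - t\<bar> \<le> 2 * \<alpha>)"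
      by measurable
    fix z :: spacetime
    define E where "E = {x. ?P x (z - x) \<and> \<bar>slope i j x - t\<bar> \<le> \<alpha> \<and> \<bar>- slope j i (z - x) - t\<bar> \<le> 2 * \<alpha>}"
    have E [measurable]: "E \<in> sets borel" unfolding E_def interact_def by measurable
    define q where "q \<xi> = snd z - (norm \<xi>)\<^sup>2 - (norm (fst z - \<xi>))\<^sup>2" for \<xi>
    \<comment> \<open>The sign \<open>b\<close> splits the sector into its two halves, on each of
      which \<open>q\<close> is monotone along lines of slope \<open>t\<close>. The constants:
      36/100 is below 3/8 * 98/100, and 48/1000 = 2 * 2 * 12/1000.\<close>
    define S where "S b = {\<xi> :: real ^ 2. \<bar>\<xi> $ j - t * \<xi> $ i\<bar> \<le> \<rho> \<and> \<bar>q \<xi>\<bar> \<le> A + B \<and>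
      36 / 100 * n1 \<le> b * (\<xi> $ i + t * \<xi> $ j) \<and> \<bar>(fst z - \<xi>) $ i + t * (fst z - \<xi>) $ j\<bar> \<le> 48 / 1000 * n1}" for b :: real
    have S: "S b \<in> sets borel" for b unfolding S_def q_def by measurable
    have area: "emeasure lborel (S b) \<le> ennreal (4 * \<rho> * (4 * (A + B) / n1))" if b: "b = 1 \<or> b = - 1" for b
    proof (rule emeasure_plane_le[OF S ij])
      show "0 \<le> \<rho>" "0 \<le> 4 * (A + B) / n1" using \<rho> pos n by auto
      show "\<bar>\<xi> $ j - t * \<xi> $ i - 0\<bar> \<le> \<rho>" if "\<xi> \<in> S b" for \<xi> using that by (simp add: S_def)
      fix \<xi> \<eta> assume *: "\<xi> \<in> S b" "\<eta> \<in> S b" "\<eta> $ j - \<xi> $ j = t * (\<eta> $ i - \<xi> $ i)"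
      \<comment> \<open>Along a line of slope \<open>t\<close>, \<open>q \<xi> - q \<eta>\<close> is
        \<open>g\<close> times \<open>\<eta> $ i - \<xi> $ i\<close>. The first two summands have a
        common sign and the last two are small, so |g| is at least (2 * 0.36 - 2 * 0.048) n1, more
        than n1 / 2.\<close>
      define g where "g = (\<xi> $ i + t * \<xi> $ j) + (\<eta> $ i + t * \<eta> $ j)
        - ((fst z - \<xi>) $ i + t * (fst z - \<xi>) $ j) - ((fst z - \<eta>) $ i + t * (fst z - \<eta>) $ j)"
      have n2: "(norm v)\<^sup>2 = v $ i * v $ i + v $ j * v $ j" for v :: "real ^ 2"
        unfolding power2_norm_eq_inner by (rule inner_vec2[OF ij])
      have ej: "\<eta> $ j = \<xi> $ j + t * (\<eta> $ i - \<xi> $ i)" using *(3) by simp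
      have "q \<xi> - q \<eta> = g * (\<eta> $ i - \<xi> $ i)"
        unfolding q_def n2 g_def vector_minus_component ej by (simp add: algebra_simps)
      moreover have "\<bar>q \<xi> - q \<eta>\<bar> \<le> 2 * (A + B)" using * by (auto simp: S_def)
      ultimately have "\<bar>g\<bar> * \<bar>\<eta> $ i - \<xi> $ i\<bar> \<le> 2 * (A + B)" by (simp add: abs_mult)
      moreover have "n1 / 2 \<le> \<bar>g\<bar>"
      proof -
        define l where "l v = v $ i + t * v $ j" for v :: "real ^ 2"
        have "36 / 100 * n1 \<le> b * (\<xi> $ i + t * \<xi> $ j)" "36 / 100 * n1 \<le> b * (\<eta> $ i + t * \<eta> $ j)"
          "\<bar>(fst z - \<xi>) $ i + t * (fst z - \<xi>) $ j\<bar> \<le> 48 / 1000 * n1" "\<bar>(fst z - \<eta>) $ i + t * (fst z - \<eta>) $ j\<bar> \<le> 48 / 1000 * n1"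
          using * by (auto simp: S_def)
        then have "36 / 100 * n1 \<le> b * l \<xi>" "36 / 100 * n1 \<le> b * l \<eta>"
          "\<bar>l (fst z - \<xi>)\<bar> \<le> 48 / 1000 * n1" "\<bar>l (fst z - \<eta>)\<bar> \<le> 48 / 1000 * n1"
          by (simp_all only: l_def)
        moreover have "g = l \<xi> + l \<eta> - l (fst z - \<xi>) - l (fst z - \<eta>)" by (simp only: g_def l_def)
        moreover have "0 < n1" by fact
        ultimately show ?thesis using b by (elim disjE; hypsubst) linarith+
      qed
      then have "n1 / 2 * \<bar>\<eta> $ i - \<xi> $ i\<bar> \<le> \<bar>g\<bar> * \<bar>\<eta> $ i - \<xi> $ i\<bar>" by (intro mult_right_mono) auto
      ultimately show "\<bar>\<eta> $ i - \<xi> $ i\<bar> \<le> 4 * (A + B) / n1" using n by (simp add: field_simps)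
    qed
    have "emeasure lborel E \<le> ennreal (2 * (2 * min A B)) * emeasure lborel (S 1 \<union> S (- 1))"
    proof (rule emeasure_spacetime_le[OF E])
      show "S 1 \<union> S (- 1) \<in> sets borel" using S by auto
      show "0 \<le> 2 * min A B" using pos by simp
    next
      fix \<xi> :: "real ^ 2" and \<tau> \<tau>' :: real
      assume x: "(\<xi>, \<tau>) \<in> E"
      define y where "y = z - (\<xi>, \<tau>)"
      have xy: "?P (\<xi>, \<tau>) y" and slx: "\<bar>slope i j (\<xi>, \<tau>) - t\<bar> \<le> \<alpha>" and sly: "\<bar>- slope j i y - t\<bar> \<le> 2 * \<alpha>"
        using x by (auto simp: E_def y_def)
      have y: "fst y = fst z - \<xi>" by (simp add: y_def)
      have 1: "\<bar>\<tau> - (norm \<xi>)\<^sup>2\<bar> < A" "\<bar>snd z - \<tau> - (norm (fst z - \<xi>))\<^sup>2\<bar> < B"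
        using modulation_less[of "(\<xi>, \<tau>)" A] modulation_less[of y B] xy by (auto simp: interact_def dyad_def y_def)
      note Pxy = P[of "(\<xi>, \<tau>)" y]
      have xi: "3 / 8 * n1 \<le> \<bar>\<xi> $ i\<bar>" "\<bar>\<xi> $ i\<bar> \<le> 2 * n1" "\<bar>slope i j (\<xi>, \<tau>)\<bar> \<le> 1"
        and yj: "n2 / 3 \<le> \<bar>fst y $ j\<bar>" "\<bar>fst y $ j\<bar> \<le> 2 * n2" using Pxy xy by auto
      have nz: "\<xi> $ i \<noteq> 0" "fst y $ j \<noteq> 0" using xi yj n by auto
      have "\<xi> $ j - t * \<xi> $ i = \<xi> $ i * (slope i j (\<xi>, \<tau>) - t)" using nz by (simp add: slope_def algebra_simps)
      also have "\<bar>\<dots>\<bar> \<le> 2 * n1 * \<alpha>" unfolding abs_mult using xi slx n by (intro mult_mono) auto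
      finally have 2: "\<bar>\<xi> $ j - t * \<xi> $ i\<bar> \<le> \<rho>" by (simp add: \<rho>_def)
      have "fst y $ i + t * fst y $ j = fst y $ j * (slope j i y + t)" using nz by (simp add: slope_def algebra_simps)
      also have "\<bar>\<dots>\<bar> \<le> 2 * n2 * (2 * \<alpha>)" unfolding abs_mult using yj sly n by (intro mult_mono) auto
      \<comment> \<open>Here \<open>n2 \<le> n1\<close> enters: the component of the lower frequency
        along the slope has to be small against \<open>n1\<close>.\<close>
      also have "\<dots> \<le> 2 * n1 * (2 * (12 / 1000))" using n \<alpha> by (intro mult_mono) auto
      finally have 3: "\<bar>(fst z - \<xi>) $ i + t * (fst z - \<xi>) $ j\<bar> \<le> 48 / 1000 * n1" by (simp add: y)
      have "\<xi> $ i + t * \<xi> $ j = \<xi> $ i * (1 + t * slope i j (\<xi>, \<tau>))" using nz by (simp add: slope_def algebra_simps)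
      then have "\<bar>\<xi> $ i + t * \<xi> $ j\<bar> = \<bar>\<xi> $ i\<bar> * (1 + t * slope i j (\<xi>, \<tau>))"
        using slope_product[OF slx xi(3) \<alpha>(2)] by (simp add: abs_mult)
      also have "\<dots> \<ge> 3 / 8 * n1 * (98 / 100)"
        using slope_product[OF slx xi(3) \<alpha>(2)] xi n by (intro mult_mono) auto
      finally have "36 / 100 * n1 \<le> \<bar>\<xi> $ i + t * \<xi> $ j\<bar>" using n by linarith
      then have 4: "36 / 100 * n1 \<le> 1 * (\<xi> $ i + t * \<xi> $ j) \<or> 36 / 100 * n1 \<le> - 1 * (\<xi> $ i + t * \<xi> $ j)"
        by (auto simp: abs_real_def split: if_splits)
      have 5: "\<bar>q \<xi>\<bar> \<le> A + B" unfolding q_def using 1 by linarith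
      show "\<xi> \<in> S 1 \<union> S (- 1)" unfolding S_def using 2 3 4 5 by blast
      assume "(\<xi>, \<tau>') \<in> E"
      then have "?P (\<xi>, \<tau>') (z - (\<xi>, \<tau>'))" by (auto simp: E_def)
      then have "\<bar>\<tau>' - (norm \<xi>)\<^sup>2\<bar> < A" "\<bar>snd z - \<tau>' - (norm (fst z - \<xi>))\<^sup>2\<bar> < B"
        using modulation_less[of "(\<xi>, \<tau>')" A] modulation_less[of "z - (\<xi>, \<tau>')" B] by (auto simp: interact_def dyad_def)
      with 1 show "\<bar>\<tau>' - \<tau>\<bar> \<le> 2 * min A B" by (auto simp: min_def)
    qed
    also have "\<dots> \<le> ennreal (2 * (2 * min A B)) * (emeasure lborel (S 1) + emeasure lborel (S (- 1)))"
      using S by (intro mult_left_mono emeasure_subadditive) auto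
    also have "\<dots> \<le> ennreal (2 * (2 * min A B)) * (ennreal (4 * \<rho> * (4 * (A + B) / n1)) + ennreal (4 * \<rho> * (4 * (A + B) / n1)))"
      by (intro mult_left_mono add_mono area) auto
    also have "\<dots> = ennreal (128 * \<rho> / n1 * (min A B * (A + B)))"
      using pos n \<rho> by (simp add: ennreal_mult[symmetric] ennreal_plus[symmetric] field_simps del: ennreal_plus)
    also have "\<dots> \<le> ennreal (128 * \<rho> / n1 * (2 * (A * B)))"
      using pos n \<rho> by (intro ennreal_leI mult_left_mono min_mult_add_le) auto
    also have "\<dots> \<le> ennreal (C\<^sup>2)"
      using n pos by (intro ennreal_leI) (simp add: \<rho>_def \<alpha>_def C_def power_mult_distrib field_simps)
    finally show "emeasure lborel {x. ?P x (z - x) \<and> \<bar>slope i j x - t\<bar> \<le> \<alpha> \<and> \<bar>- slope j i (z - x) - t\<bar> \<le> 2 * \<alpha>} \<le> ennreal (C\<^sup>2)"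
      unfolding E_def .
  qed
  have "tri (\<lambda>x y. of_bool (?P x y)) (2 * C)"
  proof (rule tri_localize[where \<phi> = "slope i j" and \<psi> = "\<lambda>y. - slope j i y" and \<alpha> = \<alpha>])
    show "kernel (\<lambda>x y. of_bool (?P x y))" by (rule kernel_of_bool) measurable
    show "\<bar>slope i j x - - slope j i y\<bar> \<le> \<alpha>" if "of_bool (?P x y) \<noteq> (0::real)" for x y
      using that P[of x y] by (auto simp: \<alpha>_def split: if_splits)
    show "tri (\<lambda>x y. of_bool (?P x y) * of_bool (\<bar>slope i j x - t\<bar> \<le> \<alpha>) * of_bool (\<bar>- slope j i y - t\<bar> \<le> 2 * \<alpha>)) C" for t
      using window[of t] by (simp only: of_bool_conj mult.assoc)
  qed (use \<alpha> C in \<open>auto\<close>)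
  then show ?thesis by (simp add: C_def)
qed

text \<open>One of the two coordinates of \<open>x\<close> always dominates, so two frames cover
  everything at the cost of a factor 2.\<close>

lemma tri_of_bool_frames:
  assumes P: "Measurable.pred borel (\<lambda>z. P (fst z) (snd z))"
    and *: "\<And>i j :: 2. i \<noteq> j \<Longrightarrow> tri (\<lambda>x y. of_bool (P x y \<and> \<bar>fst x $ j\<bar> \<le> \<bar>fst x $ i\<bar>)) C"
  shows "tri (\<lambda>x y :: spacetime. of_bool (P x y)) (2 * C)"
proof (rule tri_mono[OF tri_add[OF *[of 1 2] *[of 2 1]] kernel_of_bool[OF P]])
  show "of_bool (P x y) \<le> of_bool (P x y \<and> \<bar>fst x $ 2\<bar> \<le> \<bar>fst x $ 1\<bar>) + (of_bool (P x y \<and> \<bar>fst x $ 1\<bar> \<le> \<bar>fst x $ 2\<bar>) :: real)" for x y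
    by auto
qed auto

lemma interact_swap: "interact n1 n2 A B D x y = interact n2 n1 B A D y x"
  by (auto simp: interact_def add.commute)

lemma measurable_interact: "Measurable.pred borel (\<lambda>z. interact n1 n2 A B D (fst z) (snd z))"
  unfolding interact_def by measurable

text \<open>If the largest modulation L satisfies 1000 L \<le> n1 n2, the transversal count is run
  at the function that carries it. Otherwise Strichartz with the other two modulations U, V is good
  enough, since U V = A B D / L < 1000 A B D / (n1 n2). As 64^2 exceeds 1000, both cases fit the
  constant 384 = 6 * 64 = 2 * 192.\<close>

lemma tri_interact_aux:
  assumes n: "0 < n1" "0 < n2" "n2 \<le> n1" and pos: "0 < A" "0 < B" "0 < D"
  shows "tri (\<lambda>x y. of_bool (interact n1 n2 A B D x y)) (384 * sqrt (A * B * D / (n1 * n2)))"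
proof -
  define L where "L = max A (max B D)"
  have L: "A \<le> L" "B \<le> L" "D \<le> L" "0 < L" using pos by (auto simp: L_def)
  have mono: "tri (\<lambda>x y. of_bool (interact n1 n2 A B D x y)) (384 * sqrt (A * B * D / (n1 * n2)))"
    if t: "tri (\<lambda>x y. of_bool (Q x y)) (6 * sqrt (U * V))" and Q: "\<And>x y. interact n1 n2 A B D x y \<Longrightarrow> Q x y"
      and UV: "0 < U" "0 < V" "U * V * L = A * B * D" and big: "n1 * n2 < 1000 * L" for Q U V
  proof (rule tri_mono[OF t kernel_of_bool[OF measurable_interact]])
    show "of_bool (interact n1 n2 A B D x y) \<le> (of_bool (Q x y) :: real)" for x y using Q[of x y] by auto
    have "U * V \<le> 1000 * (A * B * D / (n1 * n2))"
    proof -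
      have "U * V * (n1 * n2) \<le> U * V * (1000 * L)" using big UV by (intro mult_left_mono) auto
      also have "\<dots> = 1000 * (A * B * D)" using UV(3) by simp
      finally have "U * V \<le> 1000 * (A * B * D) / (n1 * n2)" using n by (simp add: pos_le_divide_eq)
      then show ?thesis by simp
    qed
    moreover have "0 \<le> A * B * D / (n1 * n2)" using pos n by simp
    ultimately have "U * V \<le> 4096 * (A * B * D / (n1 * n2))" by linarith
    then have "sqrt (U * V) \<le> sqrt (64\<^sup>2 * (A * B * D / (n1 * n2)))"
      by (intro real_sqrt_le_mono) simp
    also have "\<dots> = 64 * sqrt (A * B * D / (n1 * n2))" unfolding real_sqrt_mult by simp
    finally show "6 * sqrt (U * V) \<le> 384 * sqrt (A * B * D / (n1 * n2))" by simp
  qed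
  have "L = A \<or> L = B \<or> L = D" unfolding L_def max_def by auto
  then consider "L = A" | "L = B" | "L = D" by blast
  then show ?thesis
  proof cases
    case 1
    show ?thesis
    proof (cases "1000 * A \<le> n1 * n2")
      case True
      from tri_of_bool_frames[OF measurable_interact tri_transversal_first[OF _ n(1,2) pos _ _ True]] L 1
      show ?thesis by simp
    next
      case False
      from tri_swap[OF tri_strichartz_reflected[OF pos(2,3)]]
      show ?thesis by (rule mono) (use pos 1 False in \<open>auto simp: interact_def dyad_def add.commute\<close>)
    qed
  next
    case 2
    show ?thesis
    proof (cases "1000 * B \<le> n2 * n1")
      case True
      from tri_of_bool_frames[OF measurable_interact tri_transversal_first[OF _ n(2,1) pos(2,1,3) _ _ True]] L 2
      have "tri (\<lambda>x y. of_bool (interact n2 n1 B A D x y)) (384 * sqrt (B * A * D / (n2 * n1)))" by simp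
      from tri_swap[OF this] show ?thesis by (simp add: interact_swap[of n2 n1 B A D] mult_ac)
    next
      case False
      from tri_strichartz_reflected[OF pos(1,3)]
      show ?thesis by (rule mono) (use pos 2 False in \<open>auto simp: interact_def dyad_def mult.commute\<close>)
    qed
  next
    case 3
    show ?thesis
    proof (cases "1000 * D \<le> n1 * n2")
      case True
      from tri_of_bool_frames[OF measurable_interact tri_transversal_sum[OF _ n pos _ _ True]] L 3
      show ?thesis by simp
    next
      case False
      from tri_strichartz[OF pos(1,2)]
      show ?thesis by (rule mono) (use pos 3 False in \<open>auto simp: interact_def dyad_def\<close>)
    qed
  qed
qed

text \<open>This is the trilinear Loomis--Whitney inequality for three thickened paraboloids; the gain in
  \<open>n1 * n2\<close> is the transversality of their normals.\<close>

lemma tri_interact: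
  assumes n: "0 < n1" "0 < n2" and pos: "0 < A" "0 < B" "0 < D"
  shows "tri (\<lambda>x y. of_bool (interact n1 n2 A B D x y)) (384 * sqrt (A * B * D / (n1 * n2)))"
proof (cases "n2 \<le> n1")
  case True then show ?thesis by (intro tri_interact_aux n pos)
next
  case False
  then have "tri (\<lambda>x y. of_bool (interact n2 n1 B A D x y)) (384 * sqrt (B * A * D / (n2 * n1)))"
    by (intro tri_interact_aux n pos) auto
  from tri_swap[OF this] show ?thesis by (simp add: interact_swap[of n2 n1 B A D] mult_ac)
qed

subsection \<open>Summation over dyadic pieces\<close>

lemma sqrt_2_power: "sqrt (2 ^ n) = 2 powr (1/2 * real n)"
  by (simp add: powr_half_sqrt[symmetric] powr_realpow[symmetric] powr_powr mult.commute)

lemma inverse_sqrt_2_power: "1 / sqrt (2 ^ n) = 2 powr (- (1/2) * real n)"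
  unfolding sqrt_2_power by (simp add: powr_minus_divide)

definition dyadic_const :: "real \<Rightarrow> real \<Rightarrow> real" where
  "dyadic_const a \<eta> = 2 powr \<bar>a + \<eta>\<bar> * (\<Sum>n. 2 powr (- \<eta> * real n))"

lemma tri_sum_modulation:
  fixes u :: "spacetime \<Rightarrow> spacetime \<Rightarrow> spacetime"
  assumes k: "kernel k" and u [measurable]: "(\<lambda>z. u (fst z) (snd z)) \<in> borel_measurable borel" and \<eta>: "0 < \<eta>"
    and *: "\<And>n. tri (\<lambda>x y. k x y * of_bool (modulation (u x y) < 2 ^ (n + 1))) (C * 2 powr (1/2 * real n))"
  shows "tri (\<lambda>x y. k x y * Mw \<eta> (u x y)) (C * dyadic_const (1/2) \<eta>)"
proof -
  have [measurable]: "(\<lambda>z. k (fst z) (snd z)) \<in> borel_measurable borel"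
    using kernel_measurable[OF k] by (simp add: borel_prod)
  have eq: "Mw \<eta> p = modulation p powr (- (1/2) - \<eta>)" for p by (simp add: Mw_def)
  show ?thesis unfolding eq dyadic_const_def
  proof (rule tri_dyadic_sum[OF k _ _ \<eta>])
    show "kernel (\<lambda>x y. modulation (u x y))"
    proof (rule kernelI)
      show "0 \<le> modulation (u x y)" for x y using modulation_ge_1[of "u x y"] by linarith
    qed measurable
    fix n
    show "tri (\<lambda>x y. k x y * of_bool (2 ^ n \<le> modulation (u x y) \<and> modulation (u x y) < 2 ^ (n + 1))) (C * 2 powr (1/2 * real n))"
    proof (rule tri_mono[OF *])
      show "kernel (\<lambda>x y. k x y * of_bool (2 ^ n \<le> modulation (u x y) \<and> modulation (u x y) < 2 ^ (n + 1)))"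
      proof (rule kernelI)
        show "0 \<le> k x y * of_bool (2 ^ n \<le> modulation (u x y) \<and> modulation (u x y) < 2 ^ (n + 1))" for x y
          using kernel_nonneg[OF k, of x y] by simp
      qed measurable
    qed (auto simp: kernel_nonneg[OF k])
  qed (rule modulation_ge_1)
qed

lemma tri_sum_frequency:
  fixes u :: "spacetime \<Rightarrow> spacetime \<Rightarrow> spacetime"
  assumes k: "kernel k" and u [measurable]: "(\<lambda>z. u (fst z) (snd z)) \<in> borel_measurable borel" and \<eta>: "0 < \<eta>"
    and *: "\<And>n. tri (\<lambda>x y. k x y * of_bool (2 ^ n \<le> bracket (fst (u x y)) \<and> bracket (fst (u x y)) < 2 ^ (n + 1))) (C * 2 powr (- (1/2) * real n))"
  shows "tri (\<lambda>x y. k x y * bracket (fst (u x y)) powr (1/2 - \<eta>)) (C * dyadic_const (- (1/2)) \<eta>)"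
proof -
  have eq: "1/2 - \<eta> = - (- (1/2)) - \<eta>" by simp
  show ?thesis unfolding eq dyadic_const_def
  proof (rule tri_dyadic_sum[OF k _ _ \<eta> *])
    show "kernel (\<lambda>x y. bracket (fst (u x y)))"
    proof (rule kernelI)
      show "0 \<le> bracket (fst (u x y))" for x y using bracket_ge_1[of "fst (u x y)"] by linarith
    qed measurable
  qed (rule bracket_ge_1)
qed

lemma tri_Mw_Mw:
  fixes \<eta> :: real
  assumes \<eta>: "0 < \<eta>"
  shows "\<exists>C. tri (\<lambda>x y. Mw \<eta> x * Mw \<eta> y) C"
proof -
  let ?Q = "\<lambda>n p. of_bool (modulation p < 2 ^ (n + 1)) :: real"
  let ?S = "dyadic_const (1/2) \<eta>"
  have 0: "tri (\<lambda>x y. ?Q a x * ?Q b y) (12 * 2 powr (1/2 * real a) * 2 powr (1/2 * real b))" for a b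
  proof -
    have "6 * sqrt (2 ^ (a + 1) * 2 ^ (b + 1)) = 12 * 2 powr (1/2 * real a) * 2 powr (1/2 * real b)"
      by (simp only: sqrt_2_power[symmetric]) (simp add: real_sqrt_mult)
    moreover have "tri (\<lambda>x y. of_bool (modulation x < 2 ^ (a + 1) \<and> modulation y < 2 ^ (b + 1))) (6 * sqrt (2 ^ (a + 1) * 2 ^ (b + 1)))"
      by (rule tri_strichartz) auto
    ultimately show ?thesis by (simp only: of_bool_conj)
  qed
  have 1: "tri (\<lambda>x y. ?Q a x * Mw \<eta> y) (12 * 2 powr (1/2 * real a) * ?S)" for a
  proof (rule tri_sum_modulation[OF _ _ \<eta> 0])
    show "kernel (\<lambda>x y. ?Q a x)" by (rule kernelI) measurable
  qed measurable
  have 2: "tri (\<lambda>x y. Mw \<eta> y * Mw \<eta> x) (12 * ?S * ?S)"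
  proof (rule tri_sum_modulation[OF _ _ \<eta>])
    show "kernel (\<lambda>x y. Mw \<eta> y)" by (rule kernelI) measurable
    show "tri (\<lambda>x y. Mw \<eta> y * ?Q n x) (12 * ?S * 2 powr (1/2 * real n))" for n
      using 1[of n] by (simp only: mult_ac)
  qed measurable
  then show ?thesis by (auto simp: mult.commute)
qed

lemma tri_Mw_Mw_sum:
  fixes \<eta> :: real
  assumes \<eta>: "0 < \<eta>"
  shows "\<exists>C. tri (\<lambda>x y. Mw \<eta> x * Mw \<eta> (x + y)) C"
proof -
  obtain C where "tri (\<lambda>x y. Mw \<eta> x * Mw \<eta> y) C" using tri_Mw_Mw[OF \<eta>] by blast
  then have "tri (\<lambda>x y. Mw \<eta> x * Mw \<eta> (x + y)) C" by (rule tri_reflect[rotated -1]) auto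
  then show ?thesis by blast
qed

lemma tri_low_frequency_weight:
  fixes \<eta> :: real
  assumes \<eta>: "0 < \<eta>"
  shows "\<exists>C. tri (\<lambda>x y. bracket (fst x) powr (1/8) * of_bool (4 \<le> bracket (fst x) \<and>
    bracket (parabolic_abs y) \<le> 2 * bracket (fst x) powr (1/8)) * Mw \<eta> (x + y)) C"
proof -
  have "tri (\<lambda>x y. bracket (fst x) powr (1/8) * of_bool (4 \<le> bracket (fst x) \<and>
    bracket (parabolic_abs y) \<le> 2 * bracket (fst x) powr (1/8)) * Mw \<eta> (x + y)) (140 * dyadic_const (1/2) \<eta>)"
  proof (rule tri_sum_modulation[OF _ _ \<eta>])
    show "kernel (\<lambda>x y. bracket (fst x) powr (1/8) * of_bool (4 \<le> bracket (fst x) \<and>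
      bracket (parabolic_abs y) \<le> 2 * bracket (fst x) powr (1/8)))"
    proof (rule kernelI)
      show "(\<lambda>z::spacetime \<times> spacetime. bracket (fst (fst z)) powr (1/8) * of_bool (4 \<le> bracket (fst (fst z)) \<and>
        bracket (parabolic_abs (snd z)) \<le> 2 * bracket (fst (fst z)) powr (1/8))) \<in> borel_measurable borel"
        by measurable
    qed simp
    fix n
    have "sqrt 2 \<le> 2" by (rule real_le_lsqrt) auto
    then have "70 * sqrt (2 ^ (n + 1)) \<le> 140 * 2 powr (1/2 * real n)"
      unfolding sqrt_2_power[symmetric] by (simp add: real_sqrt_mult)
    have "(1::real) \<le> 2 ^ (n + 1)" by (rule one_le_power) simp
    from tri_low_frequency[OF this]
    have t: "tri (\<lambda>x y. bracket (fst x) powr (1/8) * of_bool (4 \<le> bracket (fst x) \<and>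
      bracket (parabolic_abs y) \<le> 2 * bracket (fst x) powr (1/8)) * of_bool (modulation (x + y) < 2 ^ (n + 1))) (70 * sqrt (2 ^ (n + 1)))"
      by (simp only: of_bool_conj mult.assoc)
    show "tri (\<lambda>x y. bracket (fst x) powr (1/8) * of_bool (4 \<le> bracket (fst x) \<and>
      bracket (parabolic_abs y) \<le> 2 * bracket (fst x) powr (1/8)) * of_bool (modulation (x + y) < 2 ^ (n + 1))) (140 * 2 powr (1/2 * real n))"
      by (rule tri_mono[OF t tri_kernel[OF t] order_refl]) fact
  qed measurable
  then show ?thesis by blast
qed

text \<open>Five geometric sums, three over modulations and two over frequencies, remove one dyadic
  indicator at a time. The transversal gain (n1 n2)^(-1/2) is what allows positive powers of both
  frequencies in the kernel.\<close>

lemma tri_transversal_weight: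
  fixes \<eta> :: real
  assumes \<eta>: "0 < \<eta>"
  shows "\<exists>C. tri (\<lambda>x y. of_bool (4 \<le> bracket (fst x) \<and> 4 \<le> bracket (fst y)) * (Mw \<eta> x * Mw \<eta> y * Mw \<eta> (x + y)) *
    (bracket (fst x) powr (1/2 - \<eta>) * bracket (fst y) powr (1/2 - \<eta>))) C"
proof -
  let ?k = "\<lambda>x y::spacetime. of_bool (4 \<le> bracket (fst x) \<and> 4 \<le> bracket (fst y)) :: real"
  let ?M = "\<lambda>n p. of_bool (modulation p < 2 ^ (n + 1)) :: real"
  let ?N = "\<lambda>n p. of_bool (2 ^ n \<le> bracket (fst p) \<and> bracket (fst p) < 2 ^ (n + 1)) :: real"
  let ?W = "\<lambda>p. bracket (fst p) powr (1/2 - \<eta>)"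
  let ?S = "dyadic_const (1/2) \<eta>" and ?R = "dyadic_const (- (1/2)) \<eta>"
  let ?e = "\<lambda>n. 2 powr (1/2 * real n)" and ?i = "\<lambda>n. 2 powr (- (1/2) * real n)"
  have 0: "tri (\<lambda>x y. ?k x y * ?N j x * ?N l y * ?M a x * ?M b y * ?M d (x + y)) (1152 * ?e a * ?e b * ?i j * ?i l * ?e d)" for j l a b d
  proof -
    have t: "tri (\<lambda>x y. of_bool (interact (2 ^ j) (2 ^ l) (2 ^ (a + 1)) (2 ^ (b + 1)) (2 ^ (d + 1)) x y))
      (384 * sqrt (2 ^ (a + 1) * 2 ^ (b + 1) * 2 ^ (d + 1) / (2 ^ j * 2 ^ l)))"
      by (rule tri_interact) auto
    \<comment> \<open>The shifts from n to n + 1 in the three modulation bounds cost 2^(3/2), which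
      is at most 3 and turns 384 into 1152.\<close>
    have "sqrt 2 ^ 3 \<le> 3"
    proof -
      have "sqrt 2 ^ 3 = sqrt 2 ^ 2 * sqrt 2" by (simp add: eval_nat_numeral)
      also have "\<dots> = 2 * sqrt 2" by simp
      also have "sqrt 2 \<le> 3/2" by (rule real_le_lsqrt) (auto simp: power2_eq_square)
      finally show ?thesis by simp
    qed
    then have "sqrt 2 ^ 3 * (384 * ?e a * ?e b * ?i j * ?i l * ?e d) \<le> 3 * (384 * ?e a * ?e b * ?i j * ?i l * ?e d)"
      by (intro mult_right_mono) auto
    moreover have "384 * sqrt (2 ^ (a + 1) * 2 ^ (b + 1) * 2 ^ (d + 1) / (2 ^ j * 2 ^ l)) = sqrt 2 ^ 3 * (384 * ?e a * ?e b * ?i j * ?i l * ?e d)"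
      unfolding sqrt_2_power[symmetric] inverse_sqrt_2_power[symmetric]
      by (simp only: power_add power_one_right real_sqrt_mult real_sqrt_divide) (simp add: power3_eq_cube)
    ultimately have le: "384 * sqrt (2 ^ (a + 1) * 2 ^ (b + 1) * 2 ^ (d + 1) / (2 ^ j * 2 ^ l)) \<le> 1152 * ?e a * ?e b * ?i j * ?i l * ?e d"
      by simp
    have eq: "(\<lambda>x y. of_bool (interact (2 ^ j) (2 ^ l) (2 ^ (a + 1)) (2 ^ (b + 1)) (2 ^ (d + 1)) x y)) =
      (\<lambda>x y. ?k x y * ?N j x * ?N l y * ?M a x * ?M b y * ?M d (x + y))"
      by (intro ext) (auto simp: interact_def dyad_def)
    show ?thesis using tri_mono[OF t tri_kernel[OF t] order_refl le] unfolding eq .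
  qed
  have 1: "tri (\<lambda>x y. ?k x y * ?N j x * ?N l y * ?M a x * ?M b y * Mw \<eta> (x + y)) (1152 * ?e a * ?e b * ?i j * ?i l * ?S)" for j l a b
  proof (rule tri_sum_modulation[OF _ _ \<eta> 0])
    show "kernel (\<lambda>x y. ?k x y * ?N j x * ?N l y * ?M a x * ?M b y)" by (rule kernelI, measurable)
  qed measurable
  have 2: "tri (\<lambda>x y. ?k x y * ?N j x * ?N l y * ?M a x * Mw \<eta> (x + y) * Mw \<eta> y) (1152 * ?e a * ?i j * ?i l * ?S * ?S)" for j l a
  proof (rule tri_sum_modulation[OF _ _ \<eta>])
    show "kernel (\<lambda>x y. ?k x y * ?N j x * ?N l y * ?M a x * Mw \<eta> (x + y))" by (rule kernelI, measurable)
    show "tri (\<lambda>x y. ?k x y * ?N j x * ?N l y * ?M a x * Mw \<eta> (x + y) * ?M n y) (1152 * ?e a * ?i j * ?i l * ?S * ?e n)" for n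
      using 1[of j l a n] by (simp only: mult_ac)
  qed measurable
  have 3: "tri (\<lambda>x y. ?k x y * ?N j x * ?N l y * Mw \<eta> (x + y) * Mw \<eta> y * Mw \<eta> x) (1152 * ?i j * ?i l * ?S * ?S * ?S)" for j l
  proof (rule tri_sum_modulation[OF _ _ \<eta>])
    show "kernel (\<lambda>x y. ?k x y * ?N j x * ?N l y * Mw \<eta> (x + y) * Mw \<eta> y)" by (rule kernelI, measurable)
    show "tri (\<lambda>x y. ?k x y * ?N j x * ?N l y * Mw \<eta> (x + y) * Mw \<eta> y * ?M n x) (1152 * ?i j * ?i l * ?S * ?S * ?e n)" for n
      using 2[of j l n] by (simp only: mult_ac)
  qed measurable
  have 4: "tri (\<lambda>x y. ?k x y * ?N j x * Mw \<eta> (x + y) * Mw \<eta> y * Mw \<eta> x * ?W y) (1152 * ?i j * ?S * ?S * ?S * ?R)" for j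
  proof (rule tri_sum_frequency[OF _ _ \<eta>])
    show "kernel (\<lambda>x y. ?k x y * ?N j x * Mw \<eta> (x + y) * Mw \<eta> y * Mw \<eta> x)" by (rule kernelI, measurable)
    show "tri (\<lambda>x y. ?k x y * ?N j x * Mw \<eta> (x + y) * Mw \<eta> y * Mw \<eta> x * ?N n y) (1152 * ?i j * ?S * ?S * ?S * ?i n)" for n
      using 3[of j n] by (simp only: mult_ac)
  qed measurable
  have 5: "tri (\<lambda>x y. ?k x y * Mw \<eta> (x + y) * Mw \<eta> y * Mw \<eta> x * ?W y * ?W x) (1152 * ?S * ?S * ?S * ?R * ?R)"
  proof (rule tri_sum_frequency[OF _ _ \<eta>])
    show "kernel (\<lambda>x y. ?k x y * Mw \<eta> (x + y) * Mw \<eta> y * Mw \<eta> x * ?W y)" by (rule kernelI, measurable)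
    show "tri (\<lambda>x y. ?k x y * Mw \<eta> (x + y) * Mw \<eta> y * Mw \<eta> x * ?W y * ?N n x) (1152 * ?S * ?S * ?S * ?R * ?i n)" for n
      using 4[of n] by (simp only: mult_ac)
  qed measurable
  then show ?thesis by (intro exI) (simp only: mult_ac)
qed

subsection \<open>The regions and the weight\<close>

abbreviation freq :: "spacetime \<Rightarrow> real" where "freq p \<equiv> bracket (fst p)"
abbreviation psize :: "spacetime \<Rightarrow> real" where "psize p \<equiv> bracket (parabolic_abs p)"

lemma psize_ge_1: "1 \<le> psize p"
  by (rule bracket_ge_1)

lemma psize_power2: "psize p ^ 2 \<ge> 1 + \<bar>snd p\<bar> + (norm (fst p))\<^sup>2"
  "psize p ^ 2 \<le> 2 * (1 + \<bar>snd p\<bar> + (norm (fst p))\<^sup>2)"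
proof -
  define r where "r = parabolic_abs p"
  have r: "0 \<le> r" "r\<^sup>2 = \<bar>snd p\<bar> + (norm (fst p))\<^sup>2" by (simp_all add: r_def parabolic_abs_eq)
  have eq: "psize p ^ 2 = 1 + 2 * r + r\<^sup>2" using r by (simp add: bracket_def r_def[symmetric] power2_eq_square algebra_simps)
  then show "psize p ^ 2 \<ge> 1 + \<bar>snd p\<bar> + (norm (fst p))\<^sup>2" using r by simp
  have "2 * r \<le> 1 + r\<^sup>2" using zero_le_power2[of "r - 1"] by (simp add: power2_eq_square algebra_simps)
  then show "psize p ^ 2 \<le> 2 * (1 + \<bar>snd p\<bar> + (norm (fst p))\<^sup>2)" using eq r by simp
qed

lemma freq_le_psize: "freq p \<le> psize p"
proof -
  have "norm (fst p) = sqrt ((norm (fst p))\<^sup>2)" by simp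
  also have "\<dots> \<le> parabolic_abs p" unfolding parabolic_abs_eq by (intro real_sqrt_le_mono) simp
  finally show ?thesis by (simp add: bracket_def)
qed

lemma modulation_le_psize: "modulation p \<le> psize p ^ 2"
proof -
  have "\<bar>snd p - (norm (fst p))\<^sup>2\<bar> \<le> \<bar>snd p\<bar> + (norm (fst p))\<^sup>2"
    using abs_triangle_ineq4[of "snd p" "(norm (fst p))\<^sup>2"] by simp
  then show ?thesis using psize_power2(1)[of p] by (simp add: modulation_eq bracket_def)
qed

lemma psize_add: "psize (x + y) \<le> psize x + psize y"
proof -
  have "(parabolic_abs (x + y))\<^sup>2 = \<bar>snd x + snd y\<bar> + (norm (fst x + fst y))\<^sup>2" by (simp add: parabolic_abs_eq)
  also have "\<dots> \<le> (\<bar>snd x\<bar> + \<bar>snd y\<bar>) + (norm (fst x) + norm (fst y))\<^sup>2"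
    by (intro add_mono power_mono norm_triangle_ineq) auto
  also have "\<dots> = (parabolic_abs x)\<^sup>2 + (parabolic_abs y)\<^sup>2 + 2 * (norm (fst x) * norm (fst y))"
    by (simp add: parabolic_abs_eq power2_eq_square algebra_simps)
  also have "\<dots> \<le> (parabolic_abs x)\<^sup>2 + (parabolic_abs y)\<^sup>2 + 2 * (parabolic_abs x * parabolic_abs y)"
    using freq_le_psize[of x] freq_le_psize[of y]
    by (intro add_left_mono mult_left_mono mult_mono) (auto simp: bracket_def parabolic_abs_eq)
  also have "\<dots> = (parabolic_abs x + parabolic_abs y)\<^sup>2" by (simp add: power2_eq_square algebra_simps)
  finally have "parabolic_abs (x + y) \<le> parabolic_abs x + parabolic_abs y"
    by (rule power2_le_imp_le) (auto simp: parabolic_abs_eq)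
  then show ?thesis by (simp add: bracket_def parabolic_abs_eq)
qed

lemma A_set_iff: "p \<in> A_set j \<longleftrightarrow> 2 ^ j \<le> freq p \<and> freq p < 2 ^ (j + 1)"
  by (cases p) (simp add: A_set_def)

lemma B_set_iff: "p \<in> B_set d \<longleftrightarrow> 2 ^ d \<le> modulation p \<and> modulation p < 2 ^ (d + 1)"
  by (cases p) (simp add: B_set_def modulation_def)

lemma measurable_A_set [measurable]: "A_set j \<in> sets borel"
proof -
  have "A_set j = {p. 2 ^ j \<le> freq p \<and> freq p < 2 ^ (j + 1)}" by (auto simp: A_set_iff)
  also have "\<dots> \<in> sets borel" by measurable
  finally show ?thesis .
qed

lemma measurable_B_set [measurable]: "B_set d \<in> sets borel"
proof -
  have "B_set d = {p. 2 ^ d \<le> modulation p \<and> modulation p < 2 ^ (d + 1)}" by (auto simp: B_set_iff)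
  also have "\<dots> \<in> sets borel" by measurable
  finally show ?thesis .
qed

lemma measurable_K_set [measurable]: "K_set \<in> sets borel"
  unfolding K_set_def B_le_def by measurable

lemma K_set_iff: "p \<in> K_set \<longleftrightarrow> (\<exists>j d. p \<in> A_set j \<and> p \<in> B_set d \<and> d + 4 \<le> 2 * j)"
proof -
  have "int d \<le> 2 * int j - 4 \<longleftrightarrow> d + 4 \<le> 2 * j" for d j by linarith
  then show ?thesis unfolding K_set_def B_le_def by auto
qed

text \<open>The offset 4 in \<open>K\<close> leaves a factor 8 after rounding the modulation up to
  2^(d + 1). It also forces j \<ge> 2, which keeps frequencies away from the origin and makes norm
  and bracket comparable.\<close>

lemma K_set_D:
  assumes "p \<in> K_set"
  shows "4 \<le> freq p" "8 * modulation p \<le> freq p ^ 2"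
proof -
  obtain j d where j: "2 ^ j \<le> freq p" and d: "modulation p < 2 ^ (d + 1)" and jd: "d + 4 \<le> 2 * j"
    using assms by (auto simp: K_set_iff A_set_iff B_set_iff)
  have "(2::real) ^ 2 \<le> 2 ^ j" using jd by (intro power_increasing) auto
  then show "4 \<le> freq p" using j by simp
  have "8 * modulation p \<le> 8 * 2 ^ (d + 1)" using d by simp
  also have "\<dots> = 2 ^ (d + 4)" by (simp add: power_add)
  also have "\<dots> \<le> 2 ^ (2 * j)" using jd by (intro power_increasing) auto
  also have "\<dots> = (2 ^ j) ^ 2" by (simp add: power_mult[symmetric] mult.commute)
  also have "\<dots> \<le> freq p ^ 2" using j by (intro power_mono) auto
  finally show "8 * modulation p \<le> freq p ^ 2" .
qed

text \<open>Off \<open>K\<close> the dyadic indices satisfy 2 j \<le> d + 3, which gives 2^3;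
  rounding the frequency up to 2^(j + 1) contributes the remaining factor 4 of 32.\<close>

lemma not_K_set_D:
  assumes "p \<notin> K_set"
  shows "freq p ^ 2 \<le> 32 * modulation p"
proof -
  obtain j where j: "2 ^ j \<le> freq p" "freq p < 2 ^ (j + 1)" using ex_dyadic[OF bracket_ge_1] by blast
  obtain d where d: "2 ^ d \<le> modulation p" "modulation p < 2 ^ (d + 1)" using ex_dyadic[OF modulation_ge_1] by blast
  have "2 * j \<le> d + 3" using assms j d by (force simp: K_set_iff A_set_iff B_set_iff)
  have "freq p ^ 2 \<le> (2 ^ (j + 1)) ^ 2" using j bracket_pos[of "fst p"] by (intro power_mono) auto
  also have "\<dots> = 2 ^ (2 * j + 2)" by (simp add: power_mult[symmetric] mult.commute)
  also have "\<dots> \<le> 2 ^ (d + 5)" using \<open>2 * j \<le> d + 3\<close> by (intro power_increasing) auto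
  also have "\<dots> = 32 * 2 ^ d" by (simp add: power_add)
  also have "\<dots> \<le> 32 * modulation p" using d by simp
  finally show ?thesis .
qed

text \<open>On \<open>K\<close> the time is within N^2 / 8 of |\<xi>|^2, which lies between 9/16 N^2
  and N^2. So it is positive and the parabolic size is comparable to the frequency. Positivity
  excludes cancellation of times between two functions in \<open>K\<close>.\<close>

lemma K_set_time:
  assumes "p \<in> K_set"
  shows "7 / 16 * freq p ^ 2 \<le> snd p" "\<bar>snd p\<bar> + (norm (fst p))\<^sup>2 \<le> 17 / 8 * freq p ^ 2" "psize p \<le> 2 * freq p"
proof -
  note K = K_set_D[OF assms]
  have "(3 / 4 * freq p)\<^sup>2 \<le> (norm (fst p))\<^sup>2"
    using norm_frequency_ge[OF K(1)] bracket_pos[of "fst p"] by (intro power_mono) auto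
  then have lo: "9 / 16 * freq p ^ 2 \<le> (norm (fst p))\<^sup>2" by (simp add: power2_eq_square)
  have hi: "(norm (fst p))\<^sup>2 \<le> freq p ^ 2" by (intro power_mono) (auto simp: bracket_def)
  have m: "8 * \<bar>snd p - (norm (fst p))\<^sup>2\<bar> \<le> freq p ^ 2 - 8" using K(2) by (simp add: modulation_eq bracket_def)
  have m1: "8 * ((norm (fst p))\<^sup>2 - snd p) \<le> freq p ^ 2 - 8" "8 * (snd p - (norm (fst p))\<^sup>2) \<le> freq p ^ 2 - 8"
    using m abs_ge_self[of "snd p - (norm (fst p))\<^sup>2"] abs_ge_minus_self[of "snd p - (norm (fst p))\<^sup>2"] by simp_all
  show 1: "7 / 16 * freq p ^ 2 \<le> snd p" using m1(1) lo by simp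
  then have "0 \<le> snd p" using zero_le_power2[of "freq p"] by linarith
  then show 2: "\<bar>snd p\<bar> + (norm (fst p))\<^sup>2 \<le> 17 / 8 * freq p ^ 2" using m1(2) hi by simp
  have "(parabolic_abs p)\<^sup>2 \<le> 17 / 8 * freq p ^ 2" using 2 by (simp add: parabolic_abs_eq)
  also have "\<dots> \<le> (3 / 2 * freq p)\<^sup>2" by (simp add: power2_eq_square)
  finally have "parabolic_abs p \<le> 3 / 2 * freq p" using bracket_pos[of "fst p"] power2_le_imp_le[of "parabolic_abs p" "3 / 2 * freq p"] by simp
  moreover have "0 \<le> parabolic_abs p" by (simp add: parabolic_abs_eq)
  ultimately show "psize p \<le> 2 * freq p" using K(1) by (simp add: bracket_def[of "parabolic_abs p"])
qed

text \<open>Off \<open>K\<close> the modulation controls |\<xi>|^2 and therefore also the time; 130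
  = 2 (1 + 2 * 32).\<close>

lemma psize_le_modulation:
  assumes "p \<notin> K_set"
  shows "psize p ^ 2 \<le> 130 * modulation p"
proof -
  have m: "\<bar>snd p\<bar> \<le> modulation p - 1 + (norm (fst p))\<^sup>2"
    using abs_triangle_ineq[of "snd p - (norm (fst p))\<^sup>2" "(norm (fst p))\<^sup>2"] by (simp add: modulation_eq bracket_def)
  have "(norm (fst p))\<^sup>2 \<le> freq p ^ 2" by (intro power_mono) (auto simp: bracket_def)
  also have "\<dots> \<le> 32 * modulation p" by (rule not_K_set_D[OF assms])
  finally have n: "(norm (fst p))\<^sup>2 \<le> 32 * modulation p" .
  have "psize p ^ 2 \<le> 2 * (1 + \<bar>snd p\<bar> + (norm (fst p))\<^sup>2)" by (rule psize_power2)
  also have "\<dots> \<le> 2 * (modulation p + 2 * (norm (fst p))\<^sup>2)" using m by simp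
  also have "\<dots> \<le> 130 * modulation p" using n by simp
  finally show ?thesis .
qed

text \<open>The quotient of weights that appears when \<open>w\<close> is moved inside the
  convolution of f / w and g / w.\<close>

definition wratio :: "spacetime \<Rightarrow> spacetime \<Rightarrow> real" where
  "wratio x y = weight (x + y) / (weight x * weight y)"

lemma weight_eq: "weight p = max 1 (- snd p) ^ 10"
  by (simp add: weight_def case_prod_unfold)

lemma weight_pos: "0 < weight p"
  unfolding weight_eq by (intro zero_less_power) (simp add: less_max_iff_disj)

lemma measurable_weight [measurable]: "weight \<in> borel_measurable borel"
  unfolding weight_eq[abs_def] by measurable

lemma wratio_nonneg: "0 \<le> wratio x y"
  unfolding wratio_def using weight_pos by (simp add: less_imp_le)

text \<open>max(1, -\<tau>) is submultiplicative up to a factor 2, because a + b \<le> 2 a b for a,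
  b \<ge> 1; the tenth power makes 1024.\<close>

lemma wratio_le: "wratio x y \<le> 1024"
proof -
  define a b where "a = max 1 (- snd x)" and "b = max 1 (- snd y)"
  have ab: "1 \<le> a" "1 \<le> b" by (simp_all add: a_def b_def)
  have "a + b \<le> 2 * (a * b)"
    using mult_left_mono[OF ab(2), of a] mult_right_mono[OF ab(1), of b] ab by linarith
  moreover have "- snd (x + y) \<le> a + b" by (simp add: a_def b_def)
  moreover have "1 \<le> a * b" using mult_mono[OF ab] ab by simp
  ultimately have "max 1 (- snd (x + y)) \<le> 2 * (a * b)" by simp
  then have "weight (x + y) \<le> (2 * (a * b)) ^ 10" unfolding weight_eq by (intro power_mono) auto
  also have "\<dots> = 1024 * (weight x * weight y)" by (simp add: weight_eq a_def b_def power_mult_distrib)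
  finally show ?thesis unfolding wratio_def using weight_pos[of x] weight_pos[of y] by (simp add: field_simps)
qed

text \<open>A function supported in \<open>K\<close> has \<open>\<tau> \<approx> |\<xi>|\<^sup>2 > 0\<close>. If the sum has much smaller parabolic size,
  the other factor lives at large negative times, where the weight gains.\<close>

lemma high_low:
  assumes x: "x \<in> K_set" and small: "4 * psize (x + y) < freq x"
  shows "3 / 8 * freq x ^ 2 \<le> - snd y" "freq x \<le> 2 * psize y"
    "wratio x y \<le> 3 ^ 10 * (max 1 (- snd (x + y)) / freq x ^ 2) ^ 10"
proof -
  have N: "0 < freq x" by (rule bracket_pos)
  have "(4 * psize (x + y))\<^sup>2 \<le> freq x ^ 2" using small psize_ge_1[of "x + y"] by (intro power_mono) auto
  then have "16 * psize (x + y) ^ 2 \<le> freq x ^ 2" by (simp add: power_mult_distrib)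
  then have "16 * snd (x + y) \<le> freq x ^ 2" using psize_power2(1)[of "x + y"] zero_le_power2[of "norm (fst (x + y))"] by linarith
  then show 1: "3 / 8 * freq x ^ 2 \<le> - snd y" using K_set_time(1)[OF x] by simp
  have "- snd y \<le> psize y ^ 2"
    using psize_power2(1)[of y] zero_le_power2[of "norm (fst y)"] abs_ge_minus_self[of "snd y"] by linarith
  moreover have "(freq x / 2) ^ 2 \<le> 3 / 8 * freq x ^ 2" by (simp add: power_divide)
  ultimately have "(freq x / 2) ^ 2 \<le> psize y ^ 2" using 1 by linarith
  then have "freq x / 2 \<le> psize y" using psize_ge_1[of y] by (intro power2_le_imp_le[of "freq x / 2"]) auto
  then show "freq x \<le> 2 * psize y" by simp
  have "0 \<le> snd x" using K_set_time(1)[OF x] zero_le_power2[of "freq x"] by linarith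
  then have wx: "weight x = 1" by (simp add: weight_eq max_def)
  have "freq x ^ 2 / 3 \<le> 3 / 8 * freq x ^ 2" by simp
  also note 1
  also have "- snd y \<le> max 1 (- snd y)" by simp
  finally have 2: "freq x ^ 2 / 3 \<le> max 1 (- snd y)" .
  have "max 1 (- snd (x + y)) / max 1 (- snd y) \<le> max 1 (- snd (x + y)) / (freq x ^ 2 / 3)"
    using 2 N by (intro divide_left_mono) (auto simp: zero_less_mult_iff less_max_iff_disj)
  then have "(max 1 (- snd (x + y)) / max 1 (- snd y)) ^ 10 \<le> (3 * (max 1 (- snd (x + y)) / freq x ^ 2)) ^ 10"
    by (intro power_mono) (auto simp: zero_le_divide_iff le_max_iff_disj mult.commute)
  then show "wratio x y \<le> 3 ^ 10 * (max 1 (- snd (x + y)) / freq x ^ 2) ^ 10"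
    unfolding wratio_def wx mult_1 unfolding weight_eq by (simp only: power_divide power_mult_distrib)
qed

text \<open>The time of the sum is at most L^2 in absolute value, so the weights gain (L / N)^20 up
  to a constant; of this only (L / N)^2 is kept.\<close>

lemma wratio_high_low:
  assumes x: "x \<in> K_set" and small: "4 * psize (x + y) < freq x"
  shows "wratio x y \<le> 3 ^ 10 * (psize (x + y) / freq x) ^ 2"
proof -
  define l n where "l = psize (x + y)" and "n = freq x"
  have l: "1 \<le> l" "l \<le> n" "0 < n" using small psize_ge_1[of "x + y"] by (auto simp: l_def n_def)
  have "1 \<le> l ^ 2" using l by simp
  then have "max 1 (- snd (x + y)) \<le> l ^ 2"
    using psize_power2(1)[of "x + y"] zero_le_power2[of "norm (fst (x + y))"] unfolding l_def by linarith
  then have "(max 1 (- snd (x + y)) / n ^ 2) ^ 10 \<le> ((l / n) ^ 2) ^ 10"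
    unfolding power_divide[of l n] using l by (intro power_mono divide_right_mono) (auto simp: zero_le_divide_iff le_max_iff_disj)
  also have "\<dots> \<le> ((l / n) ^ 2) ^ 1"
    using l by (intro power_decreasing) (auto simp: power_le_one)
  finally have "(max 1 (- snd (x + y)) / n ^ 2) ^ 10 \<le> (l / n) ^ 2" by simp
  then show ?thesis using high_low(3)[OF x small] by (simp add: l_def n_def)
qed

text \<open>A sum in \<open>K\<close> has nonnegative time, hence weight 1, and the full gain
  N^(-20) of the tenth power survives.\<close>

lemma wratio_high_low_K:
  assumes x: "x \<in> K_set" and small: "4 * psize (x + y) < freq x" and K: "x + y \<in> K_set"
  shows "wratio x y \<le> 3 ^ 10 * freq x powr (- 20)"
proof -
  have "0 \<le> snd (x + y)" using K_set_time(1)[OF K] zero_le_power2[of "freq (x + y)"] by linarith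
  then have "max 1 (- snd (x + y)) = 1" by simp
  then have "wratio x y \<le> 3 ^ 10 * (1 / freq x ^ 2) ^ 10" using high_low(3)[OF x small] by simp
  also have "(1 / freq x ^ 2) ^ 10 = freq x powr (- 20)"
    using bracket_pos[of "fst x"] by (simp add: powr_minus_divide power_divide flip: power_mult)
  finally show ?thesis .
qed

subsection \<open>Pointwise kernel bounds\<close>

text \<open>The most demanding condition on \<eta> below is 6 \<eta> \<le> \<delta> / 8, in
  \<open>bound_resonant_near\<close>; the denominator 100 meets it with room to spare.\<close>

locale exponents =
  fixes \<delta> \<eta> :: real
  assumes \<delta>: "0 < \<delta>" "\<delta> < 1" and \<eta>: "\<eta> = \<delta> / 100"
begin

lemma \<eta>_pos: "0 < \<eta>" and \<eta>_small: "100 * \<eta> = \<delta>" "\<eta> < 1 / 100"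
  using \<delta> \<eta> by auto

lemma const_powr_le: "1 \<le> c \<Longrightarrow> a \<le> 1 \<Longrightarrow> c powr a \<le> c" for c a :: real
  using powr_mono[of a 1 c] by simp

lemma const_powr_ge: "1 \<le> c \<Longrightarrow> - 2 \<le> a \<Longrightarrow> 1 / c\<^sup>2 \<le> c powr a" for c a :: real
  using powr_mono[of "- 2" a c] by (simp add: powr_minus_divide)

text \<open>If N \<le> L, the missing 5 \<eta> powers of N are drawn from L^\<delta>. If N > L \<ge>
  n, the decay is transferred from N to n. The kernels of \<open>tri_weights\<close> accept a
  decaying frequency on the output as well as on an input.\<close>

lemma frequency_split:
  assumes "1 \<le> N" "1 \<le> n" "n \<le> L"
  shows "N powr (- 1 + 4 * \<eta>) \<le> L powr \<delta> * (N powr (- 1 - \<eta>) + n powr (- 1 - \<eta>))"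
proof (cases "N \<le> L")
  case True
  have "N powr (- 1 + 4 * \<eta>) \<le> N powr (\<delta> + (- 1 - \<eta>))" using assms \<delta> \<eta> by (intro powr_mono) auto
  also have "\<dots> = N powr \<delta> * N powr (- 1 - \<eta>)" by (simp add: powr_add)
  also have "\<dots> \<le> L powr \<delta> * (N powr (- 1 - \<eta>) + n powr (- 1 - \<eta>))"
    using True assms \<delta> by (intro mult_mono powr_mono2) auto
  finally show ?thesis .
next
  case False
  have "N powr (- 1 + 4 * \<eta>) \<le> L powr (- 1 + 4 * \<eta>)" using False assms \<delta> \<eta> by (intro powr_mono2') auto
  also have "\<dots> \<le> L powr (\<delta> + (- 1 - \<eta>))" using assms \<delta> \<eta> by (intro powr_mono) auto
  also have "\<dots> = L powr \<delta> * L powr (- 1 - \<eta>)" by (simp add: powr_add)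
  also have "\<dots> \<le> L powr \<delta> * (N powr (- 1 - \<eta>) + n powr (- 1 - \<eta>))"
  proof (intro mult_left_mono)
    have "L powr (- 1 - \<eta>) \<le> n powr (- 1 - \<eta>)" using assms \<eta>_pos by (intro powr_mono2') auto
    then show "L powr (- 1 - \<eta>) \<le> N powr (- 1 - \<eta>) + n powr (- 1 - \<eta>)" by (simp add: add_increasing)
  qed simp
  finally show ?thesis .
qed

text \<open>The larger size L1 dominates both L and N up to a factor 2, so L1^\<delta> pays for L^(4
  \<eta>) and for N^\<delta>, up to N^(4 \<eta>). The smaller size L2 covers that remainder through
  \<open>frequency_split\<close>.\<close>

lemma bound_low_low_aux:
  assumes "1 \<le> N" "N \<le> L" "L \<le> L1 + L2" "L2 \<le> L1" "1 \<le> N2" "N2 \<le> L2"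
  shows "N powr (\<delta> - 1) * L powr (4 * \<eta>) \<le> 4 * (L1 powr \<delta> * L2 powr \<delta> * (N powr (- 1 - \<eta>) + N2 powr (- 1 - \<eta>)))"
proof -
  have L: "1 \<le> L" "L \<le> 2 * L1" "N / 2 \<le> L1" "0 < L1" using assms by auto
  have "L powr (4 * \<eta>) \<le> (2 * L1) powr (4 * \<eta>)" using L \<eta>_pos by (intro powr_mono2) auto
  also have "\<dots> = 2 powr (4 * \<eta>) * L1 powr (4 * \<eta>)" using L by (simp add: powr_mult)
  also have "\<dots> \<le> 2 * L1 powr (4 * \<eta>)" using \<eta>_small by (intro mult_right_mono const_powr_le) auto
  finally have 1: "L powr (4 * \<eta>) \<le> 2 * (L1 powr \<delta> * L1 powr (4 * \<eta> - \<delta>))" by (simp add: powr_add[symmetric])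
  have "L1 powr (4 * \<eta> - \<delta>) \<le> (N / 2) powr (4 * \<eta> - \<delta>)" using L assms \<delta> \<eta> by (intro powr_mono2') auto
  also have "\<dots> = N powr (4 * \<eta> - \<delta>) * 2 powr (\<delta> - 4 * \<eta>)"
    using assms by (simp add: powr_divide powr_minus_divide[symmetric] divide_powr_uminus)
  also have "\<dots> \<le> N powr (4 * \<eta> - \<delta>) * 2" using \<delta> \<eta> by (intro mult_left_mono const_powr_le) auto
  finally have 2: "L1 powr (4 * \<eta> - \<delta>) \<le> N powr (4 * \<eta> - \<delta>) * 2" .
  have "N powr (\<delta> - 1) * L powr (4 * \<eta>) \<le> N powr (\<delta> - 1) * (2 * (L1 powr \<delta> * (N powr (4 * \<eta> - \<delta>) * 2)))"
    using 1 mult_left_mono[OF 2, of "L1 powr \<delta>"] by (intro mult_left_mono) auto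
  also have "\<dots> = 4 * L1 powr \<delta> * N powr (- 1 + 4 * \<eta>)"
    by (simp add: powr_add[symmetric] algebra_simps)
  also have "\<dots> \<le> 4 * L1 powr \<delta> * (L2 powr \<delta> * (N powr (- 1 - \<eta>) + N2 powr (- 1 - \<eta>)))"
    using assms by (intro mult_left_mono frequency_split) auto
  finally show ?thesis by (simp add: mult_ac)
qed

lemma bound_low_low:
  assumes "1 \<le> N" "N \<le> L" "L \<le> L1 + L2" "1 \<le> N1" "N1 \<le> L1" "1 \<le> N2" "N2 \<le> L2"
  shows "N powr (\<delta> - 1) * L powr (4 * \<eta>) \<le>
    4 * (L1 powr \<delta> * L2 powr \<delta> * (N powr (- 1 - \<eta>) + N1 powr (- 1 - \<eta>) + N2 powr (- 1 - \<eta>)))"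
proof (cases "L2 \<le> L1")
  case True
  note bound_low_low_aux[OF assms(1,2,3) True assms(6,7)]
  also have "4 * (L1 powr \<delta> * L2 powr \<delta> * (N powr (- 1 - \<eta>) + N2 powr (- 1 - \<eta>))) \<le>
    4 * (L1 powr \<delta> * L2 powr \<delta> * (N powr (- 1 - \<eta>) + N1 powr (- 1 - \<eta>) + N2 powr (- 1 - \<eta>)))"
    by (intro mult_left_mono) auto
  finally show ?thesis .
next
  case False
  then have "L \<le> L2 + L1" "L1 \<le> L2" using assms by auto
  note bound_low_low_aux[OF assms(1,2) this assms(4,5)]
  also have "4 * (L2 powr \<delta> * L1 powr \<delta> * (N powr (- 1 - \<eta>) + N1 powr (- 1 - \<eta>))) \<le>
    4 * (L2 powr \<delta> * L1 powr \<delta> * (N powr (- 1 - \<eta>) + N1 powr (- 1 - \<eta>) + N2 powr (- 1 - \<eta>)))"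
    by (intro mult_left_mono) auto
  finally show ?thesis by (simp add: mult_ac)
qed

text \<open>When N1 \<le> 4 L, negative powers of L are traded for negative powers of N1. When 4 L <
  N1, the weights supply (L / N1)^2, and L2 \<ge> N1 / 2 lets L2^\<delta> cover the remaining power
  of N1.\<close>

lemma bound_high_low_out:
  assumes N: "1 \<le> N" "N \<le> L" and N1: "1 \<le> N1" and N2: "1 \<le> N2" "N2 \<le> L2" and r: "0 \<le> r" "r \<le> 1024"
    and high: "4 * L < N1 \<Longrightarrow> r \<le> 3 ^ 10 * (L / N1) ^ 2 \<and> N1 \<le> 2 * L2"
  shows "N powr (\<delta> - 1) * L powr (- 1 + 2 * \<eta>) * r \<le>
    3 ^ 11 * (N1 powr (\<delta> - 1 - 2 * \<eta>) * (L2 powr \<delta> * (N powr (- 1 - \<eta>) + N2 powr (- 1 - \<eta>))))"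
proof (cases "4 * L < N1")
  case False
  then have N1L: "N1 \<le> 4 * L" by simp
  have L: "0 < L" using N by simp
  have "1 / 4\<^sup>2 * L powr (\<delta> - 1 - 2 * \<eta>) \<le> 4 powr (\<delta> - 1 - 2 * \<eta>) * L powr (\<delta> - 1 - 2 * \<eta>)"
    using \<delta> \<eta> by (intro mult_right_mono const_powr_ge) auto
  also have "\<dots> = (4 * L) powr (\<delta> - 1 - 2 * \<eta>)" using L by (simp add: powr_mult)
  also have "\<dots> \<le> N1 powr (\<delta> - 1 - 2 * \<eta>)" using N1L N1 \<delta> \<eta> by (intro powr_mono2') auto
  finally have 1: "L powr (\<delta> - 1 - 2 * \<eta>) \<le> 16 * N1 powr (\<delta> - 1 - 2 * \<eta>)" by simp
  have "N powr (\<delta> - 1) * L powr (- 1 + 2 * \<eta>) = N powr (\<delta> - 1) * L powr (- \<delta> + 4 * \<eta>) * L powr (\<delta> - 1 - 2 * \<eta>)"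
    by (simp add: powr_add[symmetric] algebra_simps)
  also have "\<dots> \<le> N powr (\<delta> - 1) * N powr (- \<delta> + 4 * \<eta>) * (16 * N1 powr (\<delta> - 1 - 2 * \<eta>))"
    using N \<delta> \<eta> by (intro mult_mono mult_left_mono powr_mono2' 1) auto
  also have "\<dots> = 16 * N1 powr (\<delta> - 1 - 2 * \<eta>) * N powr (- 1 + 4 * \<eta>)"
    by (simp add: powr_add[symmetric] algebra_simps)
  also have "\<dots> \<le> 16 * N1 powr (\<delta> - 1 - 2 * \<eta>) * (L2 powr \<delta> * (N powr (- 1 - \<eta>) + N2 powr (- 1 - \<eta>)))"
    using N N2 by (intro mult_left_mono frequency_split) auto
  finally have *: "N powr (\<delta> - 1) * L powr (- 1 + 2 * \<eta>) \<le>
     16 * N1 powr (\<delta> - 1 - 2 * \<eta>) * (L2 powr \<delta> * (N powr (- 1 - \<eta>) + N2 powr (- 1 - \<eta>)))" .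
  have "N powr (\<delta> - 1) * L powr (- 1 + 2 * \<eta>) * r \<le>
     16 * N1 powr (\<delta> - 1 - 2 * \<eta>) * (L2 powr \<delta> * (N powr (- 1 - \<eta>) + N2 powr (- 1 - \<eta>))) * 1024"
    by (rule mult_mono[OF *]) (use r in auto)
  also have "\<dots> = 16384 * (N1 powr (\<delta> - 1 - 2 * \<eta>) * (L2 powr \<delta> * (N powr (- 1 - \<eta>) + N2 powr (- 1 - \<eta>))))"
    by simp
  also have "\<dots> \<le> 3 ^ 11 * (N1 powr (\<delta> - 1 - 2 * \<eta>) * (L2 powr \<delta> * (N powr (- 1 - \<eta>) + N2 powr (- 1 - \<eta>))))"
    by (intro mult_right_mono) auto
  finally show ?thesis .
next
  case True
  have L: "1 \<le> L" "L \<le> N1" using N True by auto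
  have h: "r \<le> 3 ^ 10 * (L / N1) ^ 2" "N1 / 2 \<le> L2" using high[OF True] by auto
  have sq: "(L / N1) ^ 2 = L powr 2 * N1 powr (- 2)" using L N1 by (simp add: power_divide powr_minus_divide)
  have "N powr (\<delta> - 1) = N powr (- 1 - \<eta>) * N powr (\<delta> + \<eta>)" by (simp add: powr_add[symmetric])
  also have "\<dots> \<le> N powr (- 1 - \<eta>) * L powr (\<delta> + \<eta>)" using N \<delta> \<eta>_pos by (intro mult_left_mono powr_mono2) auto
  finally have 1: "N powr (\<delta> - 1) \<le> N powr (- 1 - \<eta>) * L powr (\<delta> + \<eta>)" .
  have "L powr (\<delta> + \<eta>) * L powr (- 1 + 2 * \<eta>) * (L powr 2 * N1 powr (- 2)) = L powr (1 + \<delta> + 3 * \<eta>) * N1 powr (- 2)"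
    by (simp add: powr_add[symmetric] algebra_simps)
  also have "\<dots> \<le> N1 powr (1 + \<delta> + 3 * \<eta>) * N1 powr (- 2)" using L \<delta> \<eta>_pos by (intro mult_right_mono powr_mono2) auto
  also have "\<dots> = N1 powr (- 1 + \<delta> + 3 * \<eta>)" by (simp add: powr_add[symmetric] algebra_simps)
  also have "\<dots> \<le> N1 powr ((\<delta> - 1 - 2 * \<eta>) + \<delta>)" using N1 \<delta> \<eta> by (intro powr_mono) auto
  also have "\<dots> = N1 powr (\<delta> - 1 - 2 * \<eta>) * N1 powr \<delta>" by (simp only: powr_add)
  also have "\<dots> \<le> N1 powr (\<delta> - 1 - 2 * \<eta>) * (2 * L2) powr \<delta>" using h N1 \<delta> by (intro mult_left_mono powr_mono2) auto
  also have "(2 * L2) powr \<delta> = 2 powr \<delta> * L2 powr \<delta>" using N2 by (simp add: powr_mult)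
  also have "\<dots> \<le> 2 * L2 powr \<delta>" using \<delta> by (intro mult_right_mono const_powr_le) auto
  finally have 2: "L powr (\<delta> + \<eta>) * L powr (- 1 + 2 * \<eta>) * (L powr 2 * N1 powr (- 2)) \<le> N1 powr (\<delta> - 1 - 2 * \<eta>) * (2 * L2 powr \<delta>)"
    by (simp add: mult_left_mono)
  have "N powr (\<delta> - 1) * L powr (- 1 + 2 * \<eta>) * r \<le>
     (N powr (- 1 - \<eta>) * L powr (\<delta> + \<eta>)) * L powr (- 1 + 2 * \<eta>) * (3 ^ 10 * (L powr 2 * N1 powr (- 2)))"
    using 1 h r sq by (intro mult_mono) auto
  also have "\<dots> = 3 ^ 10 * N powr (- 1 - \<eta>) * (L powr (\<delta> + \<eta>) * L powr (- 1 + 2 * \<eta>) * (L powr 2 * N1 powr (- 2)))"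
    by (simp only: ac_simps)
  also have "\<dots> \<le> 3 ^ 10 * N powr (- 1 - \<eta>) * (N1 powr (\<delta> - 1 - 2 * \<eta>) * (2 * L2 powr \<delta>))"
    by (intro mult_left_mono 2) auto
  also have "\<dots> = (2 * 3 ^ 10) * (N1 powr (\<delta> - 1 - 2 * \<eta>) * (L2 powr \<delta> * N powr (- 1 - \<eta>)))" by simp
  also have "\<dots> \<le> 3 ^ 11 * (N1 powr (\<delta> - 1 - 2 * \<eta>) * (L2 powr \<delta> * (N powr (- 1 - \<eta>) + N2 powr (- 1 - \<eta>))))"
    by (intro mult_mono mult_left_mono) auto
  finally show ?thesis .
qed

lemma bound_resonant_far:
  assumes "1 \<le> N" "1 \<le> N1" "0 \<le> r" "r \<le> 3 ^ 10 * N1 powr (- 20)"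
  shows "N powr (\<delta> - 1) * r \<le> 3 ^ 10 * (N1 powr (\<delta> - 1 - 2 * \<eta>) * N1 powr (- 1 - \<eta>))"
proof -
  have "N powr (\<delta> - 1) \<le> 1" using powr_mono[of "\<delta> - 1" 0 N] assms \<delta> by simp
  then have "N powr (\<delta> - 1) * r \<le> 1 * (3 ^ 10 * N1 powr (- 20))" using assms by (intro mult_mono) auto
  also have "\<dots> \<le> 3 ^ 10 * N1 powr (\<delta> - 1 - 2 * \<eta> + (- 1 - \<eta>))"
    using assms \<delta> \<eta> by (simp add: powr_mono)
  also have "\<dots> = 3 ^ 10 * (N1 powr (\<delta> - 1 - 2 * \<eta>) * N1 powr (- 1 - \<eta>))" by (simp only: powr_add)
  finally show ?thesis .
qed

text \<open>Since L2 \<ge> N^(1/8), the factor L2^\<delta> is worth N^(\<delta>/8), more than the 6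
  \<eta> by which the exponents of N and N1 differ.\<close>

lemma bound_resonant_near:
  assumes "1 \<le> N" "1 \<le> N1" "N1 \<le> 8 * N" "N powr (1/8) \<le> L2"
  shows "N powr (\<delta> - 1 + 4 * \<eta>) \<le> 64 * (N1 powr (\<delta> - 1 - 2 * \<eta>) * L2 powr \<delta>)"
proof -
  have "1 / 8\<^sup>2 * N powr (\<delta> - 1 - 2 * \<eta>) \<le> 8 powr (\<delta> - 1 - 2 * \<eta>) * N powr (\<delta> - 1 - 2 * \<eta>)"
    using \<delta> \<eta> by (intro mult_right_mono const_powr_ge) auto
  also have "\<dots> = (8 * N) powr (\<delta> - 1 - 2 * \<eta>)" using assms by (simp add: powr_mult)
  also have "\<dots> \<le> N1 powr (\<delta> - 1 - 2 * \<eta>)" using assms \<delta> \<eta> by (intro powr_mono2') auto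
  finally have 1: "N powr (\<delta> - 1 - 2 * \<eta>) \<le> 64 * N1 powr (\<delta> - 1 - 2 * \<eta>)" by simp
  have "N powr (\<delta> - 1 + 4 * \<eta>) \<le> N powr (\<delta> - 1 - 2 * \<eta> + 1/8 * \<delta>)" using assms \<delta> \<eta> by (intro powr_mono) auto
  also have "\<dots> = N powr (\<delta> - 1 - 2 * \<eta>) * (N powr (1/8)) powr \<delta>" by (simp only: powr_add powr_powr)
  also have "\<dots> \<le> 64 * N1 powr (\<delta> - 1 - 2 * \<eta>) * L2 powr \<delta>"
    using assms \<delta> by (intro mult_mono[OF 1] powr_mono2) auto
  finally show ?thesis by simp
qed

text \<open>When the second input is too small for L2^\<delta> to help, the loss N^(4 \<eta>) is
  paid by the factor N1^(1/8) that the low-frequency kernel tolerates.\<close>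

lemma bound_resonant_low:
  assumes "1 \<le> N" "1 \<le> N1" "N1 \<le> 8 * N" "N \<le> 4 * N1"
  shows "N powr (\<delta> - 1 + 4 * \<eta>) \<le> 32 * (N1 powr (\<delta> - 1) * N1 powr (1/8))"
proof -
  have "N powr (\<delta> - 1) \<le> (N1 / 8) powr (\<delta> - 1)" using assms \<delta> by (intro powr_mono2') auto
  also have "\<dots> = N1 powr (\<delta> - 1) * 8 powr (1 - \<delta>)"
    using assms by (simp add: powr_divide divide_powr_uminus)
  also have "\<dots> \<le> N1 powr (\<delta> - 1) * 8" using \<delta> by (intro mult_left_mono const_powr_le) auto
  finally have 1: "N powr (\<delta> - 1) \<le> N1 powr (\<delta> - 1) * 8" .
  have "N powr (4 * \<eta>) \<le> (4 * N1) powr (4 * \<eta>)" using assms \<eta>_pos by (intro powr_mono2) auto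
  also have "\<dots> = 4 powr (4 * \<eta>) * N1 powr (4 * \<eta>)" using assms by (simp add: powr_mult)
  also have "\<dots> \<le> 4 * N1 powr (1/8)" using assms \<eta>_small by (intro mult_mono const_powr_le powr_mono) auto
  finally have 2: "N powr (4 * \<eta>) \<le> 4 * N1 powr (1/8)" .
  have "N powr (\<delta> - 1 + 4 * \<eta>) = N powr (\<delta> - 1) * N powr (4 * \<eta>)" by (simp add: powr_add)
  also have "\<dots> \<le> (N1 powr (\<delta> - 1) * 8) * (4 * N1 powr (1/8))" by (rule mult_mono[OF 1 2]) auto
  finally show ?thesis by simp
qed

text \<open>The exponent e = (\<delta> - 1 - 2 \<eta>) + (1/2 - \<eta>) has no fixed sign. For e
  \<ge> 0 one uses N1 N2 \<ge> N / 2. For e < 0 one uses N1 N2 \<le> 16 N^2, where the requirement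
  \<delta> - 1 + 4 \<eta> \<le> 2 e amounts to 10 \<eta> \<le> \<delta>.\<close>

lemma bound_transversal:
  assumes "1 \<le> N" "1 \<le> N1" "1 \<le> N2" "N1 \<le> 4 * N" "N2 \<le> 4 * N" "N \<le> 2 * (N1 * N2)"
  shows "N powr (\<delta> - 1 + 4 * \<eta>) \<le> 256 * (N1 * N2) powr (\<delta> - 1/2 - 3 * \<eta>)"
proof -
  define P where "P = N1 * N2"
  have P: "1 \<le> P" "P \<le> 16 * (N * N)" "N \<le> 2 * P"
    using mult_mono[OF assms(2,3)] mult_mono[OF assms(4,5)] assms by (auto simp: P_def)
  define e where "e = \<delta> - 1/2 - 3 * \<eta>"
  have e: "- 1 \<le> e" "e \<le> 1" "\<delta> - 1 + 4 * \<eta> \<le> e" "\<delta> - 1 + 4 * \<eta> \<le> 2 * e" using \<delta> \<eta> by (auto simp: e_def)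
  show ?thesis unfolding P_def[symmetric] e_def[symmetric]
  proof (cases "0 \<le> e")
    case True
    have "1 / 2\<^sup>2 * N powr e \<le> 2 powr (- e) * N powr e"
      using e by (intro mult_right_mono const_powr_ge) auto
    also have "\<dots> = (N / 2) powr e" using assms by (simp add: powr_divide powr_minus_divide)
    also have "\<dots> \<le> P powr e" using P assms True by (intro powr_mono2) auto
    finally have "N powr e \<le> 4 * P powr e" by simp
    moreover have "N powr (\<delta> - 1 + 4 * \<eta>) \<le> N powr e" using assms e by (intro powr_mono) auto
    moreover have "0 \<le> P powr e" by simp
    ultimately show "N powr (\<delta> - 1 + 4 * \<eta>) \<le> 256 * P powr e" by linarith
  next
    case False
    have N: "0 \<le> N" using assms by simp
    have "1 / 16\<^sup>2 * N powr (\<delta> - 1 + 4 * \<eta>) \<le> 16 powr e * N powr (2 * e)"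
      using e assms by (intro mult_mono const_powr_ge powr_mono) auto
    also have "N powr (2 * e) = (N * N) powr e"
      using N by (simp only: powr_mult powr_add[symmetric] mult_2)
    also have "16 powr e * (N * N) powr e = (16 * (N * N)) powr e"
      using assms by (simp add: powr_mult)
    also have "\<dots> \<le> P powr e" using P False by (intro powr_mono2') auto
    finally show "N powr (\<delta> - 1 + 4 * \<eta>) \<le> 256 * P powr e" by simp
  qed
qed

text \<open>Division by the modulation is worth L^(-2) off \<open>K\<close>, one power of L for each
  input frequency; comparing exponents leaves 5 \<eta> \<le> \<delta>.\<close>

lemma bound_high_out:
  assumes "1 \<le> N1" "1 \<le> N2" "N1 \<le> 2 * L" "N2 \<le> 2 * L"
  shows "L powr (\<delta> + \<eta> - 2) \<le> 64 * (N1 * N2) powr (\<delta> - 1 - 2 * \<eta>)"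
proof -
  have P: "1 \<le> N1 * N2" "N1 * N2 \<le> 4 * (L * L)"
    using mult_mono[OF assms(1,2)] mult_mono[OF assms(3,4)] assms by auto
  show ?thesis
  proof (cases "1 \<le> L")
    case True
    have L: "0 \<le> L" using True by simp
    define e where "e = \<delta> - 1 - 2 * \<eta>"
    have e: "- 2 \<le> e" "e \<le> 0" "\<delta> + \<eta> - 2 \<le> 2 * e" using \<delta> \<eta> by (auto simp: e_def)
    have "1 / 4\<^sup>2 * L powr (\<delta> + \<eta> - 2) \<le> 4 powr e * L powr (2 * e)"
      using e True by (intro mult_mono const_powr_ge powr_mono) auto
    also have "L powr (2 * e) = (L * L) powr e"
      using L by (simp only: powr_mult powr_add[symmetric] mult_2)
    also have "4 powr e * (L * L) powr e = (4 * (L * L)) powr e"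
      using True by (simp add: powr_mult)
    also have "\<dots> \<le> (N1 * N2) powr e" using P e by (intro powr_mono2') auto
    finally have "L powr (\<delta> + \<eta> - 2) \<le> 16 * (N1 * N2) powr e" by simp
    moreover have "0 \<le> (N1 * N2) powr e" by simp
    ultimately show ?thesis unfolding e_def by linarith
  next
    case False
    have "L powr (\<delta> + \<eta> - 2) \<le> (1/2) powr (\<delta> + \<eta> - 2)" using assms \<delta> \<eta> by (intro powr_mono2') auto
    also have "\<dots> \<le> 4"
    proof -
      define e where "e = 2 - \<delta> - \<eta>"
      have e: "e \<le> 2" "\<delta> + \<eta> - 2 = - e" using \<delta> \<eta>_pos by (auto simp: e_def)
      have "(1/2::real) powr (- e) = 2 powr e" by (simp add: powr_divide powr_minus)
      moreover have "(2::real) powr e \<le> 2 powr 2" using e by (intro powr_mono) auto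
      ultimately show ?thesis by (simp add: e)
    qed
    finally have 1: "L powr (\<delta> + \<eta> - 2) \<le> 4" .
    have "1 / 4\<^sup>2 \<le> 4 powr (\<delta> - 1 - 2 * \<eta>)" using \<delta> \<eta> by (intro const_powr_ge) auto
    also have "\<dots> \<le> (N1 * N2) powr (\<delta> - 1 - 2 * \<eta>)"
    proof (rule powr_mono2')
      have "L * L \<le> 1 * 1" using False assms by (intro mult_mono) auto
      then show "N1 * N2 \<le> 4" using P by linarith
    qed (use P \<delta> \<eta> in auto)
    finally show ?thesis using 1 by simp
  qed
qed

end

subsection \<open>Transfer to space-time functions\<close>

context exponents begin

definition inX :: "spacetime \<Rightarrow> real" where
  "inX p = freq p powr (\<delta> - 1) * modulation p powr (1/2)"

definition inY :: "spacetime \<Rightarrow> real" where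
  "inY p = psize p powr \<delta>"

text \<open>The output weight N^(\<delta> - 1) M^(1/2 + \<eta>) after the division by the modulation
  in \<open>bilin\<close>; see \<open>outX_eq\<close>.\<close>

definition out :: "spacetime \<Rightarrow> real" where
  "out p = freq p powr (\<delta> - 1) * modulation p powr (- 1/2 + \<eta>)"

lemma measurable_in_out [measurable]:
  "inX \<in> borel_measurable borel" "inY \<in> borel_measurable borel" "out \<in> borel_measurable borel"
  unfolding inX_def[abs_def] inY_def[abs_def] out_def[abs_def] by measurable

lemma in_out_nonneg [simp]: "0 \<le> inX p" "0 \<le> inY p" "0 \<le> out p"
  by (simp_all add: inX_def inY_def out_def)

lemma modulation_pos: "0 < modulation p"
  using modulation_ge_1[of p] by linarith

lemma out_eq: "out p = freq p powr (\<delta> - 1) * modulation p powr (2 * \<eta>) * Mw \<eta> p"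
  by (simp add: out_def Mw_def powr_add[symmetric])

lemma inX_Mw: "inX p * Mw \<eta> p = freq p powr (\<delta> - 1) * modulation p powr (- \<eta>)"
  by (simp add: inX_def Mw_def powr_add[symmetric])

lemma power2_powr: "0 < x \<Longrightarrow> (x ^ 2) powr a = x powr (2 * a)" for x a :: real
  by (simp add: powr_powr[symmetric])

lemma modulation_powr_le:
  assumes "modulation p \<le> R ^ 2" "0 < R" "0 \<le> a"
  shows "modulation p powr a \<le> R powr (2 * a)"
proof -
  have "modulation p powr a \<le> (R ^ 2) powr a" using assms modulation_pos[of p] by (intro powr_mono2) auto
  also have "\<dots> = R powr (2 * a)" using assms by (simp add: powr_powr[symmetric])
  finally show ?thesis .
qed

text \<open>The \<open>X\<close> norm provides M^(1/2) while the kernels consume M^(-1/2 - \<eta>).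
  In \<open>K\<close> the leftover M^(-\<eta>) is at least N^(-2 \<eta>), because M \<le>
  N^2.\<close>

lemma inX_Mw_ge:
  assumes "p \<in> K_set"
  shows "freq p powr (\<delta> - 1 - 2 * \<eta>) \<le> inX p * Mw \<eta> p"
proof -
  have f: "0 < freq p" by (rule bracket_pos)
  have "modulation p powr \<eta> \<le> freq p powr (2 * \<eta>)"
    using K_set_D[OF assms] modulation_pos[of p] f \<eta>_pos by (intro modulation_powr_le) auto
  then have "freq p powr (- (2 * \<eta>)) \<le> modulation p powr (- \<eta>)"
    using modulation_pos[of p] f unfolding powr_minus by (intro le_imp_inverse_le) auto
  then have "freq p powr (\<delta> - 1) * freq p powr (- (2 * \<eta>)) \<le> inX p * Mw \<eta> p"
    unfolding inX_Mw by (intro mult_left_mono) auto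
  then show ?thesis using f by (simp add: powr_add[symmetric])
qed

lemma modulation_high:
  assumes "p \<notin> K_set"
  shows "modulation p powr (- 1/2 + \<eta>) \<le> 130 * psize p powr (- 1 + 2 * \<eta>)"
proof -
  have l: "0 < psize p" by (rule bracket_pos)
  have "modulation p powr (- 1/2 + \<eta>) \<le> (psize p ^ 2 / 130) powr (- 1/2 + \<eta>)"
    using psize_le_modulation[OF assms] l \<delta> \<eta> by (intro powr_mono2') auto
  also have "\<dots> = psize p powr (- 1 + 2 * \<eta>) * 130 powr (1/2 - \<eta>)"
  proof -
    have "(psize p ^ 2) powr (- 1/2 + \<eta>) = psize p powr (2 * (- 1/2 + \<eta>))"
      by (rule power2_powr[OF l])
    also have "2 * (- 1/2 + \<eta>) = - 1 + 2 * \<eta>" by simp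
    finally have "(psize p ^ 2 / 130) powr (- 1/2 + \<eta>) = psize p powr (- 1 + 2 * \<eta>) / 130 powr (- (1/2 - \<eta>))"
      using l by (simp add: powr_divide)
    then show ?thesis by (simp only: divide_powr_uminus minus_minus)
  qed
  also have "\<dots> \<le> psize p powr (- 1 + 2 * \<eta>) * 130" using \<eta>_pos by (intro mult_left_mono const_powr_le) auto
  finally show ?thesis by (simp add: mult.commute)
qed

text \<open>The factor M^(-1/2 - \<eta>) is taken from the output; the surplus M^(2 \<eta>) that
  this creates is at most L^(4 \<eta>).\<close>

lemma kernel_low_low:
  "out (x + y) * wratio x y \<le>
    4096 * (Mw \<eta> (x + y) * Nw \<eta> (x + y) + Mw \<eta> (x + y) * Nw \<eta> x + Mw \<eta> (x + y) * Nw \<eta> y) * inY x * inY y"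
proof -
  let ?p = "x + y"
  have "freq ?p powr (\<delta> - 1) * modulation ?p powr (2 * \<eta>) \<le> freq ?p powr (\<delta> - 1) * psize ?p powr (2 * (2 * \<eta>))"
    using modulation_le_psize[of ?p] psize_ge_1[of ?p] \<eta>_pos by (intro mult_left_mono modulation_powr_le) auto
  also have "\<dots> \<le> 4 * (inY x * inY y * (freq ?p powr (- 1 - \<eta>) + freq x powr (- 1 - \<eta>) + freq y powr (- 1 - \<eta>)))"
  proof -
    have eq: "2 * (2 * \<eta>) = 4 * \<eta>" by simp
    show ?thesis unfolding inY_def eq by (intro bound_low_low bracket_ge_1 freq_le_psize psize_add)
  qed
  finally have *: "freq ?p powr (\<delta> - 1) * modulation ?p powr (2 * \<eta>) * Mw \<eta> ?p \<le>
    4 * (inY x * inY y * (Nw \<eta> ?p + Nw \<eta> x + Nw \<eta> y)) * Mw \<eta> ?p"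
    unfolding Nw_def by (intro mult_right_mono) auto
  have "out ?p * wratio x y \<le> 4 * (inY x * inY y * (Nw \<eta> ?p + Nw \<eta> x + Nw \<eta> y)) * Mw \<eta> ?p * 1024"
    unfolding out_eq by (rule mult_mono[OF *]) (auto simp: wratio_le wratio_nonneg)
  then show ?thesis by (simp add: algebra_simps)
qed

text \<open>Off \<open>K\<close> the output modulation is at least L^2 / 130 and acts as the power
  L^(-1 + 2 \<eta>), so the decaying factor \<open>Mw\<close> has to come from the input in
  \<open>K\<close>.\<close>

lemma kernel_high_low_out:
  assumes x: "x \<in> K_set" and p: "x + y \<notin> K_set"
  shows "out (x + y) * wratio x y \<le> 130 * 3 ^ 11 * (Mw \<eta> x * Nw \<eta> (x + y) + Mw \<eta> x * Nw \<eta> y) * inX x * inY y"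
proof -
  let ?p = "x + y"
  have "out ?p \<le> freq ?p powr (\<delta> - 1) * (130 * psize ?p powr (- 1 + 2 * \<eta>))"
    unfolding out_def by (intro mult_left_mono modulation_high[OF p]) auto
  then have "out ?p * wratio x y \<le> freq ?p powr (\<delta> - 1) * (130 * psize ?p powr (- 1 + 2 * \<eta>)) * wratio x y"
    by (intro mult_right_mono wratio_nonneg)
  also have "\<dots> = 130 * (freq ?p powr (\<delta> - 1) * psize ?p powr (- 1 + 2 * \<eta>) * wratio x y)" by simp
  also have "\<dots> \<le> 130 * (3 ^ 11 * (freq x powr (\<delta> - 1 - 2 * \<eta>) * (psize y powr \<delta> * (freq ?p powr (- 1 - \<eta>) + freq y powr (- 1 - \<eta>)))))"
  proof (intro mult_left_mono bound_high_low_out bracket_ge_1 freq_le_psize wratio_nonneg wratio_le)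
    assume "4 * psize ?p < freq x"
    then show "wratio x y \<le> 3 ^ 10 * (psize ?p / freq x)\<^sup>2 \<and> freq x \<le> 2 * psize y"
      using wratio_high_low[OF x] high_low(2)[OF x] by blast
  qed simp
  also have "\<dots> \<le> 130 * (3 ^ 11 * ((inX x * Mw \<eta> x) * (inY y * (Nw \<eta> ?p + Nw \<eta> y))))"
    unfolding Nw_def inY_def by (intro mult_left_mono mult_right_mono inX_Mw_ge[OF x]) auto
  finally show ?thesis by (simp add: algebra_simps)
qed

lemma out_le:
  assumes "p \<in> K_set"
  shows "out p \<le> freq p powr (\<delta> - 1 + 4 * \<eta>) * Mw \<eta> p" "out p \<le> freq p powr (\<delta> - 1)"
proof -
  have f: "0 < freq p" by (rule bracket_pos)
  have "modulation p powr (2 * \<eta>) \<le> freq p powr (2 * (2 * \<eta>))"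
    using K_set_D[OF assms] modulation_pos[of p] f \<eta>_pos by (intro modulation_powr_le) auto
  then have "out p \<le> freq p powr (\<delta> - 1) * freq p powr (4 * \<eta>) * Mw \<eta> p"
    unfolding out_eq by (intro mult_right_mono mult_left_mono) auto
  then show "out p \<le> freq p powr (\<delta> - 1 + 4 * \<eta>) * Mw \<eta> p" by (simp only: powr_add)
  have "modulation p powr (- 1/2 + \<eta>) \<le> 1"
    using powr_mono[of "- 1/2 + \<eta>" 0 "modulation p"] modulation_ge_1[of p] modulation_pos[of p] \<eta>_small by simp
  then show "out p \<le> freq p powr (\<delta> - 1)" unfolding out_def by (intro mult_left_le) auto
qed

lemma inY_ge_1: "1 \<le> inY p"
  unfolding inY_def using psize_ge_1 \<delta> by (intro ge_one_powr_ge_zero) auto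

lemma inX_ge: "freq p powr (\<delta> - 1) \<le> inX p"
proof -
  have "1 \<le> modulation p powr (1/2)" using modulation_ge_1 by (intro ge_one_powr_ge_zero) auto
  then show ?thesis unfolding inX_def using mult_left_mono[of 1 "modulation p powr (1/2)" "freq p powr (\<delta> - 1)"] by simp
qed

text \<open>The factor 2 in the size condition absorbs the passage from the frequency of the sum to
  that of \<open>x\<close>.\<close>

definition low_kernel :: "spacetime \<Rightarrow> spacetime \<Rightarrow> real" where
  "low_kernel x y = freq x powr (1/8) * of_bool (4 \<le> freq x \<and> psize y \<le> 2 * freq x powr (1/8)) * Mw \<eta> (x + y)"

lemma low_kernel_nonneg: "0 \<le> low_kernel x y"
  by (simp add: low_kernel_def)

text \<open>Three regimes, one for each summand: an output much smaller than the frequency of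
  \<open>x\<close>, suppressed by N^(-20) from the weights; a \<open>y\<close> of size at least
  N^(1/8), which pays through \<open>inY y\<close>; and a very small \<open>y\<close>, where the
  strip count tolerates the factor N^(1/8).\<close>

lemma kernel_resonant:
  assumes x: "x \<in> K_set" and p: "x + y \<in> K_set"
  shows "out (x + y) * wratio x y \<le> 65536 * (Mw \<eta> x * Nw \<eta> x + Mw \<eta> x * Mw \<eta> (x + y) + low_kernel x y) * inX x * inY y"
proof -
  let ?p = "x + y" and ?k = "Mw \<eta> x * Nw \<eta> x + Mw \<eta> x * Mw \<eta> (x + y) + low_kernel x y"
  have f: "1 \<le> freq ?p" "1 \<le> freq x" by (rule bracket_ge_1)+
  have mono: "65536 * (k * inX x * inY y) \<le> 65536 * ?k * inX x * inY y" if "k \<le> ?k" for k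
  proof -
    have "65536 * (k * (inX x * inY y)) \<le> 65536 * (?k * (inX x * inY y))"
      using that by (intro mult_left_mono mult_right_mono) auto
    then show ?thesis by (simp only: mult.assoc)
  qed
  show ?thesis
  proof (cases "4 * psize ?p < freq x")
    case True
    have "out ?p * wratio x y \<le> freq ?p powr (\<delta> - 1) * wratio x y"
      by (intro mult_right_mono out_le p wratio_nonneg)
    also have "\<dots> \<le> 3 ^ 10 * (freq x powr (\<delta> - 1 - 2 * \<eta>) * freq x powr (- 1 - \<eta>))"
      by (intro bound_resonant_far f wratio_nonneg wratio_high_low_K x True p)
    also have "\<dots> \<le> 65536 * ((inX x * Mw \<eta> x) * Nw \<eta> x)"
      unfolding Nw_def by (intro mult_mono mult_right_mono inX_Mw_ge x) auto
    also have "\<dots> \<le> 65536 * ((inX x * Mw \<eta> x) * Nw \<eta> x * inY y)"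
      using mult_left_mono[OF inY_ge_1, of "inX x * Mw \<eta> x * Nw \<eta> x" y] by simp
    also have "\<dots> = 65536 * ((Mw \<eta> x * Nw \<eta> x) * inX x * inY y)" by (simp only: ac_simps)
    also have "\<dots> \<le> 65536 * ?k * inX x * inY y" by (rule mono) (simp add: low_kernel_nonneg)
    finally show ?thesis .
  next
    case False
    then have x8: "freq x \<le> 8 * freq ?p" using K_set_time(3)[OF p] by linarith
    show ?thesis
    proof (cases "freq ?p powr (1/8) \<le> psize y")
      case True
      have "out ?p \<le> freq ?p powr (\<delta> - 1 + 4 * \<eta>) * Mw \<eta> ?p" by (rule out_le[OF p])
      also have "\<dots> \<le> 64 * (freq x powr (\<delta> - 1 - 2 * \<eta>) * psize y powr \<delta>) * Mw \<eta> ?p"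
        by (intro mult_right_mono bound_resonant_near f x8 True) auto
      also have "\<dots> \<le> 64 * ((inX x * Mw \<eta> x) * inY y) * Mw \<eta> ?p"
        unfolding inY_def by (intro mult_right_mono mult_left_mono inX_Mw_ge x) auto
      finally have *: "out ?p \<le> 64 * ((inX x * Mw \<eta> x) * inY y) * Mw \<eta> ?p" .
      have "out ?p * wratio x y \<le> 64 * ((inX x * Mw \<eta> x) * inY y) * Mw \<eta> ?p * 1024"
        by (rule mult_mono[OF *]) (auto simp: wratio_le wratio_nonneg)
      also have "\<dots> = 65536 * ((Mw \<eta> x * Mw \<eta> ?p) * inX x * inY y)" by simp
      also have "\<dots> \<le> 65536 * ?k * inX x * inY y" by (rule mono) (simp add: low_kernel_nonneg)
      finally show ?thesis .
    next
      case False
      have N4: "4 \<le> freq ?p" by (rule K_set_D[OF p])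
      \<comment> \<open>For N \<ge> 4 the power N^(1/8) is at most N / 2, so \<open>y\<close> is a
        small perturbation and the frequencies of \<open>x\<close> and \<open>x + y\<close> are
        comparable.\<close>
      have "freq ?p powr (1/8) \<le> freq ?p powr (1/2)" using f by (intro powr_mono) auto
      also have "\<dots> = sqrt (freq ?p)" using f by (simp add: powr_half_sqrt)
      also have "\<dots> \<le> freq ?p / 2"
      proof (rule real_le_lsqrt)
        have "4 * freq ?p \<le> freq ?p * freq ?p" using N4 by (intro mult_right_mono) auto
        then show "freq ?p \<le> (freq ?p / 2)\<^sup>2" by (simp add: power2_eq_square)
      qed (use f in auto)
      finally have "psize y \<le> freq ?p / 2" using False by linarith
      then have le4: "freq ?p \<le> 4 * freq x"
        using freq_le_psize[of ?p] psize_add[of x y] K_set_time(3)[OF x] by linarith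
      have "psize y \<le> freq ?p powr (1/8)" using False by simp
      also have "\<dots> \<le> (4 * freq x) powr (1/8)" using le4 f by (intro powr_mono2) auto
      also have "\<dots> = 4 powr (1/8) * freq x powr (1/8)" using f by (simp add: powr_mult)
      also have "\<dots> \<le> 2 * freq x powr (1/8)"
        using powr_mono[of "1/8" "1/2" 4] by (intro mult_right_mono) (auto simp: powr_half_sqrt)
      finally have "low_kernel x y = freq x powr (1/8) * Mw \<eta> ?p"
        using K_set_D(1)[OF x] by (simp add: low_kernel_def)
      have "out ?p \<le> freq ?p powr (\<delta> - 1 + 4 * \<eta>) * Mw \<eta> ?p" by (rule out_le[OF p])
      also have "\<dots> \<le> 32 * (freq x powr (\<delta> - 1) * freq x powr (1/8)) * Mw \<eta> ?p"
        by (intro mult_right_mono bound_resonant_low f x8 le4) auto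
      also have "\<dots> = 32 * (freq x powr (\<delta> - 1) * low_kernel x y)"
        by (simp add: \<open>low_kernel x y = _\<close>)
      also have "\<dots> \<le> 32 * (inX x * low_kernel x y)"
        by (intro mult_left_mono mult_right_mono inX_ge low_kernel_nonneg) auto
      also have "\<dots> \<le> 32 * (inX x * low_kernel x y * inY y)"
        using mult_left_mono[OF inY_ge_1, of "inX x * low_kernel x y" y] by (simp add: low_kernel_nonneg)
      finally have *: "out ?p \<le> 32 * (inX x * low_kernel x y * inY y)" .
      have "out ?p * wratio x y \<le> 32 * (inX x * low_kernel x y * inY y) * 1024"
        by (rule mult_mono[OF *]) (auto simp: wratio_le wratio_nonneg low_kernel_nonneg)
      also have "\<dots> \<le> 65536 * (low_kernel x y * inX x * inY y)"
        by (simp add: mult_ac low_kernel_nonneg)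
      also have "\<dots> \<le> 65536 * ?k * inX x * inY y" by (rule mono) simp
      finally show ?thesis .
    qed
  qed
qed

lemma freq_add_le: "freq (x + y) \<le> 2 * (freq x * freq y)"
proof -
  have f: "1 \<le> freq x" "1 \<le> freq y" by (rule bracket_ge_1)+
  have "freq (x + y) \<le> freq x + freq y"
    using norm_triangle_ineq[of "fst x" "fst y"] by (simp add: bracket_def)
  also have "\<dots> \<le> freq x * freq y + freq x * freq y"
    using mult_left_mono[OF f(2), of "freq x"] mult_right_mono[OF f(1), of "freq y"] f by (intro add_mono) auto
  finally show ?thesis by simp
qed

text \<open>Times in \<open>K\<close> are positive and add without cancellation, so both input
  frequencies are bounded by 4 times that of the output. Splitting the exponent of
  \<open>bound_transversal\<close> then yields the two input weights and the powers 1/2 - \<eta> of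
  the transversal kernel.\<close>

lemma kernel_transversal:
  assumes x: "x \<in> K_set" and y: "y \<in> K_set" and p: "x + y \<in> K_set"
  shows "out (x + y) * wratio x y \<le> 262144 * (of_bool (4 \<le> freq x \<and> 4 \<le> freq y) * (Mw \<eta> x * Mw \<eta> y * Mw \<eta> (x + y)) *
    (freq x powr (1/2 - \<eta>) * freq y powr (1/2 - \<eta>))) * inX x * inX y"
proof -
  let ?p = "x + y"
  have f: "1 \<le> freq ?p" "1 \<le> freq x" "1 \<le> freq y" by (rule bracket_ge_1)+
  have le: "u \<le> 4 * freq ?p" if "7 / 16 * u ^ 2 \<le> snd ?p" for u
  proof (rule power2_le_imp_le)
    have "7 / 16 * u ^ 2 \<le> 17 / 8 * freq ?p ^ 2"
      using that K_set_time(2)[OF p] zero_le_power2[of "norm (fst ?p)"] abs_ge_self[of "snd ?p"] by linarith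
    moreover have "(4 * freq ?p)\<^sup>2 = 16 * freq ?p ^ 2" by (simp add: power_mult_distrib)
    ultimately show "u\<^sup>2 \<le> (4 * freq ?p)\<^sup>2" using zero_le_power2[of "freq ?p"] by linarith
  qed (use f in simp)
  have "7 / 16 * freq x ^ 2 \<le> snd ?p" "7 / 16 * freq y ^ 2 \<le> snd ?p"
    unfolding snd_add
    using K_set_time(1)[OF x] K_set_time(1)[OF y] zero_le_power2[of "freq x"] zero_le_power2[of "freq y"] by linarith+
  then have lx: "freq x \<le> 4 * freq ?p" and ly: "freq y \<le> 4 * freq ?p" using le by blast+
  have "(freq x * freq y) powr (\<delta> - 1/2 - 3 * \<eta>) =
    freq x powr (\<delta> - 1 - 2 * \<eta> + (1/2 - \<eta>)) * freq y powr (\<delta> - 1 - 2 * \<eta> + (1/2 - \<eta>))"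
    using f by (simp add: powr_mult algebra_simps)
  also have "\<dots> = (freq x powr (\<delta> - 1 - 2 * \<eta>) * freq y powr (\<delta> - 1 - 2 * \<eta>)) * (freq x powr (1/2 - \<eta>) * freq y powr (1/2 - \<eta>))"
    by (simp only: powr_add ac_simps)
  also have "\<dots> \<le> ((inX x * Mw \<eta> x) * (inX y * Mw \<eta> y)) * (freq x powr (1/2 - \<eta>) * freq y powr (1/2 - \<eta>))"
    by (intro mult_right_mono mult_mono inX_Mw_ge x y) auto
  finally have 1: "(freq x * freq y) powr (\<delta> - 1/2 - 3 * \<eta>) \<le>
    ((inX x * Mw \<eta> x) * (inX y * Mw \<eta> y)) * (freq x powr (1/2 - \<eta>) * freq y powr (1/2 - \<eta>))" .
  have "out ?p \<le> freq ?p powr (\<delta> - 1 + 4 * \<eta>) * Mw \<eta> ?p" by (rule out_le[OF p])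
  also have "\<dots> \<le> (256 * (freq x * freq y) powr (\<delta> - 1/2 - 3 * \<eta>)) * Mw \<eta> ?p"
    by (intro mult_right_mono bound_transversal f lx ly freq_add_le) auto
  also have "\<dots> \<le> 256 * (((inX x * Mw \<eta> x) * (inX y * Mw \<eta> y)) * (freq x powr (1/2 - \<eta>) * freq y powr (1/2 - \<eta>))) * Mw \<eta> ?p"
    by (intro mult_right_mono mult_left_mono 1) auto
  finally have *: "out ?p \<le> 256 * (((inX x * Mw \<eta> x) * (inX y * Mw \<eta> y)) * (freq x powr (1/2 - \<eta>) * freq y powr (1/2 - \<eta>))) * Mw \<eta> ?p" .
  have "out ?p * wratio x y \<le> 256 * (((inX x * Mw \<eta> x) * (inX y * Mw \<eta> y)) * (freq x powr (1/2 - \<eta>) * freq y powr (1/2 - \<eta>))) * Mw \<eta> ?p * 1024"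
    by (rule mult_mono[OF *]) (auto simp: wratio_le wratio_nonneg)
  then show ?thesis using K_set_D(1)[OF x] K_set_D(1)[OF y] by (simp add: mult_ac)
qed

text \<open>Positive times bound both input frequencies by 2 L, and off \<open>K\<close> dividing by
  the modulation is worth L^(-2). In the second bound N^(\<delta> - 1) is split as N^(-1 - \<eta>)
  N^(\<delta> + \<eta>), which leaves a square integrable factor of the output frequency. The
  constant: 64 * 130 * 1024 < 2^24.\<close>

lemma kernel_high_out:
  assumes x: "x \<in> K_set" and y: "y \<in> K_set" and p: "x + y \<notin> K_set"
  shows "psize (x + y) powr \<delta> / modulation (x + y) * wratio x y \<le> 2 ^ 24 * (Mw \<eta> x * Mw \<eta> y) * inX x * inX y"
    and "freq (x + y) powr (\<delta> - 1) / modulation (x + y) * wratio x y \<le> 2 ^ 24 * Nw \<eta> (x + y) * (inX x * Mw \<eta> x) * (inX y * Mw \<eta> y)"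
proof -
  let ?p = "x + y"
  have f: "1 \<le> freq ?p" "1 \<le> freq x" "1 \<le> freq y" by (rule bracket_ge_1)+
  have l: "1 \<le> psize ?p" by (rule psize_ge_1)
  have le: "u \<le> 2 * psize ?p" if "7 / 16 * u ^ 2 \<le> snd ?p" for u
  proof (rule power2_le_imp_le)
    have "7 / 16 * u ^ 2 \<le> psize ?p ^ 2"
      using that psize_power2(1)[of ?p] zero_le_power2[of "norm (fst ?p)"] abs_ge_self[of "snd ?p"] by linarith
    moreover have "(2 * psize ?p)\<^sup>2 = 4 * psize ?p ^ 2" by (simp add: power_mult_distrib)
    ultimately show "u\<^sup>2 \<le> (2 * psize ?p)\<^sup>2" using zero_le_power2[of "psize ?p"] by linarith
  qed (use l in simp)
  have "7 / 16 * freq x ^ 2 \<le> snd ?p" "7 / 16 * freq y ^ 2 \<le> snd ?p"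
    unfolding snd_add
    using K_set_time(1)[OF x] K_set_time(1)[OF y] zero_le_power2[of "freq x"] zero_le_power2[of "freq y"] by linarith+
  then have lx: "freq x \<le> 2 * psize ?p" and ly: "freq y \<le> 2 * psize ?p" using le by blast+
  have "psize ?p powr (\<delta> + \<eta> - 2) \<le> 64 * (freq x * freq y) powr (\<delta> - 1 - 2 * \<eta>)"
    by (intro bound_high_out f lx ly)
  also have "\<dots> = 64 * (freq x powr (\<delta> - 1 - 2 * \<eta>) * freq y powr (\<delta> - 1 - 2 * \<eta>))"
    using f by (simp add: powr_mult)
  also have "\<dots> \<le> 64 * ((inX x * Mw \<eta> x) * (inX y * Mw \<eta> y))"
    by (intro mult_left_mono mult_mono inX_Mw_ge x y) auto
  finally have 1: "psize ?p powr (\<delta> + \<eta> - 2) \<le> 64 * ((inX x * Mw \<eta> x) * (inX y * Mw \<eta> y))" .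
  have 2: "1 / modulation ?p \<le> 130 * psize ?p powr (- 2)"
    using psize_le_modulation[OF p] modulation_pos[of ?p] l by (simp add: powr_minus_divide field_simps)
  have 3: "u * psize ?p powr (- 2) * (130 * 1024) \<le> 2 ^ 24 * v"
    if "u * psize ?p powr (- 2) \<le> 64 * v" "0 \<le> v" for u v
    using that by simp
  have "psize ?p powr \<delta> / modulation ?p * wratio x y = psize ?p powr \<delta> * (1 / modulation ?p) * wratio x y" by simp
  also have "\<dots> \<le> psize ?p powr \<delta> * (130 * psize ?p powr (- 2)) * 1024"
    using 2 wratio_le wratio_nonneg modulation_pos[of ?p] by (intro mult_mono) auto
  also have "\<dots> = psize ?p powr \<delta> * psize ?p powr (- 2) * (130 * 1024)" by simp
  also have "\<dots> \<le> 2 ^ 24 * ((inX x * Mw \<eta> x) * (inX y * Mw \<eta> y))"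
  proof (rule 3)
    have "psize ?p powr \<delta> * psize ?p powr (- 2) \<le> psize ?p powr (\<delta> + \<eta> - 2)"
      unfolding powr_add[symmetric] using l \<eta>_pos by (intro powr_mono) auto
    then show "psize ?p powr \<delta> * psize ?p powr (- 2) \<le> 64 * ((inX x * Mw \<eta> x) * (inX y * Mw \<eta> y))" using 1 by linarith
  qed simp
  finally show "psize ?p powr \<delta> / modulation ?p * wratio x y \<le> 2 ^ 24 * (Mw \<eta> x * Mw \<eta> y) * inX x * inX y"
    by (simp add: mult_ac)
  have "freq ?p powr (\<delta> - 1) / modulation ?p * wratio x y = freq ?p powr (\<delta> - 1) * (1 / modulation ?p) * wratio x y" by simp
  also have "\<dots> \<le> freq ?p powr (\<delta> - 1) * (130 * psize ?p powr (- 2)) * 1024"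
    using 2 wratio_le wratio_nonneg modulation_pos[of ?p] by (intro mult_mono) auto
  also have "\<dots> = freq ?p powr (\<delta> - 1) * psize ?p powr (- 2) * (130 * 1024)" by simp
  also have "\<dots> \<le> 2 ^ 24 * (Nw \<eta> ?p * ((inX x * Mw \<eta> x) * (inX y * Mw \<eta> y)))"
  proof (rule 3)
    have "freq ?p powr (\<delta> - 1) = Nw \<eta> ?p * freq ?p powr (\<delta> + \<eta>)" by (simp add: Nw_def powr_add[symmetric])
    also have "\<dots> \<le> Nw \<eta> ?p * psize ?p powr (\<delta> + \<eta>)"
      using f freq_le_psize[of ?p] \<delta> \<eta>_pos by (intro mult_left_mono powr_mono2) auto
    finally have "freq ?p powr (\<delta> - 1) * psize ?p powr (- 2) \<le> Nw \<eta> ?p * psize ?p powr (\<delta> + \<eta>) * psize ?p powr (- 2)"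
      by (intro mult_right_mono) auto
    also have "\<dots> = Nw \<eta> ?p * psize ?p powr (\<delta> + \<eta> - 2)" by (simp add: powr_add[symmetric] mult.assoc)
    also have "\<dots> \<le> Nw \<eta> ?p * (64 * ((inX x * Mw \<eta> x) * (inX y * Mw \<eta> y)))" by (intro mult_left_mono 1) auto
    finally show "freq ?p powr (\<delta> - 1) * psize ?p powr (- 2) \<le> 64 * (Nw \<eta> ?p * ((inX x * Mw \<eta> x) * (inX y * Mw \<eta> y)))"
      by (simp add: mult_ac)
  qed simp
  finally show "freq ?p powr (\<delta> - 1) / modulation ?p * wratio x y \<le> 2 ^ 24 * Nw \<eta> ?p * (inX x * Mw \<eta> x) * (inX y * Mw \<eta> y)"
    by (simp only: mult.assoc)
qed

end

subsection \<open>The norms as weighted L2 norms\<close>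

lemma nn_integral_swap:
  fixes f :: "'a::euclidean_space \<Rightarrow> 'b::euclidean_space \<Rightarrow> ennreal"
  assumes "(\<lambda>z. f (fst z) (snd z)) \<in> borel_measurable borel"
  shows "(\<integral>\<^sup>+ x. \<integral>\<^sup>+ y. f x y \<partial>lborel \<partial>lborel) = (\<integral>\<^sup>+ y. \<integral>\<^sup>+ x. f x y \<partial>lborel \<partial>lborel)"
  by (rule lborel_pair.Fubini'[symmetric]) (use assms in \<open>simp add: lborel_prod case_prod_unfold\<close>)

lemma measurable_nn_integral_param:
  fixes f :: "'a::euclidean_space \<Rightarrow> 'b::euclidean_space \<Rightarrow> ennreal"
  assumes "(\<lambda>z. f (fst z) (snd z)) \<in> borel_measurable borel"
  shows "(\<lambda>x. \<integral>\<^sup>+ y. f x y \<partial>lborel) \<in> borel_measurable borel"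
  using lborel.borel_measurable_nn_integral_fst[of "\<lambda>z. f (fst z) (snd z)" lborel] assms
  by (simp add: lborel_prod)

lemma measurable_time_l2:
  fixes F :: "spacetime \<Rightarrow> ennreal"
  assumes [measurable]: "F \<in> borel_measurable borel"
  shows "(\<lambda>\<xi>. esqrt (\<integral>\<^sup>+ \<tau>. F (\<xi>, \<tau>) ^ 2 \<partial>lborel)) \<in> borel_measurable borel"
  by (rule measurable_compose[OF measurable_nn_integral_param measurable_esqrt]) measurable

lemma epowr_1: "epowr x 1 = x"
  by (cases x) (auto simp: epowr_def)

lemma L2Lp_norm_2:
  assumes [measurable]: "f \<in> borel_measurable borel"
  shows "L2Lp_norm 2 f = l2 (\<lambda>p. ennreal \<bar>f p\<bar>)"
  unfolding L2Lp_norm_def Lp_norm_def epowr_2 esqrt_power2 l2_def by (subst nn_integral_spacetime) auto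

lemma L2Lp_norm_1:
  "L2Lp_norm 1 f = l2 (\<lambda>\<xi>. \<integral>\<^sup>+ \<tau>. ennreal \<bar>f (\<xi>, \<tau>)\<bar> \<partial>lborel)"
  unfolding L2Lp_norm_def Lp_norm_def epowr_2 l2_def by (simp add: epowr_1)

lemma dyadic_unique:
  fixes x :: real
  assumes "2 ^ m \<le> x" "x < 2 ^ (m + 1)" "2 ^ n \<le> x" "x < 2 ^ (n + 1)"
  shows "m = n"
proof (rule ccontr)
  assume "m \<noteq> n"
  then consider "m + 1 \<le> n" | "n + 1 \<le> m" by linarith
  then show False
  proof cases
    case 1 then have "(2::real) ^ (m + 1) \<le> 2 ^ n" by (intro power_increasing) auto
    then show False using assms by linarith
  next
    case 2 then have "(2::real) ^ (n + 1) \<le> 2 ^ m" by (intro power_increasing) auto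
    then show False using assms by linarith
  qed
qed

lemma dyadic_partition:
  "(\<Sum>j. \<Sum>d. indicator (A_set j \<inter> B_set d) p) = (1 :: ennreal)"
proof -
  obtain j where j: "p \<in> A_set j" using ex_dyadic[OF bracket_ge_1[of "fst p"]] by (auto simp: A_set_iff)
  obtain d where d: "p \<in> B_set d" using ex_dyadic[OF modulation_ge_1[of p]] by (auto simp: B_set_iff)
  have "p \<in> A_set j' \<longleftrightarrow> j' = j" for j' using j dyadic_unique by (auto simp: A_set_iff)
  moreover have "p \<in> B_set d' \<longleftrightarrow> d' = d" for d' using d dyadic_unique by (auto simp: B_set_iff)
  ultimately have eq: "(indicator (A_set j' \<inter> B_set d') p :: ennreal) = (if d' = d then if j' = j then 1 else 0 else 0)" for j' d'
    by (auto simp: indicator_def)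
  have "(\<Sum>d'. if d' = d then c else 0) = (c::ennreal)" for d c
    by (subst suminf_finite[of "{d}"]) auto
  then show ?thesis unfolding eq by simp
qed

lemma nn_integral_dyadic_partition:
  fixes F :: "spacetime \<Rightarrow> ennreal"
  assumes [measurable]: "F \<in> borel_measurable borel"
  shows "(\<Sum>j. \<Sum>d. \<integral>\<^sup>+ p. F p * indicator (A_set j \<inter> B_set d) p \<partial>lborel) = (\<integral>\<^sup>+ p. F p \<partial>lborel)"
proof -
  have "(\<integral>\<^sup>+ p. F p \<partial>lborel) = (\<integral>\<^sup>+ p. (\<Sum>j. \<Sum>d. F p * indicator (A_set j \<inter> B_set d) p) \<partial>lborel)"
    by (simp add: dyadic_partition)
  also have "\<dots> = (\<Sum>j. \<integral>\<^sup>+ p. (\<Sum>d. F p * indicator (A_set j \<inter> B_set d) p) \<partial>lborel)"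
    by (rule nn_integral_suminf) measurable
  also have "\<dots> = (\<Sum>j. \<Sum>d. \<integral>\<^sup>+ p. F p * indicator (A_set j \<inter> B_set d) p \<partial>lborel)"
    by (subst nn_integral_suminf) auto
  finally show ?thesis by simp
qed

lemma measurable_restr [measurable]:
  assumes [measurable]: "S \<in> sets borel" "f \<in> borel_measurable borel"
  shows "restr S f \<in> borel_measurable borel"
  unfolding restr_def by measurable

lemma l2_restr_power2:
  assumes "f \<in> borel_measurable borel"
  shows "L2Lp_norm 2 (restr (A_set j \<inter> B_set d) f) ^ 2 = (\<integral>\<^sup>+ p. ennreal \<bar>f p\<bar> ^ 2 * indicator (A_set j \<inter> B_set d) p \<partial>lborel)"
proof -
  have "restr (A_set j \<inter> B_set d) f \<in> borel_measurable borel" using assms by measurable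
  then show ?thesis
    by (auto simp: L2Lp_norm_2 l2_power2 restr_def indicator_def intro!: nn_integral_cong)
qed

lemma suminf_power2_le: "(\<Sum>n. a n ^ 2) \<le> (\<Sum>n. a n :: ennreal) ^ 2"
proof -
  have "(\<Sum>n. a n ^ 2) \<le> (\<Sum>n. a n * (\<Sum>n. a n))"
    unfolding power2_eq_square
  proof (intro suminf_le mult_left_mono)
    fix n
    have "a n = sum a {n}" by simp
    also have "\<dots> \<le> (\<Sum>n. a n)" by (intro sum_le_suminf) auto
    finally show "a n \<le> (\<Sum>n. a n)" .
  qed auto
  then show ?thesis by (simp add: power2_eq_square)
qed

lemma suminf_Cauchy_Schwarz: "(\<Sum>n. a n * b n :: ennreal) ^ 2 \<le> (\<Sum>n. a n ^ 2) * (\<Sum>n. b n ^ 2)"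
  using Cauchy_Schwarz_nn_integral[of a "count_space UNIV" b] by (simp add: nn_integral_count_space_nat)

context exponents begin

lemma X_norm_power2:
  "X_norm (\<delta> - 1) b f ^ 2 = (\<Sum>j. ennreal (2 powr (2 * (\<delta> - 1) * real j)) *
       (\<Sum>d. ennreal (2 powr (b * real d)) * L2Lp_norm 2 (restr (A_set j \<inter> B_set d) f))\<^sup>2)"
  unfolding X_norm_def esqrt_power2 ..

lemma ennreal_power2_mult: "0 \<le> a \<Longrightarrow> ennreal (a * x) ^ 2 = ennreal (a ^ 2) * ennreal x ^ 2"
  by (simp add: ennreal_mult' power_mult_distrib ennreal_power)

text \<open>The sum over \<open>d\<close> in the norm dominates the corresponding square sum, and on
  each dyadic piece \<open>inX\<close> is at most twice the dyadic weight.\<close>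

lemma l2_inX_le:
  assumes [measurable]: "f \<in> borel_measurable borel"
  shows "l2 (\<lambda>p. ennreal (inX p * \<bar>f p\<bar>)) \<le> ennreal 2 * X_norm (\<delta> - 1) (1/2) f"
proof (rule power2_le_imp_le_ennreal)
  have pt: "ennreal (inX p * \<bar>f p\<bar>) ^ 2 * indicator (A_set j \<inter> B_set d) p \<le>
      4 * (ennreal (2 powr (2 * (\<delta> - 1) * real j)) * (ennreal (2 powr (1/2 * real d)) ^ 2 * (ennreal \<bar>f p\<bar> ^ 2 * indicator (A_set j \<inter> B_set d) p)))"
    for p j d
  proof (cases "p \<in> A_set j \<inter> B_set d")
    case True
    then have j: "2 ^ j \<le> freq p" and d: "modulation p \<le> 2 ^ (d + 1)" by (auto simp: A_set_iff B_set_iff)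
    have *: "freq p powr (\<delta> - 1) \<le> (2 ^ j) powr (\<delta> - 1)" using j \<delta> by (intro powr_mono2') auto
    have "inX p \<le> (2 ^ j) powr (\<delta> - 1) * (2 ^ (d + 1)) powr (1/2)"
      unfolding inX_def using d modulation_pos[of p] by (intro mult_mono[OF *] powr_mono2) auto
    then have "(inX p)\<^sup>2 \<le> ((2 ^ j) powr (\<delta> - 1) * (2 ^ (d + 1)) powr (1/2))\<^sup>2" by (intro power_mono) auto
    also have "\<dots> = 2 * (2 powr (2 * (\<delta> - 1) * real j) * (2 powr (1/2 * real d))\<^sup>2)"
    proof -
      have "((2::real) ^ j) powr (\<delta> - 1) = 2 powr ((\<delta> - 1) * real j)"
        by (simp add: powr_realpow[symmetric] powr_powr mult.commute)
      moreover have "((2::real) ^ (d + 1)) powr (1/2) = sqrt 2 * 2 powr (1/2 * real d)"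
        by (simp add: powr_half_sqrt real_sqrt_mult sqrt_2_power)
      moreover have "(2 powr ((\<delta> - 1) * real j))\<^sup>2 = (2::real) powr (2 * (\<delta> - 1) * real j)"
        unfolding power2_eq_square powr_add[symmetric] by (simp add: algebra_simps)
      ultimately show ?thesis by (simp add: power_mult_distrib)
    qed
    also have "\<dots> \<le> 4 * (2 powr (2 * (\<delta> - 1) * real j) * (2 powr (1/2 * real d))\<^sup>2)" by simp
    finally have "(inX p)\<^sup>2 \<le> 4 * (2 powr (2 * (\<delta> - 1) * real j) * (2 powr (1/2 * real d))\<^sup>2)" .
    then have "ennreal ((inX p)\<^sup>2) \<le> ennreal (4 * (2 powr (2 * (\<delta> - 1) * real j) * (2 powr (1/2 * real d))\<^sup>2))" by (rule ennreal_leI)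
    also have "\<dots> = 4 * (ennreal (2 powr (2 * (\<delta> - 1) * real j)) * ennreal (2 powr (1/2 * real d)) ^ 2)"
      by (simp add: ennreal_mult' ennreal_power)
    finally have "ennreal ((inX p)\<^sup>2) * ennreal \<bar>f p\<bar> ^ 2 \<le> 4 * (ennreal (2 powr (2 * (\<delta> - 1) * real j)) * ennreal (2 powr (1/2 * real d)) ^ 2) * ennreal \<bar>f p\<bar> ^ 2"
      by (rule mult_right_mono) simp
    then show ?thesis using True by (simp add: ennreal_power2_mult mult.assoc)
  qed simp
  have "l2 (\<lambda>p. ennreal (inX p * \<bar>f p\<bar>)) ^ 2 = (\<Sum>j. \<Sum>d. \<integral>\<^sup>+ p. ennreal (inX p * \<bar>f p\<bar>) ^ 2 * indicator (A_set j \<inter> B_set d) p \<partial>lborel)"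
    unfolding l2_power2 by (rule nn_integral_dyadic_partition[symmetric]) measurable
  also have "\<dots> \<le> (\<Sum>j. \<Sum>d. \<integral>\<^sup>+ p. 4 * (ennreal (2 powr (2 * (\<delta> - 1) * real j)) * (ennreal (2 powr (1/2 * real d)) ^ 2 * (ennreal \<bar>f p\<bar> ^ 2 * indicator (A_set j \<inter> B_set d) p))) \<partial>lborel)"
    by (intro suminf_le nn_integral_mono pt) auto
  also have "\<dots> = (\<Sum>j. \<Sum>d. 4 * (ennreal (2 powr (2 * (\<delta> - 1) * real j)) * (ennreal (2 powr (1/2 * real d)) * L2Lp_norm 2 (restr (A_set j \<inter> B_set d) f)) ^ 2))"
    unfolding power_mult_distrib l2_restr_power2[OF assms] by (simp add: nn_integral_cmult)
  also have "\<dots> = 4 * (\<Sum>j. ennreal (2 powr (2 * (\<delta> - 1) * real j)) * (\<Sum>d. (ennreal (2 powr (1/2 * real d)) * L2Lp_norm 2 (restr (A_set j \<inter> B_set d) f)) ^ 2))"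
    by (simp only: ennreal_suminf_cmult)
  also have "\<dots> \<le> 4 * X_norm (\<delta> - 1) (1/2) f ^ 2"
    unfolding X_norm_power2 by (intro mult_left_mono suminf_le suminf_power2_le) auto
  also have "\<dots> = (ennreal 2 * X_norm (\<delta> - 1) (1/2) f) ^ 2"
    by (simp add: power_mult_distrib ennreal_power)
  finally show "l2 (\<lambda>p. ennreal (inX p * \<bar>f p\<bar>)) ^ 2 \<le> (ennreal 2 * X_norm (\<delta> - 1) (1/2) f) ^ 2" .
qed

lemma l2_inY_le: "g \<in> borel_measurable borel \<Longrightarrow> l2 (\<lambda>p. ennreal (inY p * \<bar>g p\<bar>)) \<le> Y_norm (\<delta> - 1) g"
proof -
  assume [measurable]: "g \<in> borel_measurable borel"
  have "l2 (\<lambda>p. ennreal (inY p * \<bar>g p\<bar>)) = L2Lp_norm 2 (\<lambda>p. psize p powr (\<delta> - 1 + 1) * g p)"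
    by (subst L2Lp_norm_2) (auto simp: inY_def abs_mult)
  then show ?thesis by (simp add: Y_norm_def)
qed

definition outX :: "spacetime \<Rightarrow> real" where
  "outX p = freq p powr (\<delta> - 1) * modulation p powr (1/2 + \<eta>)"

lemma measurable_outX [measurable]: "outX \<in> borel_measurable borel"
  unfolding outX_def[abs_def] by measurable

lemma outX_nonneg [simp]: "0 \<le> outX p"
  by (simp add: outX_def)

lemma outX_eq: "outX p = out p * modulation p"
proof -
  have "modulation p powr (1/2 + \<eta>) = modulation p powr (- 1/2 + \<eta>) * modulation p powr 1"
    unfolding powr_add[symmetric] by simp
  then show ?thesis using modulation_pos[of p] by (simp add: outX_def out_def)
qed

text \<open>The sum over \<open>d\<close> becomes a square sum by Cauchy-Schwarz against 2^(-\<eta>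
  d), which produces the extra M^\<eta> in the output weight.\<close>

lemma X_norm_le:
  "\<exists>C\<ge>0. \<forall>h\<in>borel_measurable borel. X_norm (\<delta> - 1) (1/2) h \<le> ennreal C * l2 (\<lambda>p. ennreal (outX p * \<bar>h p\<bar>))"
proof -
  define S where "S = (\<Sum>n. 2 powr (- (2 * \<eta>) * real n))"
  have sum: "summable (\<lambda>n. 2 powr (- (2 * \<eta>) * real n))" using \<eta>_pos by (intro summable_2_powr) auto
  have S: "0 \<le> S" unfolding S_def by (intro suminf_nonneg sum) auto
  have "X_norm (\<delta> - 1) (1/2) h \<le> ennreal (sqrt (4 * S)) * l2 (\<lambda>p. ennreal (outX p * \<bar>h p\<bar>))"
    if h [measurable]: "h \<in> borel_measurable borel" for h
  proof (rule power2_le_imp_le_ennreal)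
    let ?a = "\<lambda>j d. L2Lp_norm 2 (restr (A_set j \<inter> B_set d) h)"
    have pt: "ennreal (2 powr (2 * (\<delta> - 1) * real j)) * (ennreal (2 powr ((1/2 + \<eta>) * real d)) ^ 2 * (ennreal \<bar>h p\<bar> ^ 2 * indicator (A_set j \<inter> B_set d) p))
      \<le> 4 * (ennreal (outX p * \<bar>h p\<bar>) ^ 2 * indicator (A_set j \<inter> B_set d) p)" for p j d
    proof (cases "p \<in> A_set j \<inter> B_set d")
      case True
      then have j: "freq p \<le> 2 ^ (j + 1)" and d: "2 ^ d \<le> modulation p" by (auto simp: A_set_iff B_set_iff)
      have "2 powr ((\<delta> - 1) * real j) = 2 powr (1 - \<delta>) * 2 powr ((\<delta> - 1) * (real j + 1))"
        unfolding powr_add[symmetric] by (simp add: algebra_simps)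
      also have "\<dots> \<le> 2 * 2 powr ((\<delta> - 1) * (real j + 1))" using \<delta> by (intro mult_right_mono const_powr_le) auto
      also have "2 powr ((\<delta> - 1) * (real j + 1)) = (2 ^ (j + 1)) powr (\<delta> - 1)"
        by (simp only: powr_realpow[symmetric] powr_powr zero_less_numeral of_nat_add of_nat_1 mult.commute)
      also have "\<dots> \<le> freq p powr (\<delta> - 1)" using j bracket_pos[of "fst p"] \<delta> by (intro powr_mono2') auto
      finally have 1: "2 powr ((\<delta> - 1) * real j) \<le> 2 * freq p powr (\<delta> - 1)" by simp
      have "2 powr ((1/2 + \<eta>) * real d) = (2 ^ d) powr (1/2 + \<eta>)"
        by (simp only: powr_realpow[symmetric] powr_powr zero_less_numeral mult.commute)
      also have "\<dots> \<le> modulation p powr (1/2 + \<eta>)" using d \<eta>_pos by (intro powr_mono2) auto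
      finally have 2: "2 powr ((1/2 + \<eta>) * real d) \<le> modulation p powr (1/2 + \<eta>)" .
      have "2 powr ((\<delta> - 1) * real j) * 2 powr ((1/2 + \<eta>) * real d) \<le> 2 * outX p"
        using mult_mono[OF 1 2] by (simp add: outX_def)
      then have "(2 powr ((\<delta> - 1) * real j) * 2 powr ((1/2 + \<eta>) * real d))\<^sup>2 \<le> (2 * outX p)\<^sup>2"
        by (intro power_mono) auto
      moreover have "(2 powr ((\<delta> - 1) * real j))\<^sup>2 = (2::real) powr (2 * (\<delta> - 1) * real j)"
        unfolding power2_eq_square powr_add[symmetric] by (simp add: algebra_simps)
      ultimately have "2 powr (2 * (\<delta> - 1) * real j) * (2 powr ((1/2 + \<eta>) * real d))\<^sup>2 \<le> 4 * (outX p)\<^sup>2"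
        by (simp add: power_mult_distrib)
      then have "ennreal (2 powr (2 * (\<delta> - 1) * real j) * (2 powr ((1/2 + \<eta>) * real d))\<^sup>2) \<le> ennreal (4 * (outX p)\<^sup>2)" by (rule ennreal_leI)
      then have "ennreal (2 powr (2 * (\<delta> - 1) * real j)) * ennreal (2 powr ((1/2 + \<eta>) * real d)) ^ 2 \<le> 4 * ennreal ((outX p)\<^sup>2)"
        by (simp add: ennreal_mult' ennreal_power)
      from mult_right_mono[OF this, of "ennreal \<bar>h p\<bar> ^ 2"]
      show ?thesis using True by (simp add: ennreal_power2_mult mult.assoc)
    qed simp
    have CS: "(\<Sum>d. ennreal (2 powr (1/2 * real d)) * ?a j d) ^ 2 \<le> ennreal S * (\<Sum>d. ennreal (2 powr ((1/2 + \<eta>) * real d)) ^ 2 * ?a j d ^ 2)" for j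
    proof -
      have e: "ennreal (2 powr (1/2 * real d)) = ennreal (2 powr (- \<eta> * real d)) * ennreal (2 powr ((1/2 + \<eta>) * real d))" for d
        by (simp add: ennreal_mult[symmetric] powr_add[symmetric] algebra_simps)
      have "(\<Sum>d. ennreal (2 powr (1/2 * real d)) * ?a j d) ^ 2 = (\<Sum>d. ennreal (2 powr (- \<eta> * real d)) * (ennreal (2 powr ((1/2 + \<eta>) * real d)) * ?a j d)) ^ 2"
        unfolding e by (simp only: mult.assoc)
      also have "\<dots> \<le> (\<Sum>d. ennreal (2 powr (- \<eta> * real d)) ^ 2) * (\<Sum>d. (ennreal (2 powr ((1/2 + \<eta>) * real d)) * ?a j d) ^ 2)"
        by (rule suminf_Cauchy_Schwarz)
      also have "(\<Sum>d. ennreal (2 powr (- \<eta> * real d)) ^ 2) = ennreal S"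
      proof -
        have "(2 powr (- \<eta> * real d))\<^sup>2 = (2::real) powr (- (2 * \<eta>) * real d)" for d
          unfolding power2_eq_square powr_add[symmetric] by (simp add: algebra_simps)
        then show ?thesis unfolding S_def using sum by (simp add: ennreal_power suminf_ennreal2)
      qed
      finally show ?thesis by (simp only: power_mult_distrib)
    qed
    have "X_norm (\<delta> - 1) (1/2) h ^ 2 \<le> (\<Sum>j. ennreal (2 powr (2 * (\<delta> - 1) * real j)) * (ennreal S * (\<Sum>d. ennreal (2 powr ((1/2 + \<eta>) * real d)) ^ 2 * ?a j d ^ 2)))"
      unfolding X_norm_power2 by (intro suminf_le mult_left_mono CS) auto
    also have "\<dots> = (\<Sum>j. \<Sum>d. ennreal S * (ennreal (2 powr (2 * (\<delta> - 1) * real j)) * (ennreal (2 powr ((1/2 + \<eta>) * real d)) ^ 2 * ?a j d ^ 2)))"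
      by (simp add: ennreal_suminf_cmult[symmetric] mult_ac del: ennreal_suminf_cmult)
    also have "\<dots> = ennreal S * (\<Sum>j. \<Sum>d. ennreal (2 powr (2 * (\<delta> - 1) * real j)) * (ennreal (2 powr ((1/2 + \<eta>) * real d)) ^ 2 * ?a j d ^ 2))"
      by (simp only: ennreal_suminf_cmult)
    also have "\<dots> = ennreal S * (\<Sum>j. \<Sum>d. \<integral>\<^sup>+ p. ennreal (2 powr (2 * (\<delta> - 1) * real j)) * (ennreal (2 powr ((1/2 + \<eta>) * real d)) ^ 2 * (ennreal \<bar>h p\<bar> ^ 2 * indicator (A_set j \<inter> B_set d) p)) \<partial>lborel)"
      unfolding l2_restr_power2[OF h] by (simp add: nn_integral_cmult)
    also have "\<dots> \<le> ennreal S * (\<Sum>j. \<Sum>d. \<integral>\<^sup>+ p. 4 * (ennreal (outX p * \<bar>h p\<bar>) ^ 2 * indicator (A_set j \<inter> B_set d) p) \<partial>lborel)"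
      by (intro mult_left_mono suminf_le nn_integral_mono pt) auto
    also have "\<dots> = ennreal S * (4 * (\<Sum>j. \<Sum>d. \<integral>\<^sup>+ p. ennreal (outX p * \<bar>h p\<bar>) ^ 2 * indicator (A_set j \<inter> B_set d) p \<partial>lborel))"
      by (simp add: nn_integral_cmult)
    also have "\<dots> = ennreal S * (4 * l2 (\<lambda>p. ennreal (outX p * \<bar>h p\<bar>)) ^ 2)"
      unfolding l2_power2 by (subst nn_integral_dyadic_partition) auto
    also have "\<dots> = (ennreal (sqrt (4 * S)) * l2 (\<lambda>p. ennreal (outX p * \<bar>h p\<bar>))) ^ 2"
      using S by (simp add: power_mult_distrib ennreal_power ennreal_mult mult_ac)
    finally show "X_norm (\<delta> - 1) (1/2) h ^ 2 \<le> (ennreal (sqrt (4 * S)) * l2 (\<lambda>p. ennreal (outX p * \<bar>h p\<bar>))) ^ 2" .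
  qed
  then show ?thesis using S by (intro exI[of _ "sqrt (4 * S)"]) auto
qed

section \<open>Integration in time and Young's inequality in space\<close>

lemma powr_power2: "(u powr a)\<^sup>2 = u powr (2 * a)" for u a :: real
  by (simp only: power2_eq_square mult_2 powr_add)

lemma nn_integral_Mw_le: "\<exists>C\<ge>0. \<forall>\<xi>. (\<integral>\<^sup>+ \<tau>. ennreal (Mw \<eta> (\<xi>, \<tau>)) ^ 2 \<partial>lborel) \<le> ennreal C"
proof -
  obtain C where C: "0 \<le> C" "\<And>c::real. (\<integral>\<^sup>+ x. ennreal (bracket (x - c) powr - (1 + 2 * \<eta>)) \<partial>lborel) \<le> ennreal C"
    using nn_integral_bracket_powr[where 'a = real, of "1 + 2 * \<eta>"] \<eta>_pos by auto
  have "ennreal (Mw \<eta> (\<xi>, \<tau>)) ^ 2 = ennreal (bracket (\<tau> - (norm \<xi>)\<^sup>2) powr - (1 + 2 * \<eta>))" for \<xi> \<tau>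
    by (simp add: Mw_def modulation_eq ennreal_power powr_power2 algebra_simps)
  then show ?thesis using C by auto
qed

text \<open>\<open>Mw\<close> is square integrable in time uniformly in \<xi>, so slightly more than
  half a power of the modulation converts L2 in time into L1 in time.\<close>

lemma nn_integral_time_le:
  "\<exists>C\<ge>0. \<forall>F\<in>borel_measurable borel. \<forall>\<xi>.
    (\<integral>\<^sup>+ \<tau>. F (\<xi>, \<tau>) * ennreal (Mw \<eta> (\<xi>, \<tau>)) \<partial>lborel) \<le> ennreal C * esqrt (\<integral>\<^sup>+ \<tau>. F (\<xi>, \<tau>) ^ 2 \<partial>lborel)"
proof -
  obtain C where C: "0 \<le> C" "\<And>\<xi>. (\<integral>\<^sup>+ \<tau>. ennreal (Mw \<eta> (\<xi>, \<tau>)) ^ 2 \<partial>lborel) \<le> ennreal C"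
    using nn_integral_Mw_le by blast
  have "(\<integral>\<^sup>+ \<tau>. F (\<xi>, \<tau>) * ennreal (Mw \<eta> (\<xi>, \<tau>)) \<partial>lborel) \<le> ennreal (sqrt C) * esqrt (\<integral>\<^sup>+ \<tau>. F (\<xi>, \<tau>) ^ 2 \<partial>lborel)"
    if [measurable]: "F \<in> borel_measurable borel" for F :: "spacetime \<Rightarrow> ennreal" and \<xi>
  proof -
    have "(\<integral>\<^sup>+ \<tau>. F (\<xi>, \<tau>) * ennreal (Mw \<eta> (\<xi>, \<tau>)) \<partial>lborel) \<le>
      esqrt (\<integral>\<^sup>+ \<tau>. F (\<xi>, \<tau>) ^ 2 \<partial>lborel) * esqrt (\<integral>\<^sup>+ \<tau>. ennreal (Mw \<eta> (\<xi>, \<tau>)) ^ 2 \<partial>lborel)"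
      by (rule nn_integral_mult_le_esqrt) measurable
    also have "\<dots> \<le> esqrt (\<integral>\<^sup>+ \<tau>. F (\<xi>, \<tau>) ^ 2 \<partial>lborel) * ennreal (sqrt C)"
      using C by (intro mult_left_mono) (auto simp: esqrt_le_iff ennreal_power)
    finally show ?thesis by (simp add: mult.commute)
  qed
  then show ?thesis using C(1) by (intro exI[of _ "sqrt C"]) auto
qed

lemma l2_time: "F \<in> borel_measurable borel \<Longrightarrow> l2 (\<lambda>\<xi>. esqrt (\<integral>\<^sup>+ \<tau>. F (\<xi>, \<tau>) ^ 2 \<partial>lborel)) = l2 (F :: spacetime \<Rightarrow> ennreal)"
  unfolding l2_def esqrt_power2 by (subst nn_integral_spacetime) auto

lemma l2_cmult:
  assumes [measurable]: "F \<in> borel_measurable borel"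
  shows "l2 (\<lambda>x. c * F x) = c * l2 F"
  unfolding l2_def power_mult_distrib by (simp add: nn_integral_cmult esqrt_mult)

text \<open>Time is integrated first, which turns both inputs into functions of frequency alone,
  bounded by multiples of \<open>a\<close> and \<open>b\<close>. Their convolution is bounded
  uniformly by \<open>l2 a * l2 b\<close>, and the weight N^(-1 - \<eta>) lies in L2 of the
  plane.\<close>

lemma l2_space_convolution:
  "\<exists>C\<ge>0. \<forall>F\<in>borel_measurable borel. \<forall>G\<in>borel_measurable borel.
    l2 (\<lambda>\<xi>. \<integral>\<^sup>+ \<tau>. \<integral>\<^sup>+ q. ennreal (Nw \<eta> (\<xi>, \<tau>)) * (F q * ennreal (Mw \<eta> q)) * (G ((\<xi>, \<tau>) - q) * ennreal (Mw \<eta> ((\<xi>, \<tau>) - q))) \<partial>lborel \<partial>lborel)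
    \<le> ennreal C * (l2 F * l2 G)"
proof -
  obtain C1 where C1: "0 \<le> C1" "\<And>F \<xi>. F \<in> borel_measurable borel \<Longrightarrow>
    (\<integral>\<^sup>+ \<tau>. F (\<xi>, \<tau>) * ennreal (Mw \<eta> (\<xi>, \<tau>)) \<partial>lborel) \<le> ennreal C1 * esqrt (\<integral>\<^sup>+ \<tau>. F (\<xi>, \<tau>) ^ 2 \<partial>lborel)"
    using nn_integral_time_le by blast
  obtain C2 where C2: "0 \<le> C2" "\<And>c::real ^ 2. (\<integral>\<^sup>+ x. ennreal (bracket (x - c) powr - (2 + 2 * \<eta>)) \<partial>lborel) \<le> ennreal C2"
    using nn_integral_bracket_powr[where 'a = "real ^ 2", of "2 + 2 * \<eta>"] \<eta>_pos by auto
  define n where "n \<xi> = ennreal (bracket \<xi> powr (- 1 - \<eta>))" for \<xi> :: "real ^ 2"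
  have [measurable]: "n \<in> borel_measurable borel" unfolding n_def by measurable
  have n: "ennreal (Nw \<eta> (\<xi>, \<tau>)) = n \<xi>" for \<xi> \<tau> by (simp add: n_def Nw_def)
  have l2n: "l2 n \<le> ennreal (sqrt C2)"
  proof -
    have "l2 n ^ 2 = (\<integral>\<^sup>+ x. ennreal (bracket (x - (0::real ^ 2)) powr - (2 + 2 * \<eta>)) \<partial>lborel)"
      unfolding l2_power2 n_def
      by (intro nn_integral_cong) (simp add: ennreal_power powr_power2 algebra_simps)
    also have "\<dots> \<le> ennreal C2" by (rule C2)
    also have "\<dots> = ennreal (sqrt C2) ^ 2" using C2(1) by (simp add: ennreal_power)
    finally show ?thesis by (rule power2_le_imp_le_ennreal)
  qed
  have "l2 (\<lambda>\<xi>. \<integral>\<^sup>+ \<tau>. \<integral>\<^sup>+ q. ennreal (Nw \<eta> (\<xi>, \<tau>)) * (F q * ennreal (Mw \<eta> q)) * (G ((\<xi>, \<tau>) - q) * ennreal (Mw \<eta> ((\<xi>, \<tau>) - q))) \<partial>lborel \<partial>lborel)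
    \<le> ennreal (C1 * C1 * sqrt C2) * (l2 F * l2 G)"
    if F [measurable]: "F \<in> borel_measurable borel" and G [measurable]: "G \<in> borel_measurable borel" for F G
  proof -
    define F1 where "F1 q = F q * ennreal (Mw \<eta> q)" for q
    define G1 where "G1 q = G q * ennreal (Mw \<eta> q)" for q
    have [measurable]: "F1 \<in> borel_measurable borel" "G1 \<in> borel_measurable borel" unfolding F1_def G1_def by measurable
    define a where "a \<xi> = esqrt (\<integral>\<^sup>+ \<tau>. F (\<xi>, \<tau>) ^ 2 \<partial>lborel)" for \<xi> :: "real ^ 2"
    define b where "b \<xi> = esqrt (\<integral>\<^sup>+ \<tau>. G (\<xi>, \<tau>) ^ 2 \<partial>lborel)" for \<xi> :: "real ^ 2"
    have [measurable]: "a \<in> borel_measurable borel" "b \<in> borel_measurable borel" unfolding a_def b_def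
      by (rule measurable_time_l2[OF F], rule measurable_time_l2[OF G])
    have le: "(\<integral>\<^sup>+ \<tau>. \<integral>\<^sup>+ q. n \<xi> * F1 q * G1 ((\<xi>, \<tau>) - q) \<partial>lborel \<partial>lborel) \<le> ennreal (C1 * C1) * (l2 F * l2 G) * n \<xi>" for \<xi>
    proof -
      have "(\<integral>\<^sup>+ \<tau>. \<integral>\<^sup>+ q. n \<xi> * F1 q * G1 ((\<xi>, \<tau>) - q) \<partial>lborel \<partial>lborel) = (\<integral>\<^sup>+ q. \<integral>\<^sup>+ \<tau>. n \<xi> * F1 q * G1 ((\<xi>, \<tau>) - q) \<partial>lborel \<partial>lborel)"
        by (rule nn_integral_swap) measurable
      also have "\<dots> = (\<integral>\<^sup>+ q. n \<xi> * F1 q * (\<integral>\<^sup>+ \<tau>. G1 (\<xi> - fst q, \<tau>) \<partial>lborel) \<partial>lborel)"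
      proof (rule nn_integral_cong)
        fix q :: spacetime
        have "(\<integral>\<^sup>+ \<tau>. n \<xi> * F1 q * G1 ((\<xi>, \<tau>) - q) \<partial>lborel) = n \<xi> * F1 q * (\<integral>\<^sup>+ \<tau>. G1 (\<xi> - fst q, \<tau> - snd q) \<partial>lborel)"
          by (subst nn_integral_cmult[symmetric]) (auto simp: minus_prod_def)
        also have "(\<integral>\<^sup>+ \<tau>. G1 (\<xi> - fst q, \<tau> - snd q) \<partial>lborel) = (\<integral>\<^sup>+ \<tau>. G1 (\<xi> - fst q, \<tau>) \<partial>lborel)"
          using nn_integral_lborel_plus[of "\<lambda>\<tau>. G1 (\<xi> - fst q, \<tau>)" "- snd q"] by simp
        finally show "(\<integral>\<^sup>+ \<tau>. n \<xi> * F1 q * G1 ((\<xi>, \<tau>) - q) \<partial>lborel) = n \<xi> * F1 q * (\<integral>\<^sup>+ \<tau>. G1 (\<xi> - fst q, \<tau>) \<partial>lborel)" .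
      qed
      also have "\<dots> \<le> (\<integral>\<^sup>+ q. n \<xi> * F1 q * (ennreal C1 * b (\<xi> - fst q)) \<partial>lborel)"
        unfolding b_def G1_def by (intro nn_integral_mono mult_left_mono C1(2)) auto
      also have "\<dots> = (\<integral>\<^sup>+ \<zeta>. \<integral>\<^sup>+ \<tau>. n \<xi> * F1 (\<zeta>, \<tau>) * (ennreal C1 * b (\<xi> - \<zeta>)) \<partial>lborel \<partial>lborel)"
        by (subst nn_integral_spacetime) auto
      also have "\<dots> = (\<integral>\<^sup>+ \<zeta>. n \<xi> * ennreal C1 * b (\<xi> - \<zeta>) * (\<integral>\<^sup>+ \<tau>. F1 (\<zeta>, \<tau>) \<partial>lborel) \<partial>lborel)"
        by (intro nn_integral_cong, subst nn_integral_cmult[symmetric]) (auto simp: mult_ac)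
      also have "\<dots> \<le> (\<integral>\<^sup>+ \<zeta>. n \<xi> * ennreal C1 * b (\<xi> - \<zeta>) * (ennreal C1 * a \<zeta>) \<partial>lborel)"
        unfolding a_def F1_def by (intro nn_integral_mono mult_left_mono C1(2)) auto
      also have "\<dots> = (\<integral>\<^sup>+ \<zeta>. (n \<xi> * ennreal (C1 * C1)) * (a \<zeta> * b (\<xi> - \<zeta>)) \<partial>lborel)"
        using C1(1) by (simp add: ennreal_mult mult_ac)
      also have "\<dots> = n \<xi> * ennreal (C1 * C1) * (\<integral>\<^sup>+ \<zeta>. a \<zeta> * b (\<xi> - \<zeta>) \<partial>lborel)"
        by (rule nn_integral_cmult) measurable
      also have "\<dots> \<le> n \<xi> * ennreal (C1 * C1) * (l2 a * l2 (\<lambda>\<zeta>. b (\<xi> - \<zeta>)))"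
        by (intro mult_left_mono nn_integral_mult_le_l2) auto
      also have "l2 (\<lambda>\<zeta>. b (\<xi> - \<zeta>)) = l2 b"
        unfolding l2_def using nn_integral_lborel_diff[of "\<lambda>\<zeta>. b \<zeta> ^ 2" \<xi>] by simp
      also have "l2 a = l2 F" unfolding a_def by (rule l2_time[OF F])
      also have "l2 b = l2 G" unfolding b_def by (rule l2_time[OF G])
      finally show ?thesis by (simp add: mult_ac)
    qed
    have "l2 (\<lambda>\<xi>. \<integral>\<^sup>+ \<tau>. \<integral>\<^sup>+ q. n \<xi> * F1 q * G1 ((\<xi>, \<tau>) - q) \<partial>lborel \<partial>lborel) \<le> l2 (\<lambda>\<xi>. ennreal (C1 * C1) * (l2 F * l2 G) * n \<xi>)"
      by (intro l2_mono le)
    also have "\<dots> = ennreal (C1 * C1) * (l2 F * l2 G) * l2 n" by (rule l2_cmult) measurable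
    also have "\<dots> \<le> ennreal (C1 * C1) * (l2 F * l2 G) * ennreal (sqrt C2)" by (intro mult_left_mono l2n) auto
    also have "\<dots> = ennreal (C1 * C1 * sqrt C2) * (l2 F * l2 G)"
      using C1(1) C2(1) by (simp add: ennreal_mult mult_ac)
    finally show ?thesis unfolding n F1_def G1_def .
  qed
  then show ?thesis using C1(1) C2(1) by (intro exI[of _ "C1 * C1 * sqrt C2"]) auto
qed

lemma Y_norm_eq:
  assumes [measurable]: "h \<in> borel_measurable borel"
  shows "Y_norm (\<delta> - 1) h = l2 (\<lambda>\<xi>. \<integral>\<^sup>+ \<tau>. ennreal (freq (\<xi>, \<tau>) powr (\<delta> - 1) * \<bar>h (\<xi>, \<tau>)\<bar>) \<partial>lborel) + l2 (\<lambda>p. ennreal (psize p powr \<delta> * \<bar>h p\<bar>))"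
proof -
  have "L2Lp_norm 2 (\<lambda>p. psize p powr (\<delta> - 1 + 1) * h p) = l2 (\<lambda>p. ennreal (psize p powr \<delta> * \<bar>h p\<bar>))"
    by (subst L2Lp_norm_2) (auto simp: abs_mult)
  then show ?thesis by (simp add: Y_norm_def L2Lp_norm_1 abs_mult)
qed

text \<open>Off \<open>K\<close>, L is at most 12 M^(1/2) since 130 \<le> 12^2. One power of L is
  exchanged for this, and the remaining L^(\<delta> - 1) is at most N^(\<delta> - 1) because
  \<delta> < 1.\<close>

lemma inY_le_outX:
  assumes "p \<notin> K_set" shows "psize p powr \<delta> \<le> 12 * outX p"
proof -
  have l: "1 \<le> psize p" "0 < psize p" using psize_ge_1[of p] by auto
  have "psize p \<le> 12 * modulation p powr (1/2)"
  proof -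
    have "psize p = sqrt (psize p ^ 2)" using l by simp
    also have "\<dots> \<le> sqrt (12\<^sup>2 * modulation p)"
      using psize_le_modulation[OF assms] modulation_pos[of p] by (intro real_sqrt_le_mono) simp
    also have "\<dots> = 12 * modulation p powr (1/2)"
      using modulation_pos[of p] by (simp add: real_sqrt_mult powr_half_sqrt)
    finally show ?thesis .
  qed
  also have "\<dots> \<le> 12 * modulation p powr (1/2 + \<eta>)"
    using modulation_ge_1[of p] \<eta>_pos by (intro mult_left_mono powr_mono) auto
  finally have 1: "psize p \<le> 12 * modulation p powr (1/2 + \<eta>)" .
  have "psize p powr \<delta> = psize p powr (\<delta> - 1) * psize p powr 1" unfolding powr_add[symmetric] by simp
  also have "\<dots> \<le> freq p powr (\<delta> - 1) * (12 * modulation p powr (1/2 + \<eta>))"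
    using 1 l freq_le_psize[of p] bracket_pos[of "fst p"] \<delta> by (intro mult_mono powr_mono2') auto
  finally show ?thesis by (simp add: outX_def)
qed

text \<open>In the part with L1 in time, N^(\<delta> - 1) is the output weight times
  \<open>Mw\<close>, so Cauchy-Schwarz in time applies. The part weighted by the parabolic size uses
  the support off \<open>K\<close>.\<close>

lemma Y_norm_le:
  "\<exists>C\<ge>0. \<forall>h\<in>borel_measurable borel. (\<forall>p\<in>K_set. h p = 0) \<longrightarrow> Y_norm (\<delta> - 1) h \<le> ennreal C * l2 (\<lambda>p. ennreal (outX p * \<bar>h p\<bar>))"
proof -
  obtain C where C: "0 \<le> C" "\<And>F \<xi>. F \<in> borel_measurable borel \<Longrightarrow>
    (\<integral>\<^sup>+ \<tau>. F (\<xi>, \<tau>) * ennreal (Mw \<eta> (\<xi>, \<tau>)) \<partial>lborel) \<le> ennreal C * esqrt (\<integral>\<^sup>+ \<tau>. F (\<xi>, \<tau>) ^ 2 \<partial>lborel)"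
    using nn_integral_time_le by blast
  have "Y_norm (\<delta> - 1) h \<le> ennreal (C + 12) * l2 (\<lambda>p. ennreal (outX p * \<bar>h p\<bar>))"
    if h [measurable]: "h \<in> borel_measurable borel" and 0: "\<forall>p\<in>K_set. h p = 0" for h
  proof -
    define H where "H p = ennreal (outX p * \<bar>h p\<bar>)" for p
    have [measurable]: "H \<in> borel_measurable borel" unfolding H_def by measurable
    have "freq p powr (\<delta> - 1) = outX p * Mw \<eta> p" for p
    proof -
      have "outX p * Mw \<eta> p = freq p powr (\<delta> - 1) * modulation p powr ((1/2 + \<eta>) + (- 1/2 - \<eta>))"
        unfolding outX_def Mw_def powr_add by (simp only: mult.assoc)
      then show ?thesis using modulation_pos[of p] by simp
    qed
    then have "ennreal (freq p powr (\<delta> - 1) * \<bar>h p\<bar>) = H p * ennreal (Mw \<eta> p)" for p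
      by (simp add: H_def ennreal_mult[symmetric] mult_ac)
    then have "l2 (\<lambda>\<xi>. \<integral>\<^sup>+ \<tau>. ennreal (freq (\<xi>, \<tau>) powr (\<delta> - 1) * \<bar>h (\<xi>, \<tau>)\<bar>) \<partial>lborel)
      \<le> l2 (\<lambda>\<xi>. ennreal C * esqrt (\<integral>\<^sup>+ \<tau>. H (\<xi>, \<tau>) ^ 2 \<partial>lborel))"
      by (simp only:) (intro l2_mono C(2), measurable)
    also have "\<dots> = ennreal C * l2 (\<lambda>\<xi>. esqrt (\<integral>\<^sup>+ \<tau>. H (\<xi>, \<tau>) ^ 2 \<partial>lborel))"
      by (rule l2_cmult, rule measurable_time_l2) measurable
    also have "\<dots> = ennreal C * l2 H" by (simp add: l2_time)
    finally have 1: "l2 (\<lambda>\<xi>. \<integral>\<^sup>+ \<tau>. ennreal (freq (\<xi>, \<tau>) powr (\<delta> - 1) * \<bar>h (\<xi>, \<tau>)\<bar>) \<partial>lborel) \<le> ennreal C * l2 H" .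
    have "ennreal (psize p powr \<delta> * \<bar>h p\<bar>) \<le> ennreal 12 * H p" for p
    proof (cases "p \<in> K_set")
      case False
      have "psize p powr \<delta> * \<bar>h p\<bar> \<le> 12 * (outX p * \<bar>h p\<bar>)"
        using mult_right_mono[OF inY_le_outX[OF False], of "\<bar>h p\<bar>"] by simp
      then show ?thesis unfolding H_def by (subst ennreal_mult[symmetric]) (auto intro: ennreal_leI)
    qed (use 0 in simp)
    then have "l2 (\<lambda>p. ennreal (psize p powr \<delta> * \<bar>h p\<bar>)) \<le> l2 (\<lambda>p. ennreal 12 * H p)" by (rule l2_mono)
    also have "\<dots> = ennreal 12 * l2 H" by (rule l2_cmult) measurable
    finally have "Y_norm (\<delta> - 1) h \<le> ennreal C * l2 H + ennreal 12 * l2 H"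
      unfolding Y_norm_eq[OF h] using 1 by (intro add_mono)
    also have "\<dots> = ennreal (C + 12) * l2 H" using C(1) by (simp add: distrib_right)
    finally show ?thesis unfolding H_def .
  qed
  then show ?thesis using C(1) by (intro exI[of _ "C + 12"]) auto
qed

end

subsection \<open>The weighted convolution\<close>

text \<open>The integral takes values in [0, \<infinity>], so divergence shows as \<infinity>, in
  contrast to the default value 0 of \<open>conv\<close>.\<close>

definition wconv :: "(spacetime \<Rightarrow> real) \<Rightarrow> (spacetime \<Rightarrow> real) \<Rightarrow> spacetime \<Rightarrow> ennreal" where
  "wconv f g p = (\<integral>\<^sup>+ q. ennreal (f q * g (p - q) * wratio q (p - q)) \<partial>lborel)"

lemma measurable_wratio [measurable (raw)]:
  assumes [measurable]: "f \<in> borel_measurable M" "g \<in> borel_measurable M"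
  shows "(\<lambda>x. wratio (f x) (g x)) \<in> borel_measurable M"
  unfolding wratio_def by measurable

lemma measurable_over_weight [measurable]:
  assumes [measurable]: "f \<in> borel_measurable borel"
  shows "over_weight f \<in> borel_measurable borel"
  unfolding over_weight_def by measurable

lemma measurable_wconv [measurable]:
  assumes [measurable]: "f \<in> borel_measurable borel" "g \<in> borel_measurable borel"
  shows "wconv f g \<in> borel_measurable borel"
  unfolding wconv_def[abs_def] by (rule measurable_nn_integral_param) measurable

lemma measurable_bilin [measurable]:
  assumes [measurable]: "f \<in> borel_measurable borel" "g \<in> borel_measurable borel"
  shows "bilin f g \<in> borel_measurable borel"
proof -
  have "(\<lambda>z. over_weight f (snd z) * over_weight g (fst z - snd z)) \<in> borel_measurable borel" by measurable
  then have "(\<lambda>p. LINT q|lborel. over_weight f q * over_weight g (p - q)) \<in> borel_measurable borel"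
    using lborel.borel_measurable_lebesgue_integral[of "\<lambda>p q. over_weight f q * over_weight g (p - q)" lborel]
    by (simp add: case_prod_unfold lborel_prod)
  then have [measurable]: "(\<lambda>p. conv (over_weight f) (over_weight g) p) \<in> borel_measurable borel"
    by (simp add: conv_def)
  show ?thesis unfolding bilin_def by measurable
qed

lemma wconv_eq:
  assumes [measurable]: "f \<in> borel_measurable borel" "g \<in> borel_measurable borel"
  shows "wconv f g p = ennreal (weight p) * (\<integral>\<^sup>+ q. ennreal (over_weight f q * over_weight g (p - q)) \<partial>lborel)"
proof -
  have "f q * g (p - q) * wratio q (p - q) = weight p * (over_weight f q * over_weight g (p - q))" for q
    by (simp add: wratio_def over_weight_def)
  then have "wconv f g p = (\<integral>\<^sup>+ q. ennreal (weight p) * ennreal (over_weight f q * over_weight g (p - q)) \<partial>lborel)"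
    unfolding wconv_def using weight_pos[of p] by (simp add: ennreal_mult')
  also have "\<dots> = ennreal (weight p) * (\<integral>\<^sup>+ q. ennreal (over_weight f q * over_weight g (p - q)) \<partial>lborel)"
    by (rule nn_integral_cmult) measurable
  finally show ?thesis .
qed

text \<open>Where the convolution integral diverges the left side is 0 by default; elsewhere the two
  sides agree.\<close>

lemma bilin_le_wconv:
  assumes [measurable]: "f \<in> borel_measurable borel" "g \<in> borel_measurable borel"
    and nn: "\<And>p. 0 \<le> f p" "\<And>p. 0 \<le> g p" and c: "0 \<le> c"
  shows "ennreal (c * \<bar>bilin f g p\<bar>) \<le> ennreal (c / modulation p) * wconv f g p"
proof -
  have M: "0 < modulation p" using modulation_ge_1[of p] by linarith
  let ?a = "\<lambda>q. over_weight f q * over_weight g (p - q)"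
  have a: "0 \<le> ?a q" for q using nn weight_pos by (simp add: over_weight_def less_imp_le)
  have le: "ennreal (LINT q|lborel. ?a q) \<le> (\<integral>\<^sup>+ q. ennreal (?a q) \<partial>lborel)"
  proof (cases "integrable lborel ?a")
    case True then show ?thesis using a by (subst nn_integral_eq_integral) auto
  qed (simp add: not_integrable_integral_eq)
  have "0 \<le> conv (over_weight f) (over_weight g) p" unfolding conv_def using a by (intro integral_nonneg_AE) auto
  then have "c * \<bar>bilin f g p\<bar> = c / modulation p * weight p * (LINT q|lborel. ?a q)"
    using M weight_pos[of p] by (simp add: bilin_def conv_def abs_mult)
  then have "ennreal (c * \<bar>bilin f g p\<bar>) = ennreal (c / modulation p) * (ennreal (weight p) * ennreal (LINT q|lborel. ?a q))"
    using c M weight_pos[of p] by (simp only: ennreal_mult' divide_nonneg_pos less_imp_le mult.assoc)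
  also have "\<dots> \<le> ennreal (c / modulation p) * wconv f g p"
    unfolding wconv_eq[OF assms(1,2)] by (intro mult_left_mono le) auto
  finally show ?thesis .
qed

lemma conv_defined_if_wconv_finite:
  assumes [measurable]: "f \<in> borel_measurable borel" "g \<in> borel_measurable borel"
    and nn: "\<And>p. 0 \<le> f p" "\<And>p. 0 \<le> g p" and fin: "AE p in lborel. wconv f g p < top"
  shows "conv_defined (over_weight f) (over_weight g)"
  unfolding conv_defined_def using fin
proof (rule AE_mp, intro AE_I2 impI)
  fix p assume "wconv f g p < top"
  then have "(\<integral>\<^sup>+ q. ennreal (over_weight f q * over_weight g (p - q)) \<partial>lborel) < top"
    unfolding wconv_eq[OF assms(1,2)] using weight_pos[of p] by (auto simp: ennreal_mult_less_top)
  moreover have "0 \<le> over_weight f q * over_weight g (p - q)" for q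
    using nn weight_pos by (simp add: over_weight_def less_imp_le)
  ultimately show "integrable lborel (\<lambda>q. over_weight f q * over_weight g (p - q))"
    by (intro integrableI_nonneg) auto
qed

lemma AE_finite_if_l2_finite:
  fixes F :: "'a::euclidean_space \<Rightarrow> ennreal"
  assumes [measurable]: "F \<in> borel_measurable borel" and "l2 F < top"
  shows "AE x in lborel. F x < top"
proof -
  have "(\<integral>\<^sup>+ x. F x ^ 2 \<partial>lborel) \<noteq> \<infinity>" using assms(2) by (auto simp: l2_def esqrt_less_top_iff)
  then have "AE x in lborel. F x ^ 2 \<noteq> \<infinity>" by (intro nn_integral_PInf_AE) auto
  then show ?thesis by (rule AE_mp) (auto simp: less_top power_eq_top_ennreal)
qed

text \<open>This reduces an L2 estimate to a pointwise inequality between kernels: \<open>a\<close>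
  and \<open>b\<close> are the weights of the inputs, \<open>c\<close> that of the output, and the
  trilinear bound for \<open>k\<close> does the rest. Only pairs in the supports of \<open>f\<close>
  and \<open>g\<close> have to be checked, which is how membership in \<open>K\<close>
  enters.\<close>

lemma l2_wconv_le:
  assumes tri: "tri k C" and [measurable]: "f \<in> borel_measurable borel" "g \<in> borel_measurable borel"
    "a \<in> borel_measurable borel" "b \<in> borel_measurable borel"
    and nn: "\<And>p. 0 \<le> f p" "\<And>p. 0 \<le> g p" "\<And>p. 0 \<le> a p" "\<And>p. 0 \<le> b p" "\<And>p. 0 \<le> c p" "0 \<le> D"
    and le: "\<And>x y. f x \<noteq> 0 \<Longrightarrow> g y \<noteq> 0 \<Longrightarrow> c (x + y) * wratio x y \<le> D * k x y * a x * b y"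
  shows "l2 (\<lambda>p. ennreal (c p) * wconv f g p) \<le> ennreal (D * C) * (l2 (\<lambda>p. ennreal (a p * f p)) * l2 (\<lambda>p. ennreal (b p * g p)))"
proof -
  have t: "tri (\<lambda>x y. D * k x y) (D * C)" by (rule tri_cmult[OF tri nn(6)])
  have "ennreal (c p) * wconv f g p \<le> (\<integral>\<^sup>+ q. ennreal (a q * f q) * ennreal (b (p - q) * g (p - q)) * ennreal (D * k q (p - q)) \<partial>lborel)" for p
  proof -
    have "ennreal (c p) * wconv f g p = (\<integral>\<^sup>+ q. ennreal (c p) * ennreal (f q * g (p - q) * wratio q (p - q)) \<partial>lborel)"
      unfolding wconv_def by (rule nn_integral_cmult[symmetric]) measurable
    also have "\<dots> \<le> (\<integral>\<^sup>+ q. ennreal (a q * f q) * ennreal (b (p - q) * g (p - q)) * ennreal (D * k q (p - q)) \<partial>lborel)"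
    proof (rule nn_integral_mono)
      fix q
      have k: "0 \<le> k q (p - q)" by (rule kernel_nonneg[OF tri_kernel[OF tri]])
      have "c p * (f q * g (p - q) * wratio q (p - q)) \<le> (a q * f q) * (b (p - q) * g (p - q)) * (D * k q (p - q))"
      proof (cases "f q = 0 \<or> g (p - q) = 0")
        case False
        then have "c p * wratio q (p - q) \<le> D * k q (p - q) * a q * b (p - q)" using le[of q "p - q"] by simp
        then have "(c p * wratio q (p - q)) * (f q * g (p - q)) \<le> (D * k q (p - q) * a q * b (p - q)) * (f q * g (p - q))"
          using nn by (intro mult_right_mono) auto
        then show ?thesis by (simp add: mult_ac)
      qed auto
      then have "ennreal (c p * (f q * g (p - q) * wratio q (p - q))) \<le> ennreal ((a q * f q) * (b (p - q) * g (p - q)) * (D * k q (p - q)))"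
        by (rule ennreal_leI)
      then show "ennreal (c p) * ennreal (f q * g (p - q) * wratio q (p - q)) \<le> ennreal (a q * f q) * ennreal (b (p - q) * g (p - q)) * ennreal (D * k q (p - q))"
        using nn k wratio_nonneg by (simp add: ennreal_mult)
    qed
    finally show ?thesis .
  qed
  then have "l2 (\<lambda>p. ennreal (c p) * wconv f g p) \<le> l2 (\<lambda>p. \<integral>\<^sup>+ q. ennreal (a q * f q) * ennreal (b (p - q) * g (p - q)) * ennreal (D * k q (p - q)) \<partial>lborel)"
    by (rule l2_mono)
  also have "\<dots> \<le> ennreal (D * C) * (l2 (\<lambda>p. ennreal (a p * f p)) * l2 (\<lambda>p. ennreal (b p * g p)))"
    by (rule tri_bilinear[OF t]) measurable
  finally show ?thesis .
qed

section \<open>Weighted L2 estimates for each interaction\<close>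

context exponents begin

text \<open>Cutting off to \<open>K\<close> or to its complement destroys smoothness but preserves
  this class.\<close>

definition adm :: "(spacetime \<Rightarrow> real) \<Rightarrow> bool" where
  "adm f \<longleftrightarrow> f \<in> borel_measurable borel \<and> (\<forall>p. 0 \<le> f p)"

lemma adm_D: "adm f \<Longrightarrow> f \<in> borel_measurable borel" "adm f \<Longrightarrow> 0 \<le> f p"
  unfolding adm_def by blast+

lemma estimate_low_low:
  "\<exists>C\<ge>0. \<forall>f g. adm f \<and> adm g \<longrightarrow>
    l2 (\<lambda>p. ennreal (out p) * wconv f g p) \<le> ennreal C * (l2 (\<lambda>p. ennreal (inY p * f p)) * l2 (\<lambda>p. ennreal (inY p * g p)))"
proof -
  obtain C where C: "tri (\<lambda>x y. Mw \<eta> (x + y) * Nw \<eta> (x + y)) C" "tri (\<lambda>x y. Mw \<eta> (x + y) * Nw \<eta> x) C" "tri (\<lambda>x y. Mw \<eta> (x + y) * Nw \<eta> y) C"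
    using tri_weights[OF \<eta>_pos] by blast
  note t = tri_add[OF tri_add[OF C(1,2)] C(3)]
  have "l2 (\<lambda>p. ennreal (out p) * wconv f g p) \<le> ennreal (4096 * (C + C + C)) * (l2 (\<lambda>p. ennreal (inY p * f p)) * l2 (\<lambda>p. ennreal (inY p * g p)))"
    if "adm f" "adm g" for f g
    using that by (intro l2_wconv_le[OF t] kernel_low_low) (simp_all add: adm_D)
  then show ?thesis using tri_nonneg[OF C(1)] by (intro exI[of _ "4096 * (C + C + C)"]) auto
qed

lemma estimate_high_low:
  "\<exists>C\<ge>0. \<forall>f g. adm f \<and> adm g \<and> (\<forall>p. p \<notin> K_set \<longrightarrow> f p = 0) \<longrightarrow>
    l2 (\<lambda>p. ennreal (out p) * wconv f g p) \<le> ennreal C * (l2 (\<lambda>p. ennreal (inX p * f p)) * l2 (\<lambda>p. ennreal (inY p * g p)))"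
proof -
  obtain C where C: "tri (\<lambda>x y. Mw \<eta> x * Nw \<eta> (x + y)) C" "tri (\<lambda>x y. Mw \<eta> x * Nw \<eta> y) C" "tri (\<lambda>x y. Mw \<eta> x * Nw \<eta> x) C"
    using tri_weights[OF \<eta>_pos] by blast
  obtain C1 where C1: "tri (\<lambda>x y. Mw \<eta> x * Mw \<eta> (x + y)) C1" using tri_Mw_Mw_sum[OF \<eta>_pos] by blast
  obtain C2 where C2: "tri low_kernel C2" using tri_low_frequency_weight[OF \<eta>_pos] unfolding low_kernel_def[abs_def] by blast
  note t1 = tri_cmult[OF tri_add[OF C(1,2)], of "130 * 3 ^ 11"]
  note t2 = tri_cmult[OF tri_add[OF tri_add[OF C(3) C1] C2], of 65536]
  let ?k1 = "\<lambda>x y. 130 * 3 ^ 11 * (Mw \<eta> x * Nw \<eta> (x + y) + Mw \<eta> x * Nw \<eta> y)"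
  let ?k2 = "\<lambda>x y. 65536 * (Mw \<eta> x * Nw \<eta> x + Mw \<eta> x * Mw \<eta> (x + y) + low_kernel x y)"
  \<comment> \<open>One kernel serves both output regions: the first summand majorises off
    \<open>K\<close>, the second on \<open>K\<close>, and both are nonnegative.\<close>
  obtain D where t: "tri (\<lambda>x y. ?k1 x y + ?k2 x y) D" using tri_add[OF t1 t2] by auto
  have k: "out (x + y) * wratio x y \<le> 1 * (?k1 x y + ?k2 x y) * inX x * inY y" if x: "x \<in> K_set" for x y
  proof -
    have nn: "0 \<le> ?k1 x y * inX x * inY y" "0 \<le> ?k2 x y * inX x * inY y" by (auto simp: low_kernel_nonneg)
    have "out (x + y) * wratio x y \<le> ?k1 x y * inX x * inY y + ?k2 x y * inX x * inY y"
      using kernel_high_low_out[OF x, of y] kernel_resonant[OF x, of y] nn by (cases "x + y \<in> K_set") linarith+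
    then show ?thesis by (simp only: distrib_right mult_1)
  qed
  have "l2 (\<lambda>p. ennreal (out p) * wconv f g p) \<le> ennreal (1 * D) * (l2 (\<lambda>p. ennreal (inX p * f p)) * l2 (\<lambda>p. ennreal (inY p * g p)))"
    if "adm f" "adm g" "\<forall>p. p \<notin> K_set \<longrightarrow> f p = 0" for f g
  proof (rule l2_wconv_le[OF t])
    fix x y assume "f x \<noteq> 0" "g y \<noteq> 0"
    then have "x \<in> K_set" using that(3) by blast
    then show "out (x + y) * wratio x y \<le> 1 * (?k1 x y + ?k2 x y) * inX x * inY y" by (rule k)
  qed (use that in \<open>simp_all add: adm_D\<close>)
  then show ?thesis using tri_nonneg[OF t] by (intro exI[of _ D]) auto
qed

lemma estimate_transversal:
  "\<exists>C\<ge>0. \<forall>f g. adm f \<and> adm g \<and> (\<forall>p. p \<notin> K_set \<longrightarrow> f p = 0) \<and> (\<forall>p. p \<notin> K_set \<longrightarrow> g p = 0) \<longrightarrow>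
    l2 (\<lambda>p. ennreal (of_bool (p \<in> K_set) * out p) * wconv f g p) \<le> ennreal C * (l2 (\<lambda>p. ennreal (inX p * f p)) * l2 (\<lambda>p. ennreal (inX p * g p)))"
proof -
  let ?k = "\<lambda>x y. of_bool (4 \<le> freq x \<and> 4 \<le> freq y) * (Mw \<eta> x * Mw \<eta> y * Mw \<eta> (x + y)) * (freq x powr (1/2 - \<eta>) * freq y powr (1/2 - \<eta>))"
  obtain C where t: "tri ?k C" using tri_transversal_weight[OF \<eta>_pos] by blast
  have k: "of_bool (x + y \<in> K_set) * out (x + y) * wratio x y \<le> 262144 * ?k x y * inX x * inX y"
    if x: "x \<in> K_set" and y: "y \<in> K_set" for x y
  proof (cases "x + y \<in> K_set")
    case True
    then show ?thesis using kernel_transversal[OF x y] by simp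
  next
    case False
    have "0 \<le> 262144 * ?k x y * inX x * inX y" by (intro mult_nonneg_nonneg) auto
    then show ?thesis using False by simp
  qed
  have "l2 (\<lambda>p. ennreal (of_bool (p \<in> K_set) * out p) * wconv f g p) \<le> ennreal (262144 * C) * (l2 (\<lambda>p. ennreal (inX p * f p)) * l2 (\<lambda>p. ennreal (inX p * g p)))"
    if "adm f" "adm g" "\<forall>p. p \<notin> K_set \<longrightarrow> f p = 0" "\<forall>p. p \<notin> K_set \<longrightarrow> g p = 0" for f g
  proof (rule l2_wconv_le[OF t])
    fix x y assume "f x \<noteq> 0" "g y \<noteq> 0"
    then have "x \<in> K_set" "y \<in> K_set" using that(3,4) by blast+
    then show "of_bool (x + y \<in> K_set) * out (x + y) * wratio x y \<le> 262144 * ?k x y * inX x * inX y" by (rule k)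
  qed (use that in \<open>simp_all add: adm_D\<close>)
  then show ?thesis using tri_nonneg[OF t] by (intro exI[of _ "262144 * C"]) auto
qed

lemma estimate_high_out:
  "\<exists>C\<ge>0. \<forall>f g. adm f \<and> adm g \<and> (\<forall>p. p \<notin> K_set \<longrightarrow> f p = 0) \<and> (\<forall>p. p \<notin> K_set \<longrightarrow> g p = 0) \<longrightarrow>
    l2 (\<lambda>p. ennreal (of_bool (p \<notin> K_set) * (psize p powr \<delta> / modulation p)) * wconv f g p) \<le> ennreal C * (l2 (\<lambda>p. ennreal (inX p * f p)) * l2 (\<lambda>p. ennreal (inX p * g p)))"
proof -
  obtain C where t: "tri (\<lambda>x y. Mw \<eta> x * Mw \<eta> y) C" using tri_Mw_Mw[OF \<eta>_pos] by blast
  have M: "0 < modulation p" for p by (rule modulation_pos)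
  have k: "of_bool (x + y \<notin> K_set) * (psize (x + y) powr \<delta> / modulation (x + y)) * wratio x y \<le> 2 ^ 24 * (Mw \<eta> x * Mw \<eta> y) * inX x * inX y"
    if x: "x \<in> K_set" and y: "y \<in> K_set" for x y
  proof (cases "x + y \<in> K_set")
    case True
    have "0 \<le> 2 ^ 24 * (Mw \<eta> x * Mw \<eta> y) * inX x * inX y" by (intro mult_nonneg_nonneg) auto
    then show ?thesis using True by simp
  next
    case False
    then show ?thesis using kernel_high_out(1)[OF x y] by simp
  qed
  have "l2 (\<lambda>p. ennreal (of_bool (p \<notin> K_set) * (psize p powr \<delta> / modulation p)) * wconv f g p) \<le> ennreal (2 ^ 24 * C) * (l2 (\<lambda>p. ennreal (inX p * f p)) * l2 (\<lambda>p. ennreal (inX p * g p)))"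
    if "adm f" "adm g" "\<forall>p. p \<notin> K_set \<longrightarrow> f p = 0" "\<forall>p. p \<notin> K_set \<longrightarrow> g p = 0" for f g
  proof (rule l2_wconv_le[OF t])
    fix x y assume "f x \<noteq> 0" "g y \<noteq> 0"
    then have "x \<in> K_set" "y \<in> K_set" using that(3,4) by blast+
    then show "of_bool (x + y \<notin> K_set) * (psize (x + y) powr \<delta> / modulation (x + y)) * wratio x y \<le> 2 ^ 24 * (Mw \<eta> x * Mw \<eta> y) * inX x * inX y"
      by (rule k)
  qed (use that M in \<open>simp_all add: adm_D less_imp_le\<close>)
  then show ?thesis using tri_nonneg[OF t] by (intro exI[of _ "2 ^ 24 * C"]) auto
qed

lemma estimate_high_out_time:
  "\<exists>C\<ge>0. \<forall>f g. adm f \<and> adm g \<and> (\<forall>p. p \<notin> K_set \<longrightarrow> f p = 0) \<and> (\<forall>p. p \<notin> K_set \<longrightarrow> g p = 0) \<longrightarrow>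
    l2 (\<lambda>\<xi>. \<integral>\<^sup>+ \<tau>. ennreal (of_bool ((\<xi>, \<tau>) \<notin> K_set) * (freq (\<xi>, \<tau>) powr (\<delta> - 1) / modulation (\<xi>, \<tau>))) * wconv f g (\<xi>, \<tau>) \<partial>lborel)
    \<le> ennreal C * (l2 (\<lambda>p. ennreal (inX p * f p)) * l2 (\<lambda>p. ennreal (inX p * g p)))"
proof -
  obtain C where C: "0 \<le> C" "\<And>F G. F \<in> borel_measurable borel \<Longrightarrow> G \<in> borel_measurable borel \<Longrightarrow>
    l2 (\<lambda>\<xi>. \<integral>\<^sup>+ \<tau>. \<integral>\<^sup>+ q. ennreal (Nw \<eta> (\<xi>, \<tau>)) * (F q * ennreal (Mw \<eta> q)) * (G ((\<xi>, \<tau>) - q) * ennreal (Mw \<eta> ((\<xi>, \<tau>) - q))) \<partial>lborel \<partial>lborel)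
    \<le> ennreal C * (l2 F * l2 G)"
    using l2_space_convolution by blast
  have "l2 (\<lambda>\<xi>. \<integral>\<^sup>+ \<tau>. ennreal (of_bool ((\<xi>, \<tau>) \<notin> K_set) * (freq (\<xi>, \<tau>) powr (\<delta> - 1) / modulation (\<xi>, \<tau>))) * wconv f g (\<xi>, \<tau>) \<partial>lborel)
    \<le> ennreal (C * 2 ^ 24) * (l2 (\<lambda>p. ennreal (inX p * f p)) * l2 (\<lambda>p. ennreal (inX p * g p)))"
    if f: "adm f" and g: "adm g" and f0: "\<forall>p. p \<notin> K_set \<longrightarrow> f p = 0" and g0: "\<forall>p. p \<notin> K_set \<longrightarrow> g p = 0" for f g
  proof -
    have [measurable]: "f \<in> borel_measurable borel" "g \<in> borel_measurable borel" and nn: "0 \<le> f p" "0 \<le> g p" for p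
      using f g by (blast intro: adm_D)+
    define F where "F p = ennreal (2 ^ 24) * ennreal (inX p * f p)" for p
    define G where "G p = ennreal (inX p * g p)" for p
    have [measurable]: "F \<in> borel_measurable borel" "G \<in> borel_measurable borel" unfolding F_def G_def by measurable
    define c where "c p = of_bool (p \<notin> K_set) * (freq p powr (\<delta> - 1) / modulation p)" for p
    have c: "0 \<le> c p" for p using modulation_pos[of p] by (simp add: c_def less_imp_le)
    have "ennreal (c p) * wconv f g p \<le> (\<integral>\<^sup>+ q. ennreal (Nw \<eta> p) * (F q * ennreal (Mw \<eta> q)) * (G (p - q) * ennreal (Mw \<eta> (p - q))) \<partial>lborel)" for p
    proof -
      have "ennreal (c p) * wconv f g p = (\<integral>\<^sup>+ q. ennreal (c p) * ennreal (f q * g (p - q) * wratio q (p - q)) \<partial>lborel)"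
        unfolding wconv_def by (rule nn_integral_cmult[symmetric]) measurable
      also have "\<dots> \<le> (\<integral>\<^sup>+ q. ennreal (Nw \<eta> p) * (F q * ennreal (Mw \<eta> q)) * (G (p - q) * ennreal (Mw \<eta> (p - q))) \<partial>lborel)"
      proof (rule nn_integral_mono)
        fix q
        have "c p * (f q * g (p - q) * wratio q (p - q)) \<le> Nw \<eta> p * (2 ^ 24 * (inX q * f q) * Mw \<eta> q) * ((inX (p - q) * g (p - q)) * Mw \<eta> (p - q))"
        proof (cases "f q = 0 \<or> g (p - q) = 0 \<or> p \<in> K_set")
          case True
          have "0 \<le> Nw \<eta> p * (2 ^ 24 * (inX q * f q) * Mw \<eta> q) * ((inX (p - q) * g (p - q)) * Mw \<eta> (p - q))"
            using nn by (intro mult_nonneg_nonneg) auto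
          then show ?thesis using True by (auto simp: c_def)
        next
          case False
          then have "q \<in> K_set" "p - q \<in> K_set" "q + (p - q) \<notin> K_set" using f0 g0 by (blast, blast, simp)
          from kernel_high_out(2)[OF this]
          have "c p * wratio q (p - q) \<le> 2 ^ 24 * Nw \<eta> p * (inX q * Mw \<eta> q) * (inX (p - q) * Mw \<eta> (p - q))"
            using False by (simp add: c_def)
          then have "(c p * wratio q (p - q)) * (f q * g (p - q)) \<le> (2 ^ 24 * Nw \<eta> p * (inX q * Mw \<eta> q) * (inX (p - q) * Mw \<eta> (p - q))) * (f q * g (p - q))"
            using nn by (intro mult_right_mono) auto
          then show ?thesis by (simp add: mult_ac)
        qed
        then have "ennreal (c p * (f q * g (p - q) * wratio q (p - q))) \<le> ennreal (Nw \<eta> p * (2 ^ 24 * (inX q * f q) * Mw \<eta> q) * ((inX (p - q) * g (p - q)) * Mw \<eta> (p - q)))"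
          by (rule ennreal_leI)
        then show "ennreal (c p) * ennreal (f q * g (p - q) * wratio q (p - q)) \<le> ennreal (Nw \<eta> p) * (F q * ennreal (Mw \<eta> q)) * (G (p - q) * ennreal (Mw \<eta> (p - q)))"
          unfolding F_def G_def using nn c by (simp only: ennreal_mult' ennreal_mult'' in_out_nonneg Nw_nonneg Mw_nonneg mult_nonneg_nonneg zero_le_numeral zero_le_power mult.assoc)
      qed
      finally show ?thesis .
    qed
    then have "l2 (\<lambda>\<xi>. \<integral>\<^sup>+ \<tau>. ennreal (c (\<xi>, \<tau>)) * wconv f g (\<xi>, \<tau>) \<partial>lborel) \<le>
      l2 (\<lambda>\<xi>. \<integral>\<^sup>+ \<tau>. \<integral>\<^sup>+ q. ennreal (Nw \<eta> (\<xi>, \<tau>)) * (F q * ennreal (Mw \<eta> q)) * (G ((\<xi>, \<tau>) - q) * ennreal (Mw \<eta> ((\<xi>, \<tau>) - q))) \<partial>lborel \<partial>lborel)"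
      by (intro l2_mono nn_integral_mono)
    also have "\<dots> \<le> ennreal C * (l2 F * l2 G)" by (rule C(2)) measurable
    also have "l2 F = ennreal (2 ^ 24) * l2 (\<lambda>p. ennreal (inX p * f p))" unfolding F_def by (rule l2_cmult) measurable
    also have "ennreal C * (ennreal (2 ^ 24) * l2 (\<lambda>p. ennreal (inX p * f p)) * l2 G) = ennreal (C * 2 ^ 24) * (l2 (\<lambda>p. ennreal (inX p * f p)) * l2 G)"
      by (simp only: ennreal_mult'[OF C(1)] mult.assoc)
    finally show ?thesis unfolding c_def G_def .
  qed
  then show ?thesis using C(1) by (intro exI[of _ "C * 2 ^ 24"]) auto
qed

section \<open>From weighted L2 bounds to the four estimates\<close>

lemma out_pos: "0 < out p"
  using bracket_pos[of "fst p"] modulation_pos[of p] by (simp add: out_def)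

lemma X_bilin_le:
  "\<exists>C\<ge>0. \<forall>f g. adm f \<and> adm g \<longrightarrow> X_norm (\<delta> - 1) (1/2) (restr K_set (bilin f g))
    \<le> ennreal C * l2 (\<lambda>p. ennreal (of_bool (p \<in> K_set) * out p) * wconv f g p)"
proof -
  obtain C where C: "0 \<le> C" "\<And>h. h \<in> borel_measurable borel \<Longrightarrow>
      X_norm (\<delta> - 1) (1/2) h \<le> ennreal C * l2 (\<lambda>p. ennreal (outX p * \<bar>h p\<bar>))"
    using X_norm_le by blast
  have "X_norm (\<delta> - 1) (1/2) (restr K_set (bilin f g))
      \<le> ennreal C * l2 (\<lambda>p. ennreal (of_bool (p \<in> K_set) * out p) * wconv f g p)" if f: "adm f" and g: "adm g" for f g
  proof -
    have [measurable]: "f \<in> borel_measurable borel" "g \<in> borel_measurable borel" and nn: "\<And>p. 0 \<le> f p" "\<And>p. 0 \<le> g p"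
      using f g by (blast intro: adm_D)+
    have "ennreal (outX p * \<bar>restr K_set (bilin f g) p\<bar>) \<le> ennreal (of_bool (p \<in> K_set) * out p) * wconv f g p" for p
    proof -
      have "ennreal (of_bool (p \<in> K_set) * outX p * \<bar>bilin f g p\<bar>) \<le> ennreal (of_bool (p \<in> K_set) * outX p / modulation p) * wconv f g p"
        by (rule bilin_le_wconv) (use nn in auto)
      then show ?thesis using modulation_pos[of p] by (auto simp: restr_def outX_eq)
    qed
    then have "l2 (\<lambda>p. ennreal (outX p * \<bar>restr K_set (bilin f g) p\<bar>)) \<le> l2 (\<lambda>p. ennreal (of_bool (p \<in> K_set) * out p) * wconv f g p)"
      by (rule l2_mono)
    moreover have "restr K_set (bilin f g) \<in> borel_measurable borel" by measurable
    ultimately show ?thesis using C(2) by (meson mult_left_mono order_trans zero_le)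
  qed
  then show ?thesis using C(1) by blast
qed

lemma Y_bilin_le:
  "\<exists>C\<ge>0. \<forall>f g. adm f \<and> adm g \<longrightarrow> Y_norm (\<delta> - 1) (restr (- K_set) (bilin f g))
    \<le> ennreal C * l2 (\<lambda>p. ennreal (out p) * wconv f g p)"
proof -
  obtain C where C: "0 \<le> C" "\<And>h. h \<in> borel_measurable borel \<Longrightarrow> \<forall>p\<in>K_set. h p = 0 \<Longrightarrow>
      Y_norm (\<delta> - 1) h \<le> ennreal C * l2 (\<lambda>p. ennreal (outX p * \<bar>h p\<bar>))"
    using Y_norm_le by blast
  have "Y_norm (\<delta> - 1) (restr (- K_set) (bilin f g)) \<le> ennreal C * l2 (\<lambda>p. ennreal (out p) * wconv f g p)"
    if f: "adm f" and g: "adm g" for f g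
  proof -
    have [measurable]: "f \<in> borel_measurable borel" "g \<in> borel_measurable borel" and nn: "\<And>p. 0 \<le> f p" "\<And>p. 0 \<le> g p"
      using f g by (blast intro: adm_D)+
    have "ennreal (outX p * \<bar>restr (- K_set) (bilin f g) p\<bar>) \<le> ennreal (out p) * wconv f g p" for p
    proof -
      have "ennreal (outX p * \<bar>bilin f g p\<bar>) \<le> ennreal (outX p / modulation p) * wconv f g p"
        by (rule bilin_le_wconv) (use nn in auto)
      then show ?thesis using modulation_pos[of p] by (auto simp: restr_def outX_eq indicator_def)
    qed
    then have "l2 (\<lambda>p. ennreal (outX p * \<bar>restr (- K_set) (bilin f g) p\<bar>)) \<le> l2 (\<lambda>p. ennreal (out p) * wconv f g p)"
      by (rule l2_mono)
    moreover have "restr (- K_set) (bilin f g) \<in> borel_measurable borel" by measurable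
    moreover have "\<forall>p\<in>K_set. restr (- K_set) (bilin f g) p = 0" by (simp add: restr_def)
    ultimately show ?thesis using C(2) by (meson mult_left_mono order_trans zero_le)
  qed
  then show ?thesis using C(1) by blast
qed

text \<open>The factor 1 / M of \<open>bilin\<close> is kept in full; passing to \<open>out\<close>
  as in \<open>Y_bilin_le\<close> would weaken it to M^(-1/2 + \<eta>) in the part with L1 in
  time.\<close>

lemma Y_bilin_le_high:
  assumes f: "adm f" and g: "adm g"
  shows "Y_norm (\<delta> - 1) (restr (- K_set) (bilin f g)) \<le>
    l2 (\<lambda>\<xi>. \<integral>\<^sup>+ \<tau>. ennreal (of_bool ((\<xi>, \<tau>) \<notin> K_set) * (freq (\<xi>, \<tau>) powr (\<delta> - 1) / modulation (\<xi>, \<tau>))) * wconv f g (\<xi>, \<tau>) \<partial>lborel) +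
    l2 (\<lambda>p. ennreal (of_bool (p \<notin> K_set) * (psize p powr \<delta> / modulation p)) * wconv f g p)"
proof -
  have [measurable]: "f \<in> borel_measurable borel" "g \<in> borel_measurable borel" and nn: "\<And>p. 0 \<le> f p" "\<And>p. 0 \<le> g p"
    using f g by (blast intro: adm_D)+
  have le: "ennreal (c p * \<bar>restr (- K_set) (bilin f g) p\<bar>) \<le> ennreal (of_bool (p \<notin> K_set) * (c p / modulation p)) * wconv f g p"
    if "0 \<le> c p" for c p
  proof -
    have "ennreal (c p * \<bar>bilin f g p\<bar>) \<le> ennreal (c p / modulation p) * wconv f g p"
      by (rule bilin_le_wconv) (use nn that in auto)
    then show ?thesis by (auto simp: restr_def indicator_def)
  qed
  have meas: "restr (- K_set) (bilin f g) \<in> borel_measurable borel" by measurable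
  show ?thesis unfolding Y_norm_eq[OF meas]
    by (intro add_mono l2_mono nn_integral_mono le) auto
qed

lemma conv_defined_if_l2_finite:
  assumes f: "adm f" and g: "adm g" and fin: "l2 (\<lambda>p. ennreal (out p) * wconv f g p) < top"
  shows "conv_defined (over_weight f) (over_weight g)"
proof (rule conv_defined_if_wconv_finite)
  have [measurable]: "f \<in> borel_measurable borel" "g \<in> borel_measurable borel" using f g by (blast intro: adm_D)+
  have "AE p in lborel. ennreal (out p) * wconv f g p < top" by (rule AE_finite_if_l2_finite[OF _ fin]) measurable
  then show "AE p in lborel. wconv f g p < top"
  proof eventually_elim
    case (elim p)
    then show ?case using out_pos[of p] by (auto simp: ennreal_mult_less_top)
  qed
qed (use f g in \<open>simp_all add: adm_D\<close>)

text \<open>The cut along \<open>K\<close> is a competitor in the infimum. A piece of infinite norm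
  lies outside its space and gives no competitor, but then the right side is infinite.\<close>

lemma Z_norm_le:
  assumes [measurable]: "h \<in> borel_measurable borel"
  shows "Z_norm s h \<le> X_norm s (1/2) (restr K_set h) + Y_norm s (restr (- K_set) h)"
proof (cases "X_norm s (1/2) (restr K_set h) < top \<and> Y_norm s (restr (- K_set) h) < top")
  case True
  have "restr K_set h \<in> borel_measurable borel" "restr (- K_set) h \<in> borel_measurable borel" by measurable
  then have "restr K_set h \<in> X_space s (1/2)" "restr (- K_set) h \<in> Y_space s"
    using True by (simp_all add: X_space_def Y_space_def)
  moreover have "AE p in lborel. h p = restr K_set h p + restr (- K_set) h p"
    by (intro AE_I2) (simp add: restr_def indicator_def)
  ultimately show ?thesis unfolding Z_norm_def by (intro Inf_lower) blast
next
  case False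
  then have "X_norm s (1/2) (restr K_set h) + Y_norm s (restr (- K_set) h) = top" by (auto simp: less_top[symmetric])
  then show ?thesis by (simp only: top_greatest)
qed

lemma inX_le: "adm f \<Longrightarrow> l2 (\<lambda>p. ennreal (inX p * f p)) \<le> ennreal 2 * X_norm (\<delta> - 1) (1/2) f"
  using l2_inX_le[of f] by (simp add: adm_D)

lemma inY_le: "adm f \<Longrightarrow> l2 (\<lambda>p. ennreal (inY p * f p)) \<le> Y_norm (\<delta> - 1) f"
  using l2_inY_le[of f] by (simp add: adm_D)

lemma l2_of_bool_le: "l2 (\<lambda>p. ennreal (of_bool (p \<in> K_set) * out p) * wconv f g p) \<le> l2 (\<lambda>p. ennreal (out p) * wconv f g p)"
  by (intro l2_mono) auto

lemma bilin_low_low: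
  "\<exists>C\<ge>0. \<forall>f g. adm f \<and> adm g \<longrightarrow> Z_norm (\<delta> - 1) (bilin f g) \<le> ennreal C * Y_norm (\<delta> - 1) f * Y_norm (\<delta> - 1) g \<and>
    (Y_norm (\<delta> - 1) f < top \<and> Y_norm (\<delta> - 1) g < top \<longrightarrow> conv_defined (over_weight f) (over_weight g))"
proof -
  obtain C1 where C1: "0 \<le> C1" "\<And>f g. adm f \<Longrightarrow> adm g \<Longrightarrow> X_norm (\<delta> - 1) (1/2) (restr K_set (bilin f g))
    \<le> ennreal C1 * l2 (\<lambda>p. ennreal (of_bool (p \<in> K_set) * out p) * wconv f g p)"
    using X_bilin_le by blast
  obtain C2 where C2: "0 \<le> C2" "\<And>f g. adm f \<Longrightarrow> adm g \<Longrightarrow> Y_norm (\<delta> - 1) (restr (- K_set) (bilin f g))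
    \<le> ennreal C2 * l2 (\<lambda>p. ennreal (out p) * wconv f g p)"
    using Y_bilin_le by blast
  obtain C3 where C3: "0 \<le> C3" "\<And>f g. adm f \<Longrightarrow> adm g \<Longrightarrow> l2 (\<lambda>p. ennreal (out p) * wconv f g p)
    \<le> ennreal C3 * (l2 (\<lambda>p. ennreal (inY p * f p)) * l2 (\<lambda>p. ennreal (inY p * g p)))"
    using estimate_low_low by blast
  have "Z_norm (\<delta> - 1) (bilin f g) \<le> ennreal ((C1 + C2) * C3) * Y_norm (\<delta> - 1) f * Y_norm (\<delta> - 1) g \<and>
    (Y_norm (\<delta> - 1) f < top \<and> Y_norm (\<delta> - 1) g < top \<longrightarrow> conv_defined (over_weight f) (over_weight g))"
    if f: "adm f" and g: "adm g" for f g
  proof -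
    have [measurable]: "f \<in> borel_measurable borel" "g \<in> borel_measurable borel" using f g by (blast intro: adm_D)+
    let ?L = "l2 (\<lambda>p. ennreal (out p) * wconv f g p)"
    have L: "?L \<le> ennreal C3 * (Y_norm (\<delta> - 1) f * Y_norm (\<delta> - 1) g)"
      by (rule order_trans[OF C3(2)[OF f g]]) (intro mult_left_mono mult_mono inY_le f g; simp)
    have "Z_norm (\<delta> - 1) (bilin f g) \<le> X_norm (\<delta> - 1) (1/2) (restr K_set (bilin f g)) + Y_norm (\<delta> - 1) (restr (- K_set) (bilin f g))"
      by (rule Z_norm_le) measurable
    also have "\<dots> \<le> ennreal C1 * ?L + ennreal C2 * ?L"
      by (intro add_mono order_trans[OF C1(2)[OF f g]] C2(2)[OF f g] mult_left_mono l2_of_bool_le) auto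
    also have "\<dots> = ennreal (C1 + C2) * ?L" using C1(1) C2(1) by (simp add: ennreal_plus distrib_right)
    also have "\<dots> \<le> ennreal (C1 + C2) * (ennreal C3 * (Y_norm (\<delta> - 1) f * Y_norm (\<delta> - 1) g))" by (intro mult_left_mono L) auto
    also have "\<dots> = ennreal ((C1 + C2) * C3) * Y_norm (\<delta> - 1) f * Y_norm (\<delta> - 1) g"
      using C1(1) C2(1) C3(1) by (simp add: ennreal_mult mult.assoc)
    finally have "Z_norm (\<delta> - 1) (bilin f g) \<le> ennreal ((C1 + C2) * C3) * Y_norm (\<delta> - 1) f * Y_norm (\<delta> - 1) g" .
    moreover have "conv_defined (over_weight f) (over_weight g)" if "Y_norm (\<delta> - 1) f < top" "Y_norm (\<delta> - 1) g < top"
      by (intro conv_defined_if_l2_finite f g le_less_trans[OF L]) (use that in \<open>simp add: ennreal_mult_less_top\<close>)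
    ultimately show ?thesis by blast
  qed
  then show ?thesis using C1(1) C2(1) C3(1) by (intro exI[of _ "(C1 + C2) * C3"]) auto
qed

lemma bilin_high_low:
  "\<exists>C\<ge>0. \<forall>f g. adm f \<and> adm g \<and> (\<forall>p. p \<notin> K_set \<longrightarrow> f p = 0) \<longrightarrow>
    X_norm (\<delta> - 1) (1/2) (restr K_set (bilin f g)) \<le> ennreal C * X_norm (\<delta> - 1) (1/2) f * Y_norm (\<delta> - 1) g \<and>
    Y_norm (\<delta> - 1) (restr (- K_set) (bilin f g)) \<le> ennreal C * X_norm (\<delta> - 1) (1/2) f * Y_norm (\<delta> - 1) g \<and>
    (X_norm (\<delta> - 1) (1/2) f < top \<and> Y_norm (\<delta> - 1) g < top \<longrightarrow> conv_defined (over_weight f) (over_weight g))"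
proof -
  obtain C1 where C1: "0 \<le> C1" "\<And>f g. adm f \<Longrightarrow> adm g \<Longrightarrow> X_norm (\<delta> - 1) (1/2) (restr K_set (bilin f g))
    \<le> ennreal C1 * l2 (\<lambda>p. ennreal (of_bool (p \<in> K_set) * out p) * wconv f g p)"
    using X_bilin_le by blast
  obtain C2 where C2: "0 \<le> C2" "\<And>f g. adm f \<Longrightarrow> adm g \<Longrightarrow> Y_norm (\<delta> - 1) (restr (- K_set) (bilin f g))
    \<le> ennreal C2 * l2 (\<lambda>p. ennreal (out p) * wconv f g p)"
    using Y_bilin_le by blast
  obtain C3 where C3: "0 \<le> C3" "\<And>f g. adm f \<Longrightarrow> adm g \<Longrightarrow> \<forall>p. p \<notin> K_set \<longrightarrow> f p = 0 \<Longrightarrow> l2 (\<lambda>p. ennreal (out p) * wconv f g p)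
    \<le> ennreal C3 * (l2 (\<lambda>p. ennreal (inX p * f p)) * l2 (\<lambda>p. ennreal (inY p * g p)))"
    using estimate_high_low by blast
  define C where "C = (C1 + C2) * C3 * 2"
  have C: "0 \<le> C" using C1(1) C2(1) C3(1) by (simp add: C_def)
  have Ceq: "ennreal C = ennreal (C1 + C2) * ennreal C3 * ennreal 2"
    using C3(1) by (simp only: C_def ennreal_mult'' zero_le_numeral)
  have "X_norm (\<delta> - 1) (1/2) (restr K_set (bilin f g)) \<le> ennreal C * X_norm (\<delta> - 1) (1/2) f * Y_norm (\<delta> - 1) g \<and>
    Y_norm (\<delta> - 1) (restr (- K_set) (bilin f g)) \<le> ennreal C * X_norm (\<delta> - 1) (1/2) f * Y_norm (\<delta> - 1) g \<and>
    (X_norm (\<delta> - 1) (1/2) f < top \<and> Y_norm (\<delta> - 1) g < top \<longrightarrow> conv_defined (over_weight f) (over_weight g))"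
    if f: "adm f" and g: "adm g" and f0: "\<forall>p. p \<notin> K_set \<longrightarrow> f p = 0" for f g
  proof -
    let ?L = "l2 (\<lambda>p. ennreal (out p) * wconv f g p)"
    have L: "?L \<le> ennreal C3 * (ennreal 2 * X_norm (\<delta> - 1) (1/2) f * Y_norm (\<delta> - 1) g)"
      by (rule order_trans[OF C3(2)[OF f g f0]]) (intro mult_left_mono mult_mono inX_le inY_le f g; simp)
    have "ennreal (C1 + C2) * ?L \<le> ennreal (C1 + C2) * (ennreal C3 * (ennreal 2 * X_norm (\<delta> - 1) (1/2) f * Y_norm (\<delta> - 1) g))"
      by (intro mult_left_mono L) auto
    also have "\<dots> = ennreal C * X_norm (\<delta> - 1) (1/2) f * Y_norm (\<delta> - 1) g"
      by (simp only: Ceq mult_ac)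
    finally have le: "ennreal (C1 + C2) * ?L \<le> ennreal C * X_norm (\<delta> - 1) (1/2) f * Y_norm (\<delta> - 1) g" .
    have "X_norm (\<delta> - 1) (1/2) (restr K_set (bilin f g)) \<le> ennreal (C1 + C2) * ?L"
      using C1(1) C2(1) by (intro order_trans[OF C1(2)[OF f g]] mult_mono l2_of_bool_le ennreal_leI) auto
    moreover have "Y_norm (\<delta> - 1) (restr (- K_set) (bilin f g)) \<le> ennreal (C1 + C2) * ?L"
      using C1(1) C2(1) by (intro order_trans[OF C2(2)[OF f g]] mult_right_mono ennreal_leI) auto
    moreover have "conv_defined (over_weight f) (over_weight g)" if "X_norm (\<delta> - 1) (1/2) f < top" "Y_norm (\<delta> - 1) g < top"
      by (intro conv_defined_if_l2_finite f g le_less_trans[OF L]) (use that in \<open>simp add: ennreal_mult_less_top\<close>)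
    ultimately show ?thesis using le by (meson order_trans)
  qed
  then show ?thesis using C by (intro exI[of _ C]) auto
qed

lemma bilin_high_high:
  "\<exists>C\<ge>0. \<forall>f g. adm f \<and> adm g \<and> (\<forall>p. p \<notin> K_set \<longrightarrow> f p = 0) \<and> (\<forall>p. p \<notin> K_set \<longrightarrow> g p = 0) \<longrightarrow>
    Z_norm (\<delta> - 1) (bilin f g) \<le> ennreal C * X_norm (\<delta> - 1) (1/2) f * X_norm (\<delta> - 1) (1/2) g \<and>
    (X_norm (\<delta> - 1) (1/2) f < top \<and> X_norm (\<delta> - 1) (1/2) g < top \<longrightarrow> conv_defined (over_weight f) (over_weight g))"
proof -
  obtain C1 where C1: "0 \<le> C1" "\<And>f g. adm f \<Longrightarrow> adm g \<Longrightarrow> X_norm (\<delta> - 1) (1/2) (restr K_set (bilin f g))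
    \<le> ennreal C1 * l2 (\<lambda>p. ennreal (of_bool (p \<in> K_set) * out p) * wconv f g p)"
    using X_bilin_le by blast
  obtain C2 where C2: "0 \<le> C2" "\<And>f g. adm f \<Longrightarrow> adm g \<Longrightarrow> \<forall>p. p \<notin> K_set \<longrightarrow> f p = 0 \<Longrightarrow> \<forall>p. p \<notin> K_set \<longrightarrow> g p = 0 \<Longrightarrow>
    l2 (\<lambda>p. ennreal (of_bool (p \<in> K_set) * out p) * wconv f g p)
    \<le> ennreal C2 * (l2 (\<lambda>p. ennreal (inX p * f p)) * l2 (\<lambda>p. ennreal (inX p * g p)))"
    using estimate_transversal by blast
  obtain C3 where C3: "0 \<le> C3" "\<And>f g. adm f \<Longrightarrow> adm g \<Longrightarrow> \<forall>p. p \<notin> K_set \<longrightarrow> f p = 0 \<Longrightarrow> \<forall>p. p \<notin> K_set \<longrightarrow> g p = 0 \<Longrightarrow>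
    l2 (\<lambda>p. ennreal (of_bool (p \<notin> K_set) * (psize p powr \<delta> / modulation p)) * wconv f g p)
    \<le> ennreal C3 * (l2 (\<lambda>p. ennreal (inX p * f p)) * l2 (\<lambda>p. ennreal (inX p * g p)))"
    using estimate_high_out by blast
  obtain C4 where C4: "0 \<le> C4" "\<And>f g. adm f \<Longrightarrow> adm g \<Longrightarrow> \<forall>p. p \<notin> K_set \<longrightarrow> f p = 0 \<Longrightarrow> \<forall>p. p \<notin> K_set \<longrightarrow> g p = 0 \<Longrightarrow>
    l2 (\<lambda>\<xi>. \<integral>\<^sup>+ \<tau>. ennreal (of_bool ((\<xi>, \<tau>) \<notin> K_set) * (freq (\<xi>, \<tau>) powr (\<delta> - 1) / modulation (\<xi>, \<tau>))) * wconv f g (\<xi>, \<tau>) \<partial>lborel)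
    \<le> ennreal C4 * (l2 (\<lambda>p. ennreal (inX p * f p)) * l2 (\<lambda>p. ennreal (inX p * g p)))"
    using estimate_high_out_time by blast
  define C where "C = (C1 * C2 + (C4 + C3)) * 4"
  have C: "0 \<le> C" using C1(1) C2(1) C3(1) C4(1) by (simp add: C_def)
  have "Z_norm (\<delta> - 1) (bilin f g) \<le> ennreal C * X_norm (\<delta> - 1) (1/2) f * X_norm (\<delta> - 1) (1/2) g \<and>
    (X_norm (\<delta> - 1) (1/2) f < top \<and> X_norm (\<delta> - 1) (1/2) g < top \<longrightarrow> conv_defined (over_weight f) (over_weight g))"
    if f: "adm f" and g: "adm g" and f0: "\<forall>p. p \<notin> K_set \<longrightarrow> f p = 0" and g0: "\<forall>p. p \<notin> K_set \<longrightarrow> g p = 0" for f g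
  proof -
    have [measurable]: "f \<in> borel_measurable borel" "g \<in> borel_measurable borel" using f g by (blast intro: adm_D)+
    let ?Q = "l2 (\<lambda>p. ennreal (inX p * f p)) * l2 (\<lambda>p. ennreal (inX p * g p))"
    let ?X = "X_norm (\<delta> - 1) (1/2)"
    have Q: "?Q \<le> ennreal 4 * (?X f * ?X g)"
    proof -
      have "?Q \<le> (ennreal 2 * ?X f) * (ennreal 2 * ?X g)" by (intro mult_mono inX_le f g) auto
      also have "\<dots> = (ennreal 2 * ennreal 2) * (?X f * ?X g)" by (simp only: mult_ac)
      also have "ennreal 2 * ennreal 2 = ennreal 4" by (simp flip: ennreal_mult)
      finally show ?thesis .
    qed
    have "Z_norm (\<delta> - 1) (bilin f g) \<le> ?X (restr K_set (bilin f g)) + Y_norm (\<delta> - 1) (restr (- K_set) (bilin f g))"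
      by (rule Z_norm_le) measurable
    \<comment> \<open>The transversal estimate serves the output on \<open>K\<close>; off
      \<open>K\<close> the two parts of the \<open>Y\<close> norm are estimated separately.\<close>
    also have "\<dots> \<le> ennreal C1 * (ennreal C2 * ?Q) + (ennreal C4 * ?Q + ennreal C3 * ?Q)"
      by (intro add_mono order_trans[OF C1(2)[OF f g]] order_trans[OF Y_bilin_le_high[OF f g]] mult_left_mono
          C2(2)[OF f g f0 g0] C3(2)[OF f g f0 g0] C4(2)[OF f g f0 g0]) auto
    also have "\<dots> = ennreal (C1 * C2 + (C4 + C3)) * ?Q"
      using C1(1) C2(1) C3(1) C4(1) by (simp add: ennreal_plus ennreal_mult distrib_right mult.assoc)
    also have "\<dots> \<le> ennreal (C1 * C2 + (C4 + C3)) * (ennreal 4 * (?X f * ?X g))" by (intro mult_left_mono Q) auto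
    also have "\<dots> = ennreal C * ?X f * ?X g"
      by (simp only: C_def ennreal_mult'' zero_le_numeral mult.assoc)
    finally have "Z_norm (\<delta> - 1) (bilin f g) \<le> ennreal C * ?X f * ?X g" .
    moreover have "conv_defined (over_weight f) (over_weight g)" if "?X f < top" "?X g < top"
    proof (rule conv_defined_if_wconv_finite)
      have "ennreal 4 * (?X f * ?X g) < top" using that by (simp add: ennreal_mult_less_top)
      with Q have "?Q < top" by (rule le_less_trans)
      then have fin: "ennreal D * ?Q < top" for D by (simp add: ennreal_mult_less_top)
      \<comment> \<open>The bounds on and off \<open>K\<close> concern differently weighted L2
        norms. Each weight is positive on its own region, so together they give finiteness almost
        everywhere.\<close>
      have "AE p in lborel. ennreal (of_bool (p \<in> K_set) * out p) * wconv f g p < top"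
        by (rule AE_finite_if_l2_finite[OF _ le_less_trans[OF C2(2)[OF f g f0 g0] fin]]) measurable
      moreover have "AE p in lborel. ennreal (of_bool (p \<notin> K_set) * (psize p powr \<delta> / modulation p)) * wconv f g p < top"
        by (rule AE_finite_if_l2_finite[OF _ le_less_trans[OF C3(2)[OF f g f0 g0] fin]]) measurable
      ultimately show "AE p in lborel. wconv f g p < top"
      proof eventually_elim
        case (elim p)
        have "0 < psize p powr \<delta> / modulation p" using psize_ge_1[of p] modulation_pos[of p] by simp
        then show ?case using elim out_pos[of p]
          by (cases "p \<in> K_set") (auto simp: ennreal_mult_less_top simp del: zero_less_divide_iff)
      qed
    qed (use f g in \<open>simp_all add: adm_D\<close>)
    ultimately show ?thesis by blast
  qed
  then show ?thesis using C by (intro exI[of _ C]) auto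
qed

lemma bilin_estimates:
  "\<exists>C\<ge>0. \<forall>f g. adm f \<and> adm g \<longrightarrow>
      (let fK = restr K_set f; fKc = restr (- K_set) f;
           gK = restr K_set g; gKc = restr (- K_set) g;
           X = X_norm (\<delta> - 1) (1/2); Y = Y_norm (\<delta> - 1); Z = Z_norm (\<delta> - 1)
       in
         Z (bilin fKc gKc) \<le> ennreal C * Y fKc * Y gKc
       \<and> Z (bilin fK gK) \<le> ennreal C * X fK * X gK
       \<and> X (restr K_set (bilin fK gKc)) \<le> ennreal C * X fK * Y gKc
       \<and> Y (restr (- K_set) (bilin fK gKc)) \<le> ennreal C * X fK * Y gKc
       \<and> (Y fKc < top \<and> Y gKc < top \<longrightarrow> conv_defined (over_weight fKc) (over_weight gKc))
       \<and> (X fK < top \<and> X gK < top \<longrightarrow> conv_defined (over_weight fK) (over_weight gK))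
       \<and> (X fK < top \<and> Y gKc < top \<longrightarrow> conv_defined (over_weight fK) (over_weight gKc)))"
proof -
  let ?X = "X_norm (\<delta> - 1) (1/2)" and ?Y = "Y_norm (\<delta> - 1)" and ?Z = "Z_norm (\<delta> - 1)"
  obtain C1 where C1: "0 \<le> C1" "\<And>f g. adm f \<Longrightarrow> adm g \<Longrightarrow> ?Z (bilin f g) \<le> ennreal C1 * ?Y f * ?Y g \<and>
    (?Y f < top \<and> ?Y g < top \<longrightarrow> conv_defined (over_weight f) (over_weight g))"
    using bilin_low_low by blast
  obtain C2 where C2: "0 \<le> C2" "\<And>f g. adm f \<Longrightarrow> adm g \<Longrightarrow> \<forall>p. p \<notin> K_set \<longrightarrow> f p = 0 \<Longrightarrow> \<forall>p. p \<notin> K_set \<longrightarrow> g p = 0 \<Longrightarrow>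
    ?Z (bilin f g) \<le> ennreal C2 * ?X f * ?X g \<and>
    (?X f < top \<and> ?X g < top \<longrightarrow> conv_defined (over_weight f) (over_weight g))"
    using bilin_high_high by blast
  obtain C3 where C3: "0 \<le> C3" "\<And>f g. adm f \<Longrightarrow> adm g \<Longrightarrow> \<forall>p. p \<notin> K_set \<longrightarrow> f p = 0 \<Longrightarrow>
    ?X (restr K_set (bilin f g)) \<le> ennreal C3 * ?X f * ?Y g \<and>
    ?Y (restr (- K_set) (bilin f g)) \<le> ennreal C3 * ?X f * ?Y g \<and>
    (?X f < top \<and> ?Y g < top \<longrightarrow> conv_defined (over_weight f) (over_weight g))"
    using bilin_high_low by blast
  define C where "C = C1 + C2 + C3"
  have C: "C1 \<le> C" "C2 \<le> C" "C3 \<le> C" "0 \<le> C" using C1(1) C2(1) C3(1) by (simp_all add: C_def)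
  have mono: "x \<le> ennreal C * a * b" if "x \<le> ennreal D * a * b" "D \<le> C" for x a b D
    using that(1) by (rule order_trans) (use that(2) in \<open>intro mult_right_mono ennreal_leI; simp\<close>)
  have K0: "\<forall>p. p \<notin> K_set \<longrightarrow> restr K_set f p = 0" for f by (simp add: restr_def)
  have adm: "adm (restr K_set f)" "adm (restr (- K_set) f)" if "adm f" for f
  proof -
    have [measurable]: "f \<in> borel_measurable borel" by (rule adm_D[OF that])
    show "adm (restr K_set f)" "adm (restr (- K_set) f)"
      unfolding adm_def using adm_D(2)[OF that] by (auto simp: restr_def)
  qed
  show ?thesis
  proof (intro exI[of _ C] conjI allI impI C(4))
    fix f g assume "adm f \<and> adm g"
    then have f: "adm f" and g: "adm g" by blast+
    note LL = C1(2)[OF adm(2)[OF f] adm(2)[OF g]]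
      and HH = C2(2)[OF adm(1)[OF f] adm(1)[OF g] K0 K0]
      and HL = C3(2)[OF adm(1)[OF f] adm(2)[OF g] K0]
    show "let fK = restr K_set f; fKc = restr (- K_set) f;
           gK = restr K_set g; gKc = restr (- K_set) g;
           X = X_norm (\<delta> - 1) (1/2); Y = Y_norm (\<delta> - 1); Z = Z_norm (\<delta> - 1)
       in
         Z (bilin fKc gKc) \<le> ennreal C * Y fKc * Y gKc
       \<and> Z (bilin fK gK) \<le> ennreal C * X fK * X gK
       \<and> X (restr K_set (bilin fK gKc)) \<le> ennreal C * X fK * Y gKc
       \<and> Y (restr (- K_set) (bilin fK gKc)) \<le> ennreal C * X fK * Y gKc
       \<and> (Y fKc < top \<and> Y gKc < top \<longrightarrow> conv_defined (over_weight fKc) (over_weight gKc))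
       \<and> (X fK < top \<and> X gK < top \<longrightarrow> conv_defined (over_weight fK) (over_weight gK))
       \<and> (X fK < top \<and> Y gKc < top \<longrightarrow> conv_defined (over_weight fK) (over_weight gKc))"
      unfolding Let_def
      using mono[OF conjunct1[OF LL] C(1)] mono[OF conjunct1[OF HH] C(2)] mono[OF conjunct1[OF HL] C(3)]
        mono[OF conjunct1[OF conjunct2[OF HL]] C(3)] conjunct2[OF LL] conjunct2[OF HH] conjunct2[OF conjunct2[OF HL]]
      by (intro conjI)
  qed
qed

end

theorem proposition2p2:
  fixes s :: real
  assumes "-1 < s" and "s < 0"
  shows "\<exists>C::real. C \<ge> 0 \<and>
    (\<forall>f g :: spacetime \<Rightarrow> real.
      smooth f \<and> smooth g \<and> (\<forall>p. f p \<ge> 0) \<and> (\<forall>p. g p \<ge> 0) \<longrightarrow>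
      (let fK = restr K_set f; fKc = restr (- K_set) f;
           gK = restr K_set g; gKc = restr (- K_set) g;
           X = X_norm s (1/2); Y = Y_norm s; Z = Z_norm s
       in
         Z (bilin fKc gKc) \<le> ennreal C * Y fKc * Y gKc
       \<and> Z (bilin fK gK) \<le> ennreal C * X fK * X gK
       \<and> X (restr K_set (bilin fK gKc)) \<le> ennreal C * X fK * Y gKc
       \<and> Y (restr (- K_set) (bilin fK gKc)) \<le> ennreal C * X fK * Y gKc
       \<and> (Y fKc < top \<and> Y gKc < top \<longrightarrow> conv_defined (over_weight fKc) (over_weight gKc))
       \<and> (X fK < top \<and> X gK < top \<longrightarrow> conv_defined (over_weight fK) (over_weight gK))
       \<and> (X fK < top \<and> Y gKc < top \<longrightarrow> conv_defined (over_weight fK) (over_weight gKc))))"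
proof -
  interpret exponents "s + 1" "(s + 1) / 100"
    using assms by unfold_locales auto
  have adm: "adm f" if "smooth f" "\<forall>p. 0 \<le> f p" for f
  proof -
    have "C_n 0 f" using that(1) unfolding smooth_def by blast
    then show ?thesis using that(2) unfolding adm_def by (simp add: borel_measurable_continuous_onI)
  qed
  have s: "s + 1 - 1 = s" by simp
  show ?thesis using bilin_estimates adm unfolding s by blast
qed

end
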